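(* Let $E,F$ be operator spaces and let $C > 0$ be a constant. The following properties of a map $u : E \to F$ are equivalent. (i) $u \in \Gamma_{oh}(E,F)$ and $\gamma_{oh}(u) \leq C$. (ii) For all $v : F \to \ell_2$ such that $\pi_{2,oh}(v) \leq 1$, the composition $vu$ can be factorized as $vu = AB$ with $B : E \to OH$ completely bounded and $A : OH \to \ell_2$ Hilbert–Schmidt satisfying $\|A\|_{HS}\,\|B\|_{cb} \leq C$.
   Context: An operator space is a closed subspace $E \subset B(H)$ for some complex Hilbert space $H$, with the norms on $M_n(E)$ inherited from $M_n(B(H)) = B(H^n)$; $\|\cdot\|_{cb}$ is the completely bounded norm. Maps are (bounded) linear operators. For $E\subset B(H)$, $F \subset B(K)$, the minimal tensor product $E \otimes_{\min} F$ is the closure of $E\otimes F$ in $B(H \otimes K)$ ($H\otimes K$ the Hilbertian tensor product). For an operator space $E$, $\overline{E}$ is the conjugate operator space: the same set with conjugate scalar multiplication, $x\mapsto \overline{x}$ denoting the identity map, and $\|[\overline{x_{ij}}]\|_{M_n(\overline{E})} = \|[x_{ij}]\|_{M_n(E)}$. For an index set $I$, $OH(I)$ denotes the operator Hilbert space: the operator space whose underlying Banach space is $\ell_2(I)$ and such that, for the canonical orthonormal basis $(T_i)_{i\in I}$ (equivalently any orthonormal basis) and any finitely supported family $(x_i)_{i \in I}$ in any $B(H)$, $$\Big\|\sum x_i \otimes T_i\Big\|_{B(H)\otimes_{\min} OH(I)} = \Big\|\sum x_i \otimes \overline{x_i}\Big\|^{1/2}_{B(H)\otimes_{\min}\overline{B(H)}}.$$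 $OH$ is $OH(\mathbb{N})$, with underlying space $\ell_2$. $\|A\|_{HS}$ is the Hilbert–Schmidt norm between the underlying Hilbert spaces. $\Gamma_{oh}(E,F)$ is the space of all $u : E \to F$ for which there are an index set $I$ and completely bounded maps $B : E \to OH(I)$ and $A : OH(I) \to F$ with $u = AB$; $\gamma_{oh}(u)$ is the infimum of $\|A\|_{cb}\|B\|_{cb}$ over all such factorizations. For an operator space $E$ and a Banach space $X$, an operator $w : E \to X$ is $(2,oh)$-summing if there is a constant $C'$ such that for all finite sequences $(x_i)$ in $E$, $$\Big(\sum \|w(x_i)\|^2\Big)^{1/2} \leq C' \Big\|\sum x_i \otimes \overline{x_i}\Big\|^{1/2}_{E\otimes_{\min}\overline{E}},$$ and $\pi_{2,oh}(w)$ denotes the smallest such constant $C'$. *)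

theory Defs
  imports "HOL-Analysis.Analysis"
begin

section \<open>Complex Hilbert spaces\<close>

class complex_vector = real_vector +
  fixes scaleC :: "complex \<Rightarrow> 'a \<Rightarrow> 'a" (infixr "*\<^sub>C" 75)
  assumes scaleC_add_right: "c *\<^sub>C (x + y) = c *\<^sub>C x + c *\<^sub>C y"
    and scaleC_add_left: "(c + d) *\<^sub>C x = c *\<^sub>C x + d *\<^sub>C x"
    and scaleC_scaleC: "c *\<^sub>C (d *\<^sub>C x) = (c * d) *\<^sub>C x"
    and scaleC_one: "1 *\<^sub>C x = x"
    and scaleR_scaleC: "r *\<^sub>R x = complex_of_real r *\<^sub>C x"

interpretation complex_vector: vector_space "scaleC :: complex \<Rightarrow> 'a \<Rightarrow> 'a::complex_vector"
  by unfold_locales (auto simp: scaleC_add_right scaleC_add_left scaleC_scaleC scaleC_one)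

class complex_normed_vector = complex_vector + real_normed_vector +
  assumes norm_scaleC: "norm (c *\<^sub>C x) = cmod c * norm x"

lemma bounded_linear_scaleC_right: "bounded_linear (\<lambda>x::'a::complex_normed_vector. c *\<^sub>C x)"
  by (rule bounded_linear_intro[where K="cmod c"])
     (auto simp: scaleC_add_right scaleR_scaleC scaleC_scaleC norm_scaleC mult.commute)

lemma bounded_linear_scaleC_left: "bounded_linear (\<lambda>c. c *\<^sub>C (x::'a::complex_normed_vector))"
  by (rule bounded_linear_intro[where K="norm x"])
     (auto simp: scaleC_add_left scaleR_scaleC scaleC_scaleC norm_scaleC scaleR_conv_of_real)

text \<open>The inner product is linear in the first and conjugate linear in the second variable.
  Definiteness is contained in \<open>norm_eq_sqrt_cinner\<close>.\<close>

class chilbert_space = complex_normed_vector + complete_space +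
  fixes cinner :: "'a \<Rightarrow> 'a \<Rightarrow> complex"
  assumes cinner_add_left: "cinner (x + y) z = cinner x z + cinner y z"
    and cinner_scaleC_left: "cinner (c *\<^sub>C x) y = c * cinner x y"
    and cinner_commute: "cinner x y = cnj (cinner y x)"
    and norm_eq_sqrt_cinner: "norm x = sqrt (Re (cinner x x))"

instantiation blinfun :: (real_normed_vector, complex_normed_vector) complex_normed_vector
begin

lift_definition scaleC_blinfun :: "complex \<Rightarrow> ('a \<Rightarrow>\<^sub>L 'b) \<Rightarrow> 'a \<Rightarrow>\<^sub>L 'b"
  is "\<lambda>c f x. c *\<^sub>C f x"
  by (rule bounded_linear_compose[OF bounded_linear_scaleC_right])

instance
proof
  fix c d :: complex and f g :: "'a \<Rightarrow>\<^sub>L 'b" and r :: real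
  show "c *\<^sub>C (f + g) = c *\<^sub>C f + c *\<^sub>C g"
    by transfer (auto simp: scaleC_add_right)
  show "(c + d) *\<^sub>C f = c *\<^sub>C f + d *\<^sub>C f"
    by transfer (auto simp: scaleC_add_left)
  show "c *\<^sub>C (d *\<^sub>C f) = (c * d) *\<^sub>C f"
    by transfer (auto simp: scaleC_scaleC)
  show "1 *\<^sub>C f = f"
    by transfer (auto simp: scaleC_one)
  show "r *\<^sub>R f = complex_of_real r *\<^sub>C f"
    by transfer (auto simp: scaleR_scaleC)
  have le: "norm (c *\<^sub>C f) \<le> cmod c * norm f" for c and f :: "'a \<Rightarrow>\<^sub>L 'b"
    by (rule norm_blinfun_bound)
       (auto simp: scaleC_blinfun.rep_eq norm_scaleC mult.assoc intro!: mult_left_mono norm_blinfun)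
  show "norm (c *\<^sub>C f) = cmod c * norm f"
  proof (cases "c = 0")
    case True
    then show ?thesis using le[of 0 f] by simp
  next
    case False
    have "inverse c *\<^sub>C (c *\<^sub>C f) = f"
      using False by transfer (auto simp: scaleC_scaleC scaleC_one)
    then have "norm f \<le> inverse (cmod c) * norm (c *\<^sub>C f)"
      using le[of "inverse c" "c *\<^sub>C f"] by (simp add: norm_inverse)
    then have "cmod c * norm f \<le> norm (c *\<^sub>C f)"
      using False by (simp add: field_simps)
    then show ?thesis using le[of c f] by simp
  qed
qed

end


section \<open>The Hilbert space of square summable families\<close>

typedef 'i ell2 = "{f :: 'i \<Rightarrow> complex. (\<lambda>i. (cmod (f i))\<^sup>2) summable_on UNIV}"
  morphisms ell2_nth Abs_ell2
  by (rule exI[of _ "\<lambda>_. 0"]) simp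

setup_lifting type_definition_ell2

lemma ell2_eqI: "(\<And>i. ell2_nth f i = ell2_nth g i) \<Longrightarrow> f = g"
  by (metis ell2_nth_inject ext)

lemma square_summable_iff:
  "(\<lambda>i. (cmod (f i))\<^sup>2) summable_on UNIV \<longleftrightarrow>
    (\<exists>c. \<forall>J. finite J \<longrightarrow> L2_set (\<lambda>i. cmod (f i)) J \<le> c)"
proof
  assume s: "(\<lambda>i. (cmod (f i))\<^sup>2) summable_on UNIV"
  have "L2_set (\<lambda>i. cmod (f i)) J \<le> sqrt (\<Sum>\<^sub>\<infinity>i. (cmod (f i))\<^sup>2)" if "finite J" for J
    unfolding L2_set_def using finite_sum_le_infsum[OF s that] by (auto intro: real_sqrt_le_mono)
  then show "\<exists>c. \<forall>J. finite J \<longrightarrow> L2_set (\<lambda>i. cmod (f i)) J \<le> c" by blast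
next
  assume "\<exists>c. \<forall>J. finite J \<longrightarrow> L2_set (\<lambda>i. cmod (f i)) J \<le> c"
  then obtain c where c: "\<And>J. finite J \<Longrightarrow> L2_set (\<lambda>i. cmod (f i)) J \<le> c" by blast
  have "(\<Sum>i\<in>J. (cmod (f i))\<^sup>2) \<le> c\<^sup>2" if "finite J" for J
    using c[OF that] unfolding L2_set_def by (rule sqrt_le_D)
  then show "(\<lambda>i. (cmod (f i))\<^sup>2) summable_on UNIV"
    by (intro nonneg_bdd_above_summable_on bdd_aboveI2) auto
qed

lemma square_summable_add:
  fixes f g :: "'i \<Rightarrow> complex"
  assumes "(\<lambda>i. (cmod (f i))\<^sup>2) summable_on UNIV" "(\<lambda>i. (cmod (g i))\<^sup>2) summable_on UNIV"
  shows "(\<lambda>i. (cmod (f i + g i))\<^sup>2) summable_on UNIV"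
proof -
  obtain a b where a: "\<And>J. finite J \<Longrightarrow> L2_set (\<lambda>i. cmod (f i)) J \<le> a"
    and b: "\<And>J. finite J \<Longrightarrow> L2_set (\<lambda>i. cmod (g i)) J \<le> b"
    using assms unfolding square_summable_iff by blast
  have "L2_set (\<lambda>i. cmod (f i + g i)) J \<le> a + b" if "finite J" for J
  proof -
    have "L2_set (\<lambda>i. cmod (f i + g i)) J \<le> L2_set (\<lambda>i. cmod (f i) + cmod (g i)) J"
      by (rule L2_set_mono) (auto intro: norm_triangle_ineq)
    also have "\<dots> \<le> L2_set (\<lambda>i. cmod (f i)) J + L2_set (\<lambda>i. cmod (g i)) J"
      by (rule L2_set_triangle_ineq)
    also have "\<dots> \<le> a + b"
      using a[OF that] b[OF that] by simp
    finally show ?thesis .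
  qed
  then show ?thesis unfolding square_summable_iff by blast
qed

lemma square_summable_scale:
  fixes f :: "'i \<Rightarrow> complex"
  assumes "(\<lambda>i. (cmod (f i))\<^sup>2) summable_on UNIV"
  shows "(\<lambda>i. (cmod (c * f i))\<^sup>2) summable_on UNIV"
  using summable_on_cmult_right[OF assms, of "(cmod c)\<^sup>2"]
  by (simp add: norm_mult power_mult_distrib)

instantiation ell2 :: (type) complex_vector
begin

lift_definition zero_ell2 :: "'a ell2" is "\<lambda>_. 0" by simp
lift_definition plus_ell2 :: "'a ell2 \<Rightarrow> 'a ell2 \<Rightarrow> 'a ell2" is "\<lambda>f g i. f i + g i"
  using square_summable_add by blast
lift_definition scaleC_ell2 :: "complex \<Rightarrow> 'a ell2 \<Rightarrow> 'a ell2" is "\<lambda>c f i. c * f i"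
  using square_summable_scale by blast
lift_definition uminus_ell2 :: "'a ell2 \<Rightarrow> 'a ell2" is "\<lambda>f i. - f i" by simp
definition minus_ell2 :: "'a ell2 \<Rightarrow> 'a ell2 \<Rightarrow> 'a ell2" where "f - g = f + - g" for f g :: "'a ell2"
definition scaleR_ell2 :: "real \<Rightarrow> 'a ell2 \<Rightarrow> 'a ell2"
  where "r *\<^sub>R f = complex_of_real r *\<^sub>C f" for f :: "'a ell2"

lemmas ell2_nth_simps [simp] = zero_ell2.rep_eq plus_ell2.rep_eq scaleC_ell2.rep_eq uminus_ell2.rep_eq

lemma ell2_nth_diff [simp]: "ell2_nth (f - g) i = ell2_nth f i - ell2_nth g i"
  by (simp add: minus_ell2_def)

lemma ell2_nth_scaleR [simp]: "ell2_nth (r *\<^sub>R f) i = complex_of_real r * ell2_nth f i"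
  by (simp add: scaleR_ell2_def)

instance
  by standard (auto intro!: ell2_eqI simp: algebra_simps)

end

lemma ell2_nth_summable: "(\<lambda>i. (cmod (ell2_nth f i))\<^sup>2) summable_on UNIV"
  using ell2_nth[of f] by simp

lemma ell2_product_summable: "(\<lambda>i. ell2_nth f i * cnj (ell2_nth g i)) summable_on UNIV"
proof (rule abs_summable_summable)
  have s: "(\<lambda>i. (cmod (ell2_nth f i))\<^sup>2 + (cmod (ell2_nth g i))\<^sup>2) summable_on UNIV"
    by (intro summable_on_add ell2_nth_summable)
  show "(\<lambda>i. norm (ell2_nth f i * cnj (ell2_nth g i))) summable_on UNIV"
  proof (rule summable_on_comparison_test[OF s])
    fix i
    have "0 \<le> (cmod (ell2_nth f i) - cmod (ell2_nth g i))\<^sup>2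
        + (cmod (ell2_nth f i))\<^sup>2 + (cmod (ell2_nth g i))\<^sup>2" by simp
    then show "norm (ell2_nth f i * cnj (ell2_nth g i))
        \<le> (cmod (ell2_nth f i))\<^sup>2 + (cmod (ell2_nth g i))\<^sup>2"
      by (simp add: norm_mult power2_diff)
  qed auto
qed

instantiation ell2 :: (type) complex_normed_vector
begin

definition norm_ell2 :: "'a ell2 \<Rightarrow> real"
  where "norm f = sqrt (\<Sum>\<^sub>\<infinity>i. (cmod (ell2_nth f i))\<^sup>2)"
definition sgn_ell2 :: "'a ell2 \<Rightarrow> 'a ell2"
  where "sgn f = inverse (norm f) *\<^sub>R f" for f :: "'a ell2"
definition dist_ell2 :: "'a ell2 \<Rightarrow> 'a ell2 \<Rightarrow> real"
  where "dist f g = norm (f - g)" for f g :: "'a ell2"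
definition uniformity_ell2 :: "('a ell2 \<times> 'a ell2) filter"
  where "uniformity_ell2 = (INF e\<in>{0<..}. principal {(x, y). dist x y < e})"
definition open_ell2 :: "'a ell2 set \<Rightarrow> bool"
  where "open_ell2 U = (\<forall>x\<in>U. eventually (\<lambda>(x', y). x' = x \<longrightarrow> y \<in> U) uniformity)"

lemma L2_set_le_norm_ell2: "finite J \<Longrightarrow> L2_set (\<lambda>i. cmod (ell2_nth f i)) J \<le> norm f"
  unfolding L2_set_def norm_ell2_def
  by (intro real_sqrt_le_mono finite_sum_le_infsum ell2_nth_summable) auto

lemma norm_ell2_le:
  assumes "\<And>J. finite J \<Longrightarrow> L2_set (\<lambda>i. cmod (ell2_nth f i)) J \<le> c"
  shows "norm f \<le> c"
proof -
  have "0 \<le> c" using assms[of "{}"] by simp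
  have "(\<Sum>i\<in>J. (cmod (ell2_nth f i))\<^sup>2) \<le> c\<^sup>2" if "finite J" for J
    using assms[OF that] unfolding L2_set_def by (rule sqrt_le_D)
  then have "(\<Sum>\<^sub>\<infinity>i. (cmod (ell2_nth f i))\<^sup>2) \<le> c\<^sup>2"
    by (intro infsum_le_finite_sums ell2_nth_summable) auto
  then show ?thesis
    unfolding norm_ell2_def using \<open>0 \<le> c\<close> by (simp add: real_le_lsqrt)
qed

lemma cmod_ell2_nth_le: "cmod (ell2_nth f i) \<le> norm f"
  using L2_set_le_norm_ell2[of "{i}" f] by simp

instance
proof
  fix f g :: "'a ell2" and r :: real and c :: complex and U :: "'a ell2 set"
  show "dist f g = norm (f - g)" by (rule dist_ell2_def)
  show "sgn f = inverse (norm f) *\<^sub>R f" by (rule sgn_ell2_def)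
  show "(uniformity :: ('a ell2 \<times> 'a ell2) filter)
      = (INF e\<in>{0<..}. principal {(x, y). dist x y < e})"
    by (rule uniformity_ell2_def)
  show "open U = (\<forall>x\<in>U. eventually (\<lambda>(x', y). x' = x \<longrightarrow> y \<in> U) uniformity)"
    by (rule open_ell2_def)
  show "norm f = 0 \<longleftrightarrow> f = 0"
  proof
    assume "norm f = 0"
    then have "ell2_nth f i = 0" for i using cmod_ell2_nth_le[of f i] by simp
    then show "f = 0" by (intro ell2_eqI) simp
  qed (simp add: norm_ell2_def)
  show "norm (f + g) \<le> norm f + norm g"
  proof (rule norm_ell2_le)
    fix J :: "'a set" assume J: "finite J"
    have "L2_set (\<lambda>i. cmod (ell2_nth (f + g) i)) J
        \<le> L2_set (\<lambda>i. cmod (ell2_nth f i) + cmod (ell2_nth g i)) J"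
      by (rule L2_set_mono) (auto intro: norm_triangle_ineq)
    also have "\<dots> \<le> L2_set (\<lambda>i. cmod (ell2_nth f i)) J + L2_set (\<lambda>i. cmod (ell2_nth g i)) J"
      by (rule L2_set_triangle_ineq)
    also have "\<dots> \<le> norm f + norm g"
      by (intro add_mono L2_set_le_norm_ell2 J)
    finally show "L2_set (\<lambda>i. cmod (ell2_nth (f + g) i)) J \<le> norm f + norm g" .
  qed
  show sc: "norm (c *\<^sub>C f) = cmod c * norm f" for c
    unfolding norm_ell2_def
    by (simp add: norm_mult power_mult_distrib infsum_cmult_right' real_sqrt_mult)
  show "norm (r *\<^sub>R f) = \<bar>r\<bar> * norm f"
    using sc[of "complex_of_real r"] by (simp add: scaleR_ell2_def)
qed

end

instantiation ell2 :: (type) chilbert_space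
begin

definition cinner_ell2 :: "'a ell2 \<Rightarrow> 'a ell2 \<Rightarrow> complex"
  where "cinner f g = (\<Sum>\<^sub>\<infinity>i. ell2_nth f i * cnj (ell2_nth g i))"

instance
proof
  fix f g h :: "'a ell2" and c :: complex
  show "cinner (f + g) h = cinner f h + cinner g h"
    unfolding cinner_ell2_def
    by (simp add: distrib_right infsum_add[OF ell2_product_summable ell2_product_summable])
  show "cinner (c *\<^sub>C f) g = c * cinner f g"
    unfolding cinner_ell2_def by (simp add: mult.assoc infsum_cmult_right')
  show "cinner f g = cnj (cinner g f)"
    unfolding cinner_ell2_def by (simp flip: infsum_cnj add: mult.commute)
  have "Re (cinner f f) = (\<Sum>\<^sub>\<infinity>i. (cmod (ell2_nth f i))\<^sup>2)"
    unfolding cinner_ell2_def infsum_Re[OF ell2_product_summable, symmetric]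
    by (simp only: complex_norm_square[symmetric] Re_complex_of_real)
  then show "norm f = sqrt (Re (cinner f f))"
    by (simp only: norm_ell2_def)
next
  fix X :: "nat \<Rightarrow> 'a ell2"
  assume C: "Cauchy X"
  have "Cauchy (\<lambda>n. ell2_nth (X n) i)" for i
  proof (rule CauchyI)
    fix e :: real assume "0 < e"
    then obtain N where "\<And>m n. m \<ge> N \<Longrightarrow> n \<ge> N \<Longrightarrow> norm (X m - X n) < e"
      using CauchyD[OF C] by metis
    then have "norm (ell2_nth (X m) i - ell2_nth (X n) i) < e" if "m \<ge> N" "n \<ge> N" for m n
      using cmod_ell2_nth_le[of "X m - X n" i] that by fastforce
    then show "\<exists>M. \<forall>m\<ge>M. \<forall>n\<ge>M. norm (ell2_nth (X m) i - ell2_nth (X n) i) < e" by blast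
  qed
  then have "\<exists>l. (\<lambda>n. ell2_nth (X n) i) \<longlonglongrightarrow> l" for i
    by (simp add: Cauchy_convergent_iff convergent_def)
  then obtain l where l: "\<And>i. (\<lambda>n. ell2_nth (X n) i) \<longlonglongrightarrow> l i" by metis
  have fin: "L2_set (\<lambda>i. cmod (ell2_nth (X m) i - l i)) J \<le> e"
    if "finite J" and N: "\<And>n. n \<ge> N \<Longrightarrow> norm (X m - X n) \<le> e" for J m N e
  proof (rule tendsto_upperbound)
    show "(\<lambda>n. L2_set (\<lambda>i. cmod (ell2_nth (X m) i - ell2_nth (X n) i)) J)
        \<longlonglongrightarrow> L2_set (\<lambda>i. cmod (ell2_nth (X m) i - l i)) J"
      unfolding L2_set_def by (intro tendsto_intros l)
    show "\<forall>\<^sub>F n in sequentially. L2_set (\<lambda>i. cmod (ell2_nth (X m) i - ell2_nth (X n) i)) J \<le> e"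
    proof (rule eventually_sequentiallyI)
      fix n assume "n \<ge> N"
      have "L2_set (\<lambda>i. cmod (ell2_nth (X m - X n) i)) J \<le> e"
        using L2_set_le_norm_ell2[OF \<open>finite J\<close>] N[OF \<open>n \<ge> N\<close>] by (rule order.trans)
      then show "L2_set (\<lambda>i. cmod (ell2_nth (X m) i - ell2_nth (X n) i)) J \<le> e" by simp
    qed
  qed simp
  have cau: "\<exists>N. \<forall>m\<ge>N. \<forall>n\<ge>N. norm (X m - X n) \<le> e" if "e > 0" for e
    using CauchyD[OF C that] by (meson less_imp_le)
  obtain N where N: "\<And>n. n \<ge> N \<Longrightarrow> norm (X N - X n) \<le> 1"
    using cau[of 1] by auto
  have "(\<lambda>i. (cmod (ell2_nth (X N) i - l i))\<^sup>2) summable_on UNIV"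
    unfolding square_summable_iff by (intro exI[of _ 1] allI impI fin[OF _ N])
  then have "(\<lambda>i. (cmod (- 1 * (ell2_nth (X N) i - l i) + ell2_nth (X N) i))\<^sup>2) summable_on UNIV"
    by (intro square_summable_add square_summable_scale ell2_nth_summable)
  then have "(\<lambda>i. (cmod (l i))\<^sup>2) summable_on UNIV" by simp
  then have "ell2_nth (Abs_ell2 l) = l" by (intro Abs_ell2_inverse CollectI)
  then obtain L where L: "\<And>i. ell2_nth L i = l i" by metis
  have "X \<longlonglongrightarrow> L"
  proof (rule LIMSEQ_I)
    fix r :: real assume "0 < r"
    then obtain N where N: "\<And>m n. m \<ge> N \<Longrightarrow> n \<ge> N \<Longrightarrow> norm (X m - X n) \<le> r / 2"
      using cau[of "r / 2"] by auto
    have "norm (X m - L) \<le> r / 2" if "m \<ge> N" for m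
      using fin[OF _ N[OF that]] by (intro norm_ell2_le) (simp add: L)
    then show "\<exists>no. \<forall>n\<ge>no. norm (X n - L) < r" using \<open>0 < r\<close> by fastforce
  qed
  then show "convergent X" by (rule convergentI)
qed

end

lift_definition ell2_basis :: "'i \<Rightarrow> 'i ell2" is "\<lambda>i j. if j = i then 1 else 0"
proof -
  fix i :: 'i
  have "(\<lambda>j. (cmod (if j = i then 1 else 0))\<^sup>2) summable_on UNIV
      \<longleftrightarrow> (\<lambda>j. (cmod (if j = i then 1 else 0))\<^sup>2) summable_on {i}"
    by (rule summable_on_cong_neutral) auto
  then show "(\<lambda>j. (cmod (if j = i then 1 else 0))\<^sup>2) summable_on UNIV" by simp
qed

definition ell2_space :: "'i set \<Rightarrow> 'i ell2 set"
  where "ell2_space I = {f. \<forall>i. i \<notin> I \<longrightarrow> ell2_nth f i = 0}"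

lemma bounded_linear_ell2_nth: "bounded_linear (\<lambda>f. ell2_nth f i)"
  by (rule bounded_linear_intro[where K=1])
     (auto simp: cmod_ell2_nth_le scaleR_conv_of_real)


section \<open>The conjugate of a Hilbert space\<close>

typedef 'h conjugate = "UNIV :: 'h set"
  morphisms of_conjugate conjugate ..

setup_lifting type_definition_conjugate

instantiation conjugate :: (complex_vector) complex_vector
begin

lift_definition zero_conjugate :: "'a conjugate" is 0 .
lift_definition plus_conjugate :: "'a conjugate \<Rightarrow> 'a conjugate \<Rightarrow> 'a conjugate" is plus .
lift_definition minus_conjugate :: "'a conjugate \<Rightarrow> 'a conjugate \<Rightarrow> 'a conjugate" is minus .
lift_definition uminus_conjugate :: "'a conjugate \<Rightarrow> 'a conjugate" is uminus .
lift_definition scaleR_conjugate :: "real \<Rightarrow> 'a conjugate \<Rightarrow> 'a conjugate" is scaleR .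
lift_definition scaleC_conjugate :: "complex \<Rightarrow> 'a conjugate \<Rightarrow> 'a conjugate"
  is "\<lambda>c x. cnj c *\<^sub>C x" .

instance
  by standard
     (transfer, simp add: scaleC_add_right scaleC_add_left scaleC_scaleC scaleC_one scaleR_scaleC
        algebra_simps)+

end

instantiation conjugate :: (complex_normed_vector) complex_normed_vector
begin

lift_definition norm_conjugate :: "'a conjugate \<Rightarrow> real" is norm .
lift_definition sgn_conjugate :: "'a conjugate \<Rightarrow> 'a conjugate" is sgn .
lift_definition dist_conjugate :: "'a conjugate \<Rightarrow> 'a conjugate \<Rightarrow> real" is dist .
definition uniformity_conjugate :: "('a conjugate \<times> 'a conjugate) filter"
  where "uniformity_conjugate = (INF e\<in>{0<..}. principal {(x, y). dist x y < e})"
definition open_conjugate :: "'a conjugate set \<Rightarrow> bool"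
  where "open_conjugate U = (\<forall>x\<in>U. eventually (\<lambda>(x', y). x' = x \<longrightarrow> y \<in> U) uniformity)"

instance
proof
  fix f g :: "'a conjugate" and r :: real and c :: complex and U :: "'a conjugate set"
  show "(uniformity :: ('a conjugate \<times> 'a conjugate) filter)
      = (INF e\<in>{0<..}. principal {(x, y). dist x y < e})"
    by (rule uniformity_conjugate_def)
  show "open U = (\<forall>x\<in>U. eventually (\<lambda>(x', y). x' = x \<longrightarrow> y \<in> U) uniformity)"
    by (rule open_conjugate_def)
qed (transfer, simp add: dist_norm sgn_div_norm norm_triangle_ineq norm_scaleC)+

end

instantiation conjugate :: (chilbert_space) chilbert_space
begin

lift_definition cinner_conjugate :: "'a conjugate \<Rightarrow> 'a conjugate \<Rightarrow> complex"
  is "\<lambda>x y. cnj (cinner x y)" .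

instance
proof
  fix f g h :: "'a conjugate" and c :: complex
  show "cinner (f + g) h = cinner f h + cinner g h"
    by transfer (simp add: cinner_add_left)
  show "cinner (c *\<^sub>C f) g = c * cinner f g"
    by transfer (simp add: cinner_scaleC_left)
  show "cinner f g = cnj (cinner g f)"
    by transfer (metis cinner_commute complex_cnj_cnj)
  show "norm f = sqrt (Re (cinner f f))"
    by transfer (simp add: norm_eq_sqrt_cinner)
next
  fix X :: "nat \<Rightarrow> 'a conjugate"
  assume "Cauchy X"
  then have "Cauchy (\<lambda>n. of_conjugate (X n))"
    unfolding Cauchy_def by (simp add: dist_conjugate.rep_eq)
  then obtain l where "(\<lambda>n. of_conjugate (X n)) \<longlonglongrightarrow> l"
    by (auto simp: Cauchy_convergent_iff convergent_def)
  then have "X \<longlonglongrightarrow> conjugate l"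
    unfolding lim_sequentially by (simp add: dist_conjugate.rep_eq conjugate_inverse)
  then show "convergent X" by (rule convergentI)
qed

end

text \<open>The identification of the conjugate of \<open>B(H)\<close> with \<open>B\<close> of the conjugate of \<open>H\<close>;
  an operator is unchanged as a map on the underlying set.\<close>

lift_definition conj_op ::
    "('h::chilbert_space \<Rightarrow>\<^sub>L 'h) \<Rightarrow> ('h conjugate \<Rightarrow>\<^sub>L 'h conjugate)"
  is "\<lambda>x h. conjugate (x (of_conjugate h))"
proof -
  fix x :: "'h \<Rightarrow> 'h" assume x: "bounded_linear x"
  then obtain K where "\<And>h. norm (x h) \<le> norm h * K"
    using bounded_linear.bounded by blast
  then show "bounded_linear (\<lambda>h. conjugate (x (of_conjugate h)))"
    by (intro bounded_linear_intro[where K=K])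
       (simp_all add: plus_conjugate.rep_eq scaleR_conjugate.rep_eq norm_conjugate.rep_eq
          linear_add[OF bounded_linear.linear[OF x]] linear_scale[OF bounded_linear.linear[OF x]]
          plus_conjugate.abs_eq scaleR_conjugate.abs_eq conjugate_inverse eq_onp_def)
qed


section \<open>Operator spaces and completely bounded maps\<close>

definition bounded_operators :: "('h::chilbert_space \<Rightarrow>\<^sub>L 'h) set"
  where "bounded_operators = {x :: 'h \<Rightarrow>\<^sub>L 'h. \<forall>c h. x (c *\<^sub>C h) = c *\<^sub>C x h}"

definition operator_space :: "('h::chilbert_space \<Rightarrow>\<^sub>L 'h) set \<Rightarrow> bool"
  where "operator_space E \<longleftrightarrow>
    E \<subseteq> bounded_operators \<and> complex_vector.subspace E \<and> closed E"

text \<open>The norm of an \<open>n \<times> n\<close> matrix of operators on \<open>H\<close>, as an operator on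
  the \<open>n\<close>-fold Hilbertian direct sum of \<open>H\<close>. Only entries with indices below \<open>n\<close> matter.\<close>

definition op_matrix_norm :: "nat \<Rightarrow> (nat \<Rightarrow> nat \<Rightarrow> 'h::chilbert_space \<Rightarrow>\<^sub>L 'h) \<Rightarrow> real"
  where "op_matrix_norm n x = Inf {c. 0 \<le> c \<and>
    (\<forall>h. L2_set (\<lambda>i. norm (\<Sum>j<n. x i j (h j))) {..<n} \<le> c * L2_set (\<lambda>j. norm (h j)) {..<n})}"

text \<open>A space together with a norm on square matrices of each size. This is the data of an operator
  space on which complete boundedness depends.\<close>

record 'a matrix_normed =
  carrier :: "'a set"
  matrix_norm :: "nat \<Rightarrow> (nat \<Rightarrow> nat \<Rightarrow> 'a) \<Rightarrow> real"

definition opsp :: "('h::chilbert_space \<Rightarrow>\<^sub>L 'h) set \<Rightarrow> ('h \<Rightarrow>\<^sub>L 'h) matrix_normed"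
  where "opsp E = \<lparr>carrier = E, matrix_norm = op_matrix_norm\<rparr>"

definition clinear_between ::
    "'a::complex_vector set \<Rightarrow> 'b::complex_vector set \<Rightarrow> ('a \<Rightarrow> 'b) \<Rightarrow> bool"
  where "clinear_between E F u \<longleftrightarrow> u ` E \<subseteq> F \<and>
    (\<forall>x\<in>E. \<forall>y\<in>E. u (x + y) = u x + u y) \<and> (\<forall>c. \<forall>x\<in>E. u (c *\<^sub>C x) = c *\<^sub>C u x)"

definition bounded_clinear_between ::
    "'a::complex_normed_vector set \<Rightarrow> 'b::complex_normed_vector set \<Rightarrow> ('a \<Rightarrow> 'b) \<Rightarrow> bool"
  where "bounded_clinear_between E F u \<longleftrightarrow>
    clinear_between E F u \<and> (\<exists>K. \<forall>x\<in>E. norm (u x) \<le> K * norm x)"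

definition cb_bound :: "'a matrix_normed \<Rightarrow> 'b matrix_normed \<Rightarrow> ('a \<Rightarrow> 'b) \<Rightarrow> real \<Rightarrow> bool"
  where "cb_bound E F u c \<longleftrightarrow> 0 \<le> c \<and>
    (\<forall>n x. (\<forall>i<n. \<forall>j<n. x i j \<in> carrier E) \<longrightarrow>
      matrix_norm F n (\<lambda>i j. u (x i j)) \<le> c * matrix_norm E n x)"

definition completely_bounded ::
    "'a::complex_vector matrix_normed \<Rightarrow> 'b::complex_vector matrix_normed \<Rightarrow> ('a \<Rightarrow> 'b) \<Rightarrow> bool"
  where "completely_bounded E F u \<longleftrightarrow>
    clinear_between (carrier E) (carrier F) u \<and> (\<exists>c. cb_bound E F u c)"

definition cb_norm :: "'a matrix_normed \<Rightarrow> 'b matrix_normed \<Rightarrow> ('a \<Rightarrow> 'b) \<Rightarrow> real"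
  where "cb_norm E F u = Inf {c. cb_bound E F u c}"

lemma conj_op_scaleC: "conj_op (c *\<^sub>C x) = cnj c *\<^sub>C conj_op x"
  by (rule blinfun_eqI)
     (simp add: conj_op.rep_eq scaleC_blinfun.rep_eq scaleC_conjugate.abs_eq)

lemma op_matrix_norm_conj_op: "op_matrix_norm n (\<lambda>i j. conj_op (x i j)) = op_matrix_norm n x"
proof -
  have sum: "(\<Sum>j<n. conjugate (y j)) = conjugate (\<Sum>j<n. y j)" for y :: "nat \<Rightarrow> 'a"
    by (induction n) (simp_all add: zero_conjugate.abs_eq plus_conjugate.abs_eq)
  have all: "(\<forall>h::nat \<Rightarrow> 'a conjugate. P h) \<longleftrightarrow> (\<forall>h. P (\<lambda>j. conjugate (h j)))" for P
  proof (intro iffI allI)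
    fix h :: "nat \<Rightarrow> 'a conjugate" assume *: "\<forall>h. P (\<lambda>j. conjugate (h j))"
    show "P h" using *[rule_format, of "\<lambda>j. of_conjugate (h j)"] by (simp add: of_conjugate_inverse)
  qed blast
  show ?thesis
    unfolding op_matrix_norm_def
    by (subst all) (simp add: conj_op.rep_eq conjugate_inverse sum norm_conjugate.rep_eq)
qed


section \<open>The minimal tensor norm\<close>

text \<open>The norm in the Hilbertian tensor product of the finite sum over \<open>p \<in> P\<close> of the elementary
  tensors \<open>h p \<otimes> k p\<close>.\<close>

definition tensor_norm ::
    "'p set \<Rightarrow> ('p \<Rightarrow> 'h::chilbert_space) \<Rightarrow> ('p \<Rightarrow> 'k::chilbert_space) \<Rightarrow> real"
  where "tensor_norm P h k =
    sqrt (Re (\<Sum>p\<in>P. \<Sum>q\<in>P. cinner (h p) (h q) * cinner (k p) (k q)))"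

text \<open>The operator norm of the sum over \<open>i \<in> J\<close> of \<open>x i \<otimes> y i\<close> on the Hilbertian tensor product
  of \<open>H\<close> and \<open>K\<close> (\<open>J\<close> finite). It is determined on the dense subspace of finite sums of elementary
  tensors.\<close>

definition min_tensor_norm ::
    "'i set \<Rightarrow> ('i \<Rightarrow> 'h::chilbert_space \<Rightarrow>\<^sub>L 'h) \<Rightarrow> ('i \<Rightarrow> 'k::chilbert_space \<Rightarrow>\<^sub>L 'k) \<Rightarrow> real"
  where "min_tensor_norm J x y = Inf {c. 0 \<le> c \<and>
    (\<forall>m h k. tensor_norm (J \<times> {..<m}) (\<lambda>(i, p). x i (h p)) (\<lambda>(i, p). y i (k p))
      \<le> c * tensor_norm {..<m::nat} h k)}"

definition conj_square_norm :: "'i set \<Rightarrow> ('i \<Rightarrow> 'h::chilbert_space \<Rightarrow>\<^sub>L 'h) \<Rightarrow> real"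
  where "conj_square_norm J x = sqrt (min_tensor_norm J x (\<lambda>i. conj_op (x i)))"


section \<open>The operator Hilbert space\<close>

text \<open>The scalar matrix with entries \<open>a k l\<close>, \<open>k, l < n\<close>, as an operator on \<open>\<ell>\<^sub>2\<close>,
  that is, the compression algebra \<open>M\<^sub>n\<close> sitting isometrically in the upper left corner of
  \<open>B(\<ell>\<^sub>2)\<close>.\<close>

lift_definition corner_op :: "nat \<Rightarrow> (nat \<Rightarrow> nat \<Rightarrow> complex) \<Rightarrow> nat ell2 \<Rightarrow>\<^sub>L nat ell2"
  is "\<lambda>n a f. \<Sum>k<n. (\<Sum>l<n. a k l * ell2_nth f l) *\<^sub>C ell2_basis k"
  by (intro bounded_linear_sum bounded_linear_compose[OF bounded_linear_scaleC_left]
        bounded_linear_compose[OF bounded_linear_mult_right] bounded_linear_ell2_nth)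

text \<open>Writing a matrix over \<open>\<ell>\<^sub>2(I)\<close> as the sum over \<open>i\<close> of \<open>x i \<otimes> T i\<close> with coefficients
  \<open>x i \<in> M\<^sub>n\<close>, its norm in \<open>M\<^sub>n(OH(I))\<close> is given by the defining formula of \<open>OH(I)\<close>, applied to
  \<open>x i \<in> M\<^sub>n \<subseteq> B(\<ell>\<^sub>2)\<close>, if the support is finite, and by continuity in general.\<close>

definition oh_matrix_norm :: "nat \<Rightarrow> (nat \<Rightarrow> nat \<Rightarrow> 'i ell2) \<Rightarrow> real"
  where "oh_matrix_norm n X = Lim (finite_subsets_at_top UNIV)
    (\<lambda>J. conj_square_norm J (\<lambda>i. corner_op n (\<lambda>k l. ell2_nth (X k l) i)))"

definition OH :: "'i set \<Rightarrow> 'i ell2 matrix_normed"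
  where "OH I = \<lparr>carrier = ell2_space I, matrix_norm = oh_matrix_norm\<rparr>"

lemma corner_op_eq_0: "(\<And>k l. k < n \<Longrightarrow> l < n \<Longrightarrow> a k l = 0) \<Longrightarrow> corner_op n a = 0"
  by (rule blinfun_eqI) (simp add: corner_op.rep_eq)

lemma min_tensor_norm_superset:
  assumes "finite J'" "J \<subseteq> J'" "\<And>i. i \<in> J' - J \<Longrightarrow> x i = 0"
  shows "min_tensor_norm J' x y = min_tensor_norm J x y"
proof -
  have c0: "cinner 0 a = 0" "cinner a 0 = 0" for a :: "'x::chilbert_space"
    using cinner_scaleC_left[of 0 0 a] cinner_commute[of a 0] by auto
  have "tensor_norm (J' \<times> {..<m}) (\<lambda>(i, p). x i (h p)) (\<lambda>(i, p). y i (k p))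
      = tensor_norm (J \<times> {..<m}) (\<lambda>(i, p). x i (h p)) (\<lambda>(i, p). y i (k p))"
    for m :: nat and h k
  proof -
    let ?g = "\<lambda>p q. cinner (case p of (i, p) \<Rightarrow> x i (h p)) (case q of (i, p) \<Rightarrow> x i (h p))
      * cinner (case p of (i, p) \<Rightarrow> y i (k p)) (case q of (i, p) \<Rightarrow> y i (k p))"
    have fin: "finite (J' \<times> {..<m})" and sub: "J \<times> {..<m} \<subseteq> J' \<times> {..<m}"
      using assms by auto
    have g0: "?g p q = 0" "?g q p = 0" if pq: "q \<in> J' \<times> {..<m} - J \<times> {..<m}" for p q
    proof -
      obtain i l where q: "q = (i, l)" "i \<in> J' - J" using pq by auto
      then have "x i = 0" using assms(3) by blast
      then show "?g p q = 0" "?g q p = 0" by (simp_all add: q(1) c0)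
    qed
    have inner: "sum (?g p) (J \<times> {..<m}) = sum (?g p) (J' \<times> {..<m})" for p
      by (rule sum.mono_neutral_left[OF fin sub]) (use g0 in blast)
    have "(\<Sum>p\<in>J \<times> {..<m}. sum (?g p) (J' \<times> {..<m})) = (\<Sum>p\<in>J' \<times> {..<m}. sum (?g p) (J' \<times> {..<m}))"
    proof (rule sum.mono_neutral_left[OF fin sub], intro ballI)
      fix p assume "p \<in> J' \<times> {..<m} - J \<times> {..<m}"
      then show "sum (?g p) (J' \<times> {..<m}) = 0" by (intro sum.neutral ballI g0(2))
    qed
    then show ?thesis unfolding tensor_norm_def inner by simp
  qed
  then show ?thesis unfolding min_tensor_norm_def by simp
qed

lemma oh_matrix_norm_finite_support:
  assumes J: "finite J" and X: "\<And>k l i. k < n \<Longrightarrow> l < n \<Longrightarrow> i \<notin> J \<Longrightarrow> ell2_nth (X k l) i = 0"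
  shows "oh_matrix_norm n X = conj_square_norm J (\<lambda>i. corner_op n (\<lambda>k l. ell2_nth (X k l) i))"
  unfolding oh_matrix_norm_def
proof (rule tendsto_Lim)
  let ?f = "\<lambda>J. conj_square_norm J (\<lambda>i. corner_op n (\<lambda>k l. ell2_nth (X k l) i))"
  have "?f J' = ?f J" if "finite J'" "J \<subseteq> J'" for J'
  proof -
    have "corner_op n (\<lambda>k l. ell2_nth (X k l) i) = 0" if "i \<in> J' - J" for i
      using that by (intro corner_op_eq_0 X) auto
    then show ?thesis
      unfolding conj_square_norm_def by (simp only: min_tensor_norm_superset[OF that])
  qed
  then have "\<forall>\<^sub>F J' in finite_subsets_at_top UNIV. ?f J' = ?f J"
    unfolding eventually_finite_subsets_at_top using J by blast
  then show "(?f \<longlongrightarrow> ?f J) (finite_subsets_at_top UNIV)"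
    by (rule tendsto_eventually)
qed simp


section \<open>Factorization through the operator Hilbert space\<close>

text \<open>HOL cannot quantify over the type of the elements of the index set \<open>I\<close>, so that type is a
  parameter.\<close>

definition oh_factorization :: "('h::chilbert_space \<Rightarrow>\<^sub>L 'h) set \<Rightarrow> ('k::chilbert_space \<Rightarrow>\<^sub>L 'k) set \<Rightarrow>
    (('h \<Rightarrow>\<^sub>L 'h) \<Rightarrow> ('k \<Rightarrow>\<^sub>L 'k)) \<Rightarrow>
    'i set \<Rightarrow> ('i ell2 \<Rightarrow> ('k \<Rightarrow>\<^sub>L 'k)) \<Rightarrow> (('h \<Rightarrow>\<^sub>L 'h) \<Rightarrow> 'i ell2) \<Rightarrow> bool"
  where "oh_factorization E F u I A B \<longleftrightarrow>
    completely_bounded (opsp E) (OH I) B \<and> completely_bounded (OH I) (opsp F) A \<and>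
    (\<forall>x\<in>E. u x = A (B x))"

definition Gamma_oh :: "'i itself \<Rightarrow> ('h::chilbert_space \<Rightarrow>\<^sub>L 'h) set \<Rightarrow>
    ('k::chilbert_space \<Rightarrow>\<^sub>L 'k) set \<Rightarrow> (('h \<Rightarrow>\<^sub>L 'h) \<Rightarrow> ('k \<Rightarrow>\<^sub>L 'k)) set"
  where "Gamma_oh _ E F = {u. \<exists>(I :: 'i set) A B. oh_factorization E F u I A B}"

definition gamma_oh :: "'i itself \<Rightarrow> ('h::chilbert_space \<Rightarrow>\<^sub>L 'h) set \<Rightarrow>
    ('k::chilbert_space \<Rightarrow>\<^sub>L 'k) set \<Rightarrow> (('h \<Rightarrow>\<^sub>L 'h) \<Rightarrow> ('k \<Rightarrow>\<^sub>L 'k)) \<Rightarrow> real"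
  where "gamma_oh _ E F u = Inf {cb_norm (OH I) (opsp F) A * cb_norm (opsp E) (OH I) B |
    (I :: 'i set) A B. oh_factorization E F u I A B}"


section \<open>Summing and Hilbert--Schmidt maps\<close>

definition two_oh_bound ::
    "('k::chilbert_space \<Rightarrow>\<^sub>L 'k) set \<Rightarrow> (('k \<Rightarrow>\<^sub>L 'k) \<Rightarrow> 'x::complex_normed_vector) \<Rightarrow> real \<Rightarrow> bool"
  where "two_oh_bound E w C \<longleftrightarrow> 0 \<le> C \<and>
    (\<forall>n x. (\<forall>i<n. x i \<in> E) \<longrightarrow>
      L2_set (\<lambda>i. norm (w (x i))) {..<n::nat} \<le> C * conj_square_norm {..<n} x)"

definition two_oh_summing ::
    "('k::chilbert_space \<Rightarrow>\<^sub>L 'k) set \<Rightarrow> (('k \<Rightarrow>\<^sub>L 'k) \<Rightarrow> 'x::complex_normed_vector) \<Rightarrow> bool"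
  where "two_oh_summing E w \<longleftrightarrow> (\<exists>C. two_oh_bound E w C)"

definition pi_2oh ::
    "('k::chilbert_space \<Rightarrow>\<^sub>L 'k) set \<Rightarrow> (('k \<Rightarrow>\<^sub>L 'k) \<Rightarrow> 'x::complex_normed_vector) \<Rightarrow> real"
  where "pi_2oh E w = Inf {C. two_oh_bound E w C}"

definition hilbert_schmidt :: "('i ell2 \<Rightarrow> 'x::chilbert_space) \<Rightarrow> bool"
  where "hilbert_schmidt A \<longleftrightarrow> bounded_clinear_between UNIV UNIV A \<and>
    (\<lambda>i. (norm (A (ell2_basis i)))\<^sup>2) summable_on UNIV"

definition hs_norm :: "('i ell2 \<Rightarrow> 'x::chilbert_space) \<Rightarrow> real"
  where "hs_norm A = sqrt (\<Sum>\<^sub>\<infinity>i. (norm (A (ell2_basis i)))\<^sup>2)"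

end

theory Submission
  imports Defs
begin

text \<open>The operator \<open>\<Sum> x i \<otimes> \<bar>x i\<close> acts on Hilbert--Schmidt operators as a positive map, so its norm is a
  supremum of sums of the positive forms \<open>q y = \<Sum> \<bar>\<langle>y h\<^sub>l, h'\<^sub>k\<rangle>\<bar>\<^sup>2\<close>. Consequently a complete contraction
  from \<open>E\<close> into some \<open>OH(I)\<close> amounts to a positive sesquilinear form \<open>s\<close> on \<open>E\<close> that satisfies a family of
  linear inequalities, and \<open>u\<close> factors with constant \<open>C\<close> through the Hilbert space of such an \<open>s\<close> if and only
  if the trace of each form \<open>q \<circ> u\<close> relative to \<open>s\<close> is at most \<open>C\<^sup>2\<close>. By optimising over scalars this
  becomes a family of inequalities affine in \<open>s\<close>, and the set of admissible \<open>s\<close> is convex and compact. The second property,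
  applied to finite rank maps \<open>v\<close> whose coefficients are those of an average of forms \<open>q\<close>, provides an \<open>s\<close>
  for every such average; by a minimax argument some \<open>s\<close> then works for all \<open>q\<close> simultaneously. Conversely,
  compactness shows that the infimum defining \<open>\<gamma>\<^sub>o\<^sub>h(u)\<close> is attained, and a map \<open>v\<close>
  with \<open>\<pi>\<^sub>2\<^sub>,\<^sub>o\<^sub>h(v) \<le> 1\<close> composed with a map \<open>A : OH(I) \<rightarrow> F\<close> is Hilbert--Schmidt of norm at most that of \<open>A\<close>, because the canonical basis is mapped to a
  family \<open>y\<close> with \<open>\<parallel>\<Sum> y i \<otimes> \<bar>y i\<parallel> \<le> \<parallel>A\<parallel>\<^sup>2\<close>.\<close>

\<comment> \<open>Property (ii) yields a form that depends on \<open>v\<close>, whereas a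
  factorization needs one form for all tests; this order of quantifiers is the obstacle behind the
  use of convexity and compactness. A trace relative to \<open>s\<close> is not affine in
  \<open>s\<close>, but it is a supremum of affine expressions, by the scalar fact that
  \<open>a\<^sup>2 / q\<close> is the maximum over real \<open>r\<close> of
  \<open>2 * r * a - r\<^sup>2 * q\<close>. The normalization of the tests comes from
  Hilbert-Schmidt geometry. Since the singular values of a tensor can be shared equally between its
  two factors, the Cauchy-Schwarz inequality separates \<open>x\<close> from its conjugate, and what
  remains are two positive tests of the same size. The index type in the statement has to carry the
  Hilbert space of any form on \<open>E\<close>. In
  \<open>'i + ('h \<Rightarrow>\<^sub>L 'h)\<close> every operator can name a basis vector of its
  own, and \<open>'i\<close> is arbitrary further room. The constant \<open>C\<close> is exact on
  both sides although \<open>gamma_oh\<close> is an infimum and the minimax step loses an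
  arbitrarily small amount: both losses disappear by compactness.\<close>
subclass (in chilbert_space) banach ..

section \<open>Positive sesquilinear forms and Hilbert spaces\<close>

text \<open>Semidefinite rather than definite, so that the condition survives pointwise limits and
  holds for the zero form. Conjugate linearity in the second argument follows from the Hermitian
  symmetry.\<close>

definition psd_form :: "'a::complex_vector set \<Rightarrow> ('a \<Rightarrow> 'a \<Rightarrow> complex) \<Rightarrow> bool"
  where "psd_form V s \<longleftrightarrow>
    (\<forall>x\<in>V. \<forall>y\<in>V. \<forall>z\<in>V. s (x + y) z = s x z + s y z) \<and>
    (\<forall>c. \<forall>x\<in>V. \<forall>z\<in>V. s (c *\<^sub>C x) z = c * s x z) \<and>
    (\<forall>x\<in>V. \<forall>z\<in>V. s x z = cnj (s z x)) \<and>
    (\<forall>x\<in>V. 0 \<le> Re (s x x))"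

lemma psd_formD:
  assumes "psd_form V s"
  shows psd_form_add: "\<And>x y z. x \<in> V \<Longrightarrow> y \<in> V \<Longrightarrow> z \<in> V \<Longrightarrow> s (x + y) z = s x z + s y z"
    and psd_form_scale: "\<And>c x z. x \<in> V \<Longrightarrow> z \<in> V \<Longrightarrow> s (c *\<^sub>C x) z = c * s x z"
    and psd_form_commute: "\<And>x z. x \<in> V \<Longrightarrow> z \<in> V \<Longrightarrow> s x z = cnj (s z x)"
    and psd_form_nonneg: "\<And>x. x \<in> V \<Longrightarrow> 0 \<le> Re (s x x)"
  using assms unfolding psd_form_def by blast+

lemma psd_form_real:
  assumes "psd_form V s" "x \<in> V"
  shows "s x x = complex_of_real (Re (s x x))"
proof -
  have "s x x = cnj (s x x)" using psd_form_commute[OF assms(1)] assms(2) by blast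
  then show ?thesis by (metis Reals_cnj_iff of_real_Re)
qed

lemma psd_form_right:
  assumes s: "psd_form V s" and V: "complex_vector.subspace V"
    and "x \<in> V" "y \<in> V" "z \<in> V"
  shows "s z (x + y) = s z x + s z y" "s z (c *\<^sub>C x) = cnj c * s z x"
proof -
  have xy: "x + y \<in> V" "c *\<^sub>C x \<in> V"
    using V assms by (auto intro: complex_vector.subspace_add complex_vector.subspace_scale)
  have "s z (x + y) = cnj (s (x + y) z)" using psd_form_commute[OF s \<open>z \<in> V\<close> xy(1)] by simp
  also have "\<dots> = cnj (s x z) + cnj (s y z)" using psd_form_add[OF s] assms by simp
  also have "\<dots> = s z x + s z y" using psd_form_commute[OF s] assms by metis
  finally show "s z (x + y) = s z x + s z y" .
  have "s z (c *\<^sub>C x) = cnj (s (c *\<^sub>C x) z)" using psd_form_commute[OF s \<open>z \<in> V\<close> xy(2)] by simp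
  also have "\<dots> = cnj c * cnj (s x z)" using psd_form_scale[OF s] assms by simp
  also have "\<dots> = cnj c * s z x" using psd_form_commute[OF s] assms by metis
  finally show "s z (c *\<^sub>C x) = cnj c * s z x" .
qed

text \<open>Nonnegativity of \<open>s\<close> at \<open>x - r * s x y * y\<close> is a quadratic
  inequality in the real number \<open>r\<close>. The optimal \<open>r = 1 / s y y\<close> exists
  only if \<open>s y y\<close> is nonzero, hence the case distinction.\<close>

lemma psd_form_Cauchy_Schwarz:
  assumes s: "psd_form V s" and V: "complex_vector.subspace V" and x: "x \<in> V" and y: "y \<in> V"
  shows "(cmod (s x y))\<^sup>2 \<le> Re (s x x) * Re (s y y)"
proof -
  define a b c where "a = Re (s x x)" and "b = Re (s y y)" and "c = s x y"
  have ab: "0 \<le> a" "0 \<le> b" unfolding a_def b_def using psd_form_nonneg[OF s] x y by auto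
  have sx: "s x x = of_real a" and sy: "s y y = of_real b"
    unfolding a_def b_def using psd_form_real[OF s] x y by auto
  have main: "0 \<le> a - 2 * r * (cmod c)\<^sup>2 + r\<^sup>2 * (cmod c)\<^sup>2 * b" for r :: real
  proof -
    define z where "z = - (of_real r * c)"
    have zy: "z *\<^sub>C y \<in> V" using V y by (auto intro: complex_vector.subspace_scale)
    then have w: "x + z *\<^sub>C y \<in> V" using V x by (auto intro: complex_vector.subspace_add)
    have "s (x + z *\<^sub>C y) (x + z *\<^sub>C y) = s x x + cnj z * s x y + z * s y x + z * cnj z * s y y"
      using psd_form_add[OF s x zy w] psd_form_right(1)[OF s V x zy]
        psd_form_right(2)[OF s V y y] psd_form_right(2)[OF s V y y] psd_form_right(2)[OF s V y x]
        psd_form_scale[OF s y] x y zy w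
      by (simp add: algebra_simps)
    moreover have "s y x = cnj c" unfolding c_def using psd_form_commute[OF s y x] .
    ultimately have "s (x + z *\<^sub>C y) (x + z *\<^sub>C y)
        = of_real a + cnj z * c + z * cnj c + (z * cnj z) * of_real b"
      by (simp add: sx sy c_def)
    also have "\<dots> = of_real (a - 2 * r * (cmod c)\<^sup>2 + r\<^sup>2 * (cmod c)\<^sup>2 * b)"
    proof -
      have cc: "c * cnj c = of_real ((cmod c)\<^sup>2)" by (metis complex_norm_square)
      have "cnj z * c = - of_real r * (c * cnj c)" "z * cnj c = - of_real r * (c * cnj c)"
        "z * cnj z = of_real (r\<^sup>2) * (c * cnj c)"
        by (simp_all add: z_def power2_eq_square)
      then show ?thesis unfolding cc by (simp add: algebra_simps)
    qed
    finally show ?thesis using psd_form_nonneg[OF s w] by simp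
  qed
  show ?thesis
  proof (cases "b = 0")
    case True
    have "(cmod c)\<^sup>2 = 0"
    proof (rule ccontr)
      assume n: "(cmod c)\<^sup>2 \<noteq> 0"
      \<comment> \<open>For \<open>b = 0\<close> the inequality is linear in \<open>r\<close>; this
        \<open>r\<close> makes its right side \<open>- a - 2\<close>.\<close>
      have "0 \<le> a - 2 * ((a + 1) / (cmod c)\<^sup>2) * (cmod c)\<^sup>2"
        using main[of "(a + 1) / (cmod c)\<^sup>2"] True by simp
      also have "\<dots> = a - 2 * (a + 1)" using n by simp
      finally show False using ab by simp
    qed
    then show ?thesis using True by (simp add: b_def c_def)
  next
    case False
    then have "0 < b" using ab by simp
    have "0 \<le> a - 2 * (1 / b) * (cmod c)\<^sup>2 + (1 / b)\<^sup>2 * (cmod c)\<^sup>2 * b" by (rule main)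
    also have "\<dots> = a - (cmod c)\<^sup>2 / b" using \<open>0 < b\<close> by (simp add: power2_eq_square field_simps)
    finally have "(cmod c)\<^sup>2 \<le> a * b" using \<open>0 < b\<close> by (simp add: field_simps)
    then show ?thesis by (simp add: a_def b_def c_def)
  qed
qed

lemma psd_form_Cauchy_Schwarz_sqrt:
  assumes "psd_form V s" "complex_vector.subspace V" "x \<in> V" "y \<in> V"
  shows "cmod (s x y) \<le> sqrt (Re (s x x)) * sqrt (Re (s y y))"
  using psd_form_Cauchy_Schwarz[OF assms] by (metis real_le_rsqrt real_sqrt_mult)

section \<open>Calculus of the inner product\<close>

lemma cinner_scaleC_right: "cinner x (c *\<^sub>C y) = cnj c * cinner x y"
  by (metis cinner_commute cinner_scaleC_left complex_cnj_mult)

lemma cinner_add_right: "cinner x (y + z) = cinner x y + cinner x z"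
  by (metis cinner_add_left cinner_commute complex_cnj_add)

declare scaleC_one [simp]

lemma cinner_zero [simp]: "cinner 0 x = 0" "cinner x 0 = 0"
  using cinner_scaleC_left[of 0 0 x] cinner_scaleC_right[of x 0 0] by simp_all

lemma cinner_minus [simp]: "cinner (- x) y = - cinner x y" "cinner x (- y) = - cinner x y"
  using cinner_scaleC_left[of "-1" x y] cinner_scaleC_right[of x "-1" y]
  by simp_all

lemma cinner_diff_left: "cinner (x - y) z = cinner x z - cinner y z"
  using cinner_add_left[of x "- y" z] by simp

lemma cinner_diff_right: "cinner x (y - z) = cinner x y - cinner x z"
  using cinner_add_right[of x y "- z"] by simp

lemma cinner_sum_left: "cinner (\<Sum>i\<in>A. f i) x = (\<Sum>i\<in>A. cinner (f i) x)"
  by (induction A rule: infinite_finite_induct) (simp_all add: cinner_add_left)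

lemma cinner_sum_right: "cinner x (\<Sum>i\<in>A. f i) = (\<Sum>i\<in>A. cinner x (f i))"
  by (induction A rule: infinite_finite_induct) (simp_all add: cinner_add_right)

lemma power2_norm_eq_Re_cinner: "(norm x)\<^sup>2 = Re (cinner x x)"
  by (metis norm_eq_sqrt_cinner norm_ge_zero real_sqrt_ge_0_iff real_sqrt_pow2)

lemma psd_form_cinner: "psd_form UNIV cinner"
  unfolding psd_form_def
  using cinner_commute by (auto simp: cinner_add_left cinner_scaleC_left simp flip: power2_norm_eq_Re_cinner)

lemma cinner_self: "cinner x x = of_real ((norm x)\<^sup>2)"
  using psd_form_real[OF psd_form_cinner] by (auto simp: power2_norm_eq_Re_cinner)

lemma cinner_Cauchy_Schwarz: "cmod (cinner x y) \<le> norm x * norm y"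
  using psd_form_Cauchy_Schwarz_sqrt[OF psd_form_cinner complex_vector.subspace_UNIV, of x y]
  by (simp add: norm_eq_sqrt_cinner)

lemma bounded_linear_cinner_left: "bounded_linear (\<lambda>x. cinner x y)"
  by (rule bounded_linear_intro[where K="norm y"])
     (auto simp: cinner_add_left scaleR_scaleC cinner_scaleC_left cinner_Cauchy_Schwarz
        scaleR_conv_of_real)

lemmas tendsto_cinner_left = bounded_linear.tendsto[OF bounded_linear_cinner_left]

lemma cinner_eq_zero_iff_norm: "(\<And>y. cinner x y = 0) \<Longrightarrow> x = 0"
  using cinner_self[of x] by simp

lemma norm_add_squared: "(norm (x + y))\<^sup>2 = (norm x)\<^sup>2 + 2 * Re (cinner x y) + (norm y)\<^sup>2"
proof -
  have "Re (cinner y x) = Re (cinner x y)" by (metis cinner_commute complex_cnj(1) complex.sel(1) cnj.simps(1))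
  then show ?thesis by (simp add: power2_norm_eq_Re_cinner cinner_add_left cinner_add_right)
qed

lemma norm_diff_squared: "(norm (x - y))\<^sup>2 = (norm x)\<^sup>2 - 2 * Re (cinner x y) + (norm (y :: 'a :: chilbert_space))\<^sup>2"
  using norm_add_squared[of x "- y"] by simp

lemma sum_cmod_mult_le:
  "(\<Sum>i\<in>A. cmod (f i) * cmod (g i)) \<le> sqrt (\<Sum>i\<in>A. (cmod (f i))\<^sup>2) * sqrt (\<Sum>i\<in>A. (cmod (g i))\<^sup>2)"
  using L2_set_mult_ineq[of "\<lambda>i. cmod (f i)" "\<lambda>i. cmod (g i)" A] by (simp add: L2_set_def)

lemma sum_norm_mult_le:
  "(\<Sum>i\<in>A. norm (f i) * norm (g i)) \<le> sqrt (\<Sum>i\<in>A. (norm (f i))\<^sup>2) * sqrt (\<Sum>i\<in>A. (norm (g i))\<^sup>2)"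
  using L2_set_mult_ineq[of "\<lambda>i. norm (f i)" "\<lambda>i. norm (g i)" A] by (simp add: L2_set_def)

text \<open>Instead of projecting onto a closed subspace, minimise \<open>\<parallel>a\<parallel>\<^sup>2 - 2 Re (f a)\<close>: a minimising sequence
  is Cauchy by the parallelogram law.\<close>

lemma Riesz_subspace:
  fixes M :: "'a::chilbert_space set" and f :: "'a \<Rightarrow> complex"
  assumes M: "complex_vector.subspace M"
    and add: "\<And>a b. a \<in> M \<Longrightarrow> b \<in> M \<Longrightarrow> f (a + b) = f a + f b"
    and scale: "\<And>c a. a \<in> M \<Longrightarrow> f (c *\<^sub>C a) = c * f a"
    and K: "\<And>a. a \<in> M \<Longrightarrow> cmod (f a) \<le> K * norm a"
  shows "\<exists>p\<in>closure M. \<forall>a\<in>M. cinner a p = f a"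
proof -
  define \<phi> where "\<phi> a = (norm a)\<^sup>2 - 2 * Re (f a)" for a
  define m where "m = Inf (\<phi> ` M)"
  have z: "0 \<in> M" using M by (rule complex_vector.subspace_0)
  have lb: "- K\<^sup>2 \<le> \<phi> a" if "a \<in> M" for a
  proof -
    have "Re (f a) \<le> K * norm a" using K[OF that] complex_Re_le_cmod[of "f a"] by linarith
    moreover have "0 \<le> (norm a - K)\<^sup>2" by simp
    ultimately show ?thesis unfolding \<phi>_def by (simp add: power2_diff mult.commute)
  qed
  have bdd: "bdd_below (\<phi> ` M)" by (rule bdd_belowI2[of _ "- K\<^sup>2"]) (rule lb)
  have mle: "m \<le> \<phi> a" if "a \<in> M" for a unfolding m_def using that bdd by (intro cInf_lower) auto
  have "\<exists>a\<in>M. \<phi> a < m + e" if "e > 0" for e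
  proof -
    have "Inf (\<phi> ` M) < m + e" using that by (simp add: m_def)
    then show ?thesis using cInf_less_iff[OF _ bdd] z by blast
  qed
  then have "\<exists>a. \<forall>n::nat. a n \<in> M \<and> \<phi> (a n) < m + inverse (real (Suc n))"
    by (intro choice) (metis inverse_positive_iff_positive of_nat_0_less_iff zero_less_Suc)
  then obtain a where a: "\<And>n. a n \<in> M" and \<phi>a: "\<And>n::nat. \<phi> (a n) < m + inverse (real (Suc n))" by blast
  \<comment> \<open>The parallelogram law at the midpoint \<open>?h\<close>, where
    \<open>\<phi>\<close> is still at least the infimum \<open>m\<close>.\<close>
  have dist: "(norm (a i - a j))\<^sup>2 \<le> 2 * (inverse (real (Suc i)) + inverse (real (Suc j)))" for i j
  proof -
    let ?h = "(1/2) *\<^sub>C (a i + a j)"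
    have sum: "a i + a j \<in> M" using M a by (blast intro: complex_vector.subspace_add)
    have h: "?h \<in> M" using M sum by (blast intro: complex_vector.subspace_scale)
    have "\<phi> ?h = (norm (a i + a j))\<^sup>2 / 4 - Re (f (a i)) - Re (f (a j))"
    proof -
      have "(norm ?h)\<^sup>2 = (norm (a i + a j))\<^sup>2 / 4"
        unfolding norm_scaleC by (simp add: norm_divide power_divide)
      then show ?thesis
        unfolding \<phi>_def scale[OF sum] add[OF a a] by (simp add: field_simps)
    qed
    moreover have "(norm (a i + a j))\<^sup>2 + (norm (a i - a j))\<^sup>2 = 2 * (norm (a i))\<^sup>2 + 2 * (norm (a j))\<^sup>2"
      by (simp add: norm_add_squared norm_diff_squared)
    ultimately have "(norm (a i - a j))\<^sup>2 = 2 * \<phi> (a i) + 2 * \<phi> (a j) - 4 * \<phi> ?h"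
      unfolding \<phi>_def[of "a i"] \<phi>_def[of "a j"] by simp
    then show ?thesis using mle[OF h] \<phi>a[of i] \<phi>a[of j] by simp
  qed
  have "Cauchy a"
  proof (rule CauchyI)
    fix e :: real assume "0 < e"
    then have "0 < e\<^sup>2 / 4" by simp
    then obtain N where N: "inverse (real (Suc N)) < e\<^sup>2 / 4" using reals_Archimedean by blast
    have "norm (a i - a j) < e" if "i \<ge> N" "j \<ge> N" for i j
    proof -
      have "inverse (real (Suc i)) \<le> inverse (real (Suc N))" "inverse (real (Suc j)) \<le> inverse (real (Suc N))"
        using that by (auto intro!: le_imp_inverse_le)
      moreover have "2 * (x + y) \<le> 4 * z" if "x \<le> z" "y \<le> z" for x y z :: real
        using that by simp
      ultimately have "2 * (inverse (real (Suc i)) + inverse (real (Suc j))) \<le> 4 * inverse (real (Suc N))"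
        by blast
      also have "\<dots> < e\<^sup>2" using N by (simp del: of_nat_Suc)
      finally have "(norm (a i - a j))\<^sup>2 < e\<^sup>2" using dist[of i j] by simp
      then show ?thesis using \<open>0 < e\<close> by (simp add: power2_less_imp_less)
    qed
    then show "\<exists>M. \<forall>m\<ge>M. \<forall>n\<ge>M. norm (a m - a n) < e" by blast
  qed
  then obtain p where p: "a \<longlonglongrightarrow> p" using Cauchy_convergent_iff convergent_def by blast
  have pc: "p \<in> closure M" using a p closure_sequential by blast
  have key: "cinner b p = f b" if b: "b \<in> M" for b
  proof -
    have *: "Re (cinner b p) = Re (f b)" if b: "b \<in> M" for b
    proof -
      \<comment> \<open>First variation at the limit: moving from \<open>a n\<close> by
        \<open>t\<close> times \<open>b\<close> cannot bring \<open>\<phi>\<close> below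
        \<open>m\<close>, and \<open>\<phi> (a n)\<close> exceeds \<open>m\<close> by less than
        \<open>inverse (real (Suc n))\<close>.\<close>
      have ineq: "0 \<le> 2 * t * Re (cinner b p - f b) + t\<^sup>2 * (norm b)\<^sup>2" for t :: real
      proof -
        have "m \<le> \<phi> (a n) + (2 * t * Re (cinner b (a n)) - 2 * t * Re (f b) + t\<^sup>2 * (norm b)\<^sup>2)" for n
        proof -
          have tb: "of_real t *\<^sub>C b \<in> M" using M b by (blast intro: complex_vector.subspace_scale)
          then have "a n + of_real t *\<^sub>C b \<in> M" using M a by (blast intro: complex_vector.subspace_add)
          from mle[OF this] show ?thesis
            unfolding \<phi>_def add[OF a tb] scale[OF b] norm_add_squared
            using cinner_commute[of b "a n"]
            by (simp add: cinner_scaleC_right norm_scaleC power_mult_distrib algebra_simps)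
        qed
        then have "0 \<le> inverse (real (Suc n)) + (2 * t * Re (cinner b (a n)) - 2 * t * Re (f b) + t\<^sup>2 * (norm b)\<^sup>2)" for n
          using \<phi>a[of n] by (smt (verit))
        moreover have "(\<lambda>n. inverse (real (Suc n)) + (2 * t * Re (cinner b (a n)) - 2 * t * Re (f b) + t\<^sup>2 * (norm b)\<^sup>2))
            \<longlonglongrightarrow> 0 + (2 * t * Re (cinner b p) - 2 * t * Re (f b) + t\<^sup>2 * (norm b)\<^sup>2)"
        proof -
          have "(\<lambda>n. cnj (cinner (a n) b)) \<longlonglongrightarrow> cnj (cinner p b)"
            by (intro tendsto_intros tendsto_cinner_left p)
          then have "(\<lambda>n. cinner b (a n)) \<longlonglongrightarrow> cinner b p"
            using cinner_commute[of b] by simp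
          then show ?thesis by (intro tendsto_intros LIMSEQ_inverse_real_of_nat)
        qed
        ultimately have "0 \<le> 0 + (2 * t * Re (cinner b p) - 2 * t * Re (f b) + t\<^sup>2 * (norm b)\<^sup>2)"
          by (intro LIMSEQ_le_const) auto
        then show ?thesis by (simp add: algebra_simps)
      qed
      define d where "d = Re (cinner b p - f b)"
      define q where "q = (norm b)\<^sup>2"
      \<comment> \<open>The choice \<open>t = - d / (q + 1)\<close> instead of the optimal
        \<open>- d / q\<close> also covers \<open>b = 0\<close>.\<close>
      have "0 \<le> 2 * (- d / (q + 1)) * d + (- d / (q + 1))\<^sup>2 * q" unfolding d_def q_def by (rule ineq)
      moreover have q: "q \<ge> 0" by (simp add: q_def)
      moreover have "2 * (- d / (q + 1)) * d + (- d / (q + 1))\<^sup>2 * q = - (d\<^sup>2 * (q + 2)) / (q + 1)\<^sup>2"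
        using q by (simp add: power2_eq_square divide_simps) (simp add: algebra_simps)
      ultimately have "d\<^sup>2 * (q + 2) / (q + 1)\<^sup>2 \<le> 0" by simp
      then have "d\<^sup>2 * (q + 2) \<le> 0" using q zero_less_power[of "q + 1" 2] by (auto simp: divide_le_0_iff)
      then have "d = 0" using q by (simp add: mult_le_0_iff)
      then show ?thesis by (simp add: d_def)
    qed
    \<comment> \<open>The real part at \<open>\<i> *\<^sub>C b\<close> supplies the imaginary part
      at \<open>b\<close>.\<close>
    have "\<i> *\<^sub>C b \<in> M" using M b by (blast intro: complex_vector.subspace_scale)
    from *[OF this] *[OF b] show ?thesis
      by (simp add: cinner_scaleC_left scale[OF b] complex_eq_iff)
  qed
  then show ?thesis using pc by blast
qed

text \<open>The vector \<open>p\<close> is the orthogonal projection of \<open>x\<close> onto the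
  closure of \<open>M\<close>: it represents the functional that \<open>x\<close> induces on
  \<open>M\<close>.\<close>

lemma orthogonal_decomposition:
  fixes M :: "'a::chilbert_space set"
  assumes M: "complex_vector.subspace M"
  shows "\<exists>p\<in>closure M. \<forall>a\<in>M. cinner a p = cinner a x"
  by (rule Riesz_subspace[OF M, where K="norm x"])
     (auto simp: cinner_add_left cinner_scaleC_left intro: order_trans[OF cinner_Cauchy_Schwarz])

text \<open>Finite orthonormal systems that expand given vectors are the device by which norms of
  tensors are computed here without constructing the tensor product as a Hilbert space.\<close>

lemma Gram_Schmidt:
  fixes S :: "'a::chilbert_space set"
  assumes "finite S"
  shows "\<exists>B. finite B \<and> (\<forall>b\<in>B. \<forall>b'\<in>B. cinner b b' = (if b = b' then 1 else 0)) \<and>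
    (\<forall>x\<in>S. x = (\<Sum>b\<in>B. cinner x b *\<^sub>C b))"
  using assms
proof (induction S)
  case (insert x S)
  then obtain B where B: "finite B" "\<And>b b'. b \<in> B \<Longrightarrow> b' \<in> B \<Longrightarrow> cinner b b' = (if b = b' then 1 else 0)"
    and S: "\<And>y. y \<in> S \<Longrightarrow> y = (\<Sum>b\<in>B. cinner y b *\<^sub>C b)"
    by auto
  define r where "r = x - (\<Sum>b\<in>B. cinner x b *\<^sub>C b)"
  show ?case
  proof (cases "r = 0")
    case True
    then show ?thesis using B S unfolding r_def by (intro exI[of _ B]) auto
  next
    case False
    define e where "e = of_real (inverse (norm r)) *\<^sub>C r"
    have rB: "cinner r b = 0" if "b \<in> B" for b
    proof -
      have "(\<Sum>b'\<in>B. cinner x b' * cinner b' b) = (\<Sum>b'\<in>B. if b' = b then cinner x b' else 0)"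
        by (rule sum.cong) (use B(2) that in auto)
      also have "\<dots> = cinner x b" using B(1) that by simp
      finally show ?thesis
        by (simp add: r_def cinner_diff_left cinner_sum_left cinner_scaleC_left)
    qed
    then have eB: "cinner e b = 0" "cinner b e = 0" if "b \<in> B" for b
      using that cinner_commute[of b r] by (simp_all add: e_def cinner_scaleC_left cinner_scaleC_right)
    have ee: "cinner e e = 1"
      using False by (simp add: e_def cinner_self norm_scaleC norm_inverse)
    then have eB': "e \<notin> B" using eB(1) by force
    have xr: "cinner x r = of_real ((norm r)\<^sup>2)"
    proof -
      have "cinner x r = cinner r r + cinner (\<Sum>b\<in>B. cinner x b *\<^sub>C b) r"
        by (simp add: r_def cinner_diff_left)
      also have "cinner (\<Sum>b\<in>B. cinner x b *\<^sub>C b) r = 0"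
        unfolding cinner_sum_left cinner_scaleC_left
        using rB cinner_commute[of _ r] by (intro sum.neutral) simp
      finally show ?thesis by (simp add: cinner_self)
    qed
    have "inverse n * (n * n) * inverse n = 1" if "n \<noteq> 0" for n :: complex
      using that by (simp add: field_simps)
    then have "cinner x e *\<^sub>C e = r"
      using False by (simp add: e_def cinner_scaleC_right xr scaleC_scaleC power2_eq_square)
    then have "x = (\<Sum>b\<in>insert e B. cinner x b *\<^sub>C b)"
      using B(1) eB' by (simp add: r_def)
    moreover have "y = (\<Sum>b\<in>insert e B. cinner y b *\<^sub>C b)" if "y \<in> S" for y
    proof -
      have "cinner y e = cinner (\<Sum>b\<in>B. cinner y b *\<^sub>C b) e" using S[OF that] by simp
      also have "\<dots> = 0" using eB(2) by (auto simp: cinner_sum_left cinner_scaleC_left intro!: sum.neutral)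
      finally show ?thesis using S[OF that] B(1) eB' by simp
    qed
    moreover have "\<forall>b\<in>insert e B. \<forall>b'\<in>insert e B. cinner b b' = (if b = b' then 1 else 0)"
      using B(2) eB ee eB' by auto
    ultimately show ?thesis using B(1) by (intro exI[of _ "insert e B"]) simp
  qed
qed (auto intro: exI[of _ "{}"])

lemma cinner_orthonormal_expansion:
  fixes B :: "'a::chilbert_space set"
  assumes "x = (\<Sum>b\<in>B. cinner x b *\<^sub>C b)"
  shows "cinner x y = (\<Sum>b\<in>B. cinner x b * cinner b y)"
  by (subst assms) (simp add: cinner_sum_left cinner_scaleC_left)

section \<open>Finite tensors\<close>

definition tensor_inner ::
    "'p set \<Rightarrow> ('p \<Rightarrow> 'h::chilbert_space) \<Rightarrow> ('p \<Rightarrow> 'k::chilbert_space) \<Rightarrow>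
     'q set \<Rightarrow> ('q \<Rightarrow> 'h) \<Rightarrow> ('q \<Rightarrow> 'k) \<Rightarrow> complex"
  where "tensor_inner P h k Q h' k' =
    (\<Sum>p\<in>P. \<Sum>q\<in>Q. cinner (h p) (h' q) * cinner (k p) (k' q))"

lemma tensor_norm_eq: "tensor_norm P h k = sqrt (Re (tensor_inner P h k P h k))"
  unfolding tensor_norm_def tensor_inner_def ..

text \<open>Slicing along \<open>B\<close> in the second factor identifies a tensor with the family
  of vectors \<open>\<Sum>p\<in>P. cinner (k p) b *\<^sub>C h p\<close>, so that tensors behave like
  elements of a finite direct sum of copies of the first space.\<close>

lemma tensor_inner_expansion:
  assumes "\<forall>p\<in>P. k p = (\<Sum>b\<in>B. cinner (k p) b *\<^sub>C b)"
  shows "tensor_inner P h k Q h' k' = (\<Sum>b\<in>B. cinner (\<Sum>p\<in>P. cinner (k p) b *\<^sub>C h p)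
    (\<Sum>q\<in>Q. cinner (k' q) b *\<^sub>C h' q))"
proof -
  have "tensor_inner P h k Q h' k'
      = (\<Sum>p\<in>P. \<Sum>q\<in>Q. \<Sum>b\<in>B. cinner (k p) b * (cinner b (k' q) * cinner (h p) (h' q)))"
    unfolding tensor_inner_def
    by (intro sum.cong refl, subst cinner_orthonormal_expansion[OF assms[rule_format]])
       (simp_all add: sum_distrib_left sum_distrib_right mult_ac)
  also have "\<dots> = (\<Sum>p\<in>P. \<Sum>b\<in>B. \<Sum>q\<in>Q. cinner (k p) b * (cinner b (k' q) * cinner (h p) (h' q)))"
    by (intro sum.cong refl sum.swap)
  also have "\<dots> = (\<Sum>b\<in>B. \<Sum>p\<in>P. \<Sum>q\<in>Q. cinner (k p) b * (cinner b (k' q) * cinner (h p) (h' q)))"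
    by (rule sum.swap)
  also have "\<dots> = (\<Sum>b\<in>B. cinner (\<Sum>p\<in>P. cinner (k p) b *\<^sub>C h p) (\<Sum>q\<in>Q. cinner (k' q) b *\<^sub>C h' q))"
    unfolding cinner_sum_left unfolding cinner_sum_right
    by (simp add: cinner_scaleC_left cinner_scaleC_right cinner_commute[symmetric] mult_ac)
  finally show ?thesis .
qed

lemma tensor_inner_self:
  assumes "\<forall>p\<in>P. k p = (\<Sum>b\<in>B. cinner (k p) b *\<^sub>C b)"
  shows "tensor_inner P h k P h k = of_real (\<Sum>b\<in>B. (norm (\<Sum>p\<in>P. cinner (k p) b *\<^sub>C h p))\<^sup>2)"
  unfolding tensor_inner_expansion[OF assms] cinner_self of_real_sum ..

lemma tensor_norm_expansion:
  assumes "\<forall>p\<in>P. k p = (\<Sum>b\<in>B. cinner (k p) b *\<^sub>C b)"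
  shows "tensor_norm P h k = sqrt (\<Sum>b\<in>B. (norm (\<Sum>p\<in>P. cinner (k p) b *\<^sub>C h p))\<^sup>2)"
  unfolding tensor_norm_eq tensor_inner_self[OF assms] by simp

lemma tensor_norm_nonneg: "finite P \<Longrightarrow> 0 \<le> tensor_norm P h k"
proof -
  assume "finite P"
  then obtain B where "\<forall>x\<in>k ` P. x = (\<Sum>b\<in>B. cinner x b *\<^sub>C b)"
    using Gram_Schmidt[of "k ` P"] by auto
  then show ?thesis by (subst tensor_norm_expansion[of P k B]) (auto intro: sum_nonneg)
qed

lemma tensor_norm_power2:
  assumes "finite P"
  shows "of_real ((tensor_norm P h k)\<^sup>2) = tensor_inner P h k P h k"
proof -
  obtain B where "\<forall>x\<in>k ` P. x = (\<Sum>b\<in>B. cinner x b *\<^sub>C b)"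
    using Gram_Schmidt[of "k ` P"] assms by auto
  then show ?thesis
    by (subst tensor_inner_self[of P k B], simp, subst tensor_norm_expansion[of P k B])
       (auto simp: sum_nonneg)
qed

text \<open>With one \<open>B\<close> that slices both tensors, this is the Cauchy-Schwarz
  inequality twice: within each slice and over the slices.\<close>

lemma tensor_Cauchy_Schwarz:
  assumes "finite P" "finite Q"
  shows "cmod (tensor_inner P h k Q h' k') \<le> tensor_norm P h k * tensor_norm Q h' k'"
proof -
  obtain B where B: "\<forall>x\<in>k ` P \<union> k' ` Q. x = (\<Sum>b\<in>B. cinner x b *\<^sub>C b)"
    using Gram_Schmidt[of "k ` P \<union> k' ` Q"] assms by auto
  have "cmod (tensor_inner P h k Q h' k') \<le> (\<Sum>b\<in>B. norm (\<Sum>p\<in>P. cinner (k p) b *\<^sub>C h p)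
      * norm (\<Sum>q\<in>Q. cinner (k' q) b *\<^sub>C h' q))"
    using B by (subst tensor_inner_expansion[of P k B]) (auto intro!: sum_norm_le cinner_Cauchy_Schwarz)
  also have "\<dots> \<le> tensor_norm P h k * tensor_norm Q h' k'"
    using B by (subst (1 2) tensor_norm_expansion[where B=B]) (auto intro!: sum_norm_mult_le)
  finally show ?thesis .
qed

lemma tensor_norm_commute: "tensor_norm P h k = tensor_norm P k h"
  unfolding tensor_norm_def by (simp add: mult.commute)

text \<open>A linear map on the first factor commutes with slicing along the second, hence acts on
  every slice separately.\<close>

lemma tensor_norm_contract:
  assumes P: "finite P" and K: "0 \<le> K"
    and add: "\<And>x y. T (x + y) = T x + T y" and scale: "\<And>c x. T (c *\<^sub>C x) = c *\<^sub>C T x"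
    and le: "\<And>x. norm (T x) \<le> K * norm x"
  shows "tensor_norm P (\<lambda>p. T (h p)) k \<le> K * tensor_norm P h k"
proof -
  obtain B where B: "\<forall>x\<in>k ` P. x = (\<Sum>b\<in>B. cinner x b *\<^sub>C b)"
    using Gram_Schmidt[of "k ` P"] P by auto
  have T0: "T 0 = 0" using scale[of 0 0] by simp
  have T: "T (\<Sum>p\<in>P. c p *\<^sub>C h p) = (\<Sum>p\<in>P. c p *\<^sub>C T (h p))" for c
    using P by (induction P) (simp_all add: T0 add scale)
  have "tensor_norm P (\<lambda>p. T (h p)) k = sqrt (\<Sum>b\<in>B. (norm (T (\<Sum>p\<in>P. cinner (k p) b *\<^sub>C h p)))\<^sup>2)"
    using B unfolding T by (subst tensor_norm_expansion[of P k B]) auto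
  also have "\<dots> \<le> sqrt (\<Sum>b\<in>B. (K * norm (\<Sum>p\<in>P. cinner (k p) b *\<^sub>C h p))\<^sup>2)"
    by (intro real_sqrt_le_mono sum_mono power_mono le) simp
  also have "\<dots> = K * tensor_norm P h k"
    using B K by (subst tensor_norm_expansion[of P k B])
      (auto simp: power_mult_distrib real_sqrt_mult simp flip: sum_distrib_left)
  finally show ?thesis .
qed

section \<open>Diagonalizing finite tensors\<close>

text \<open>Tychonoff's theorem. It serves twice: in the search for an optimal unitary matrix and
  for the set of admissible forms.\<close>

lemma compact_bounded_functions: "compact {s :: 'a \<Rightarrow> complex. \<forall>x. cmod (s x) \<le> M x}"
proof -
  have eq: "{s :: 'a \<Rightarrow> complex. \<forall>x. cmod (s x) \<le> M x} = PiE UNIV (\<lambda>x. cball 0 (M x))"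
    by (auto simp: PiE_def Pi_def)
  have "compactin (product_topology (\<lambda>x::'a. euclidean :: complex topology) UNIV) (PiE UNIV (\<lambda>x. cball 0 (M x)))"
    unfolding compactin_PiE by simp
  then show ?thesis by (simp add: eq euclidean_product_topology)
qed

text \<open>Uncurried, so that these matrices form a closed set in the product topology on functions
  of pairs.\<close>

definition isometry_matrix :: "nat \<Rightarrow> (nat \<times> nat \<Rightarrow> complex) \<Rightarrow> bool"
  where "isometry_matrix n U \<longleftrightarrow>
    (\<forall>j<n. \<forall>j'<n. (\<Sum>p<n. cnj (U (p, j)) * U (p, j')) = (if j = j' then 1 else 0))"

text \<open>The Gram matrix \<open>R\<close> of the rows is Hermitian and idempotent, so the squared
  moduli in row \<open>p\<close> sum to the diagonal entry \<open>d p\<close>; thus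
  \<open>d p\<close> is at most \<open>1\<close>. The trace is \<open>n\<close>, because the columns
  are unit vectors, and so every \<open>d p\<close> is \<open>1\<close> and nothing is left off the
  diagonal.\<close>

lemma isometry_matrix_rows:
  assumes U: "isometry_matrix n U" and "p < n" "q < n"
  shows "(\<Sum>j<n. U (p, j) * cnj (U (q, j))) = (if p = q then 1 else 0)"
proof -
  define R where "R p q = (\<Sum>j<n. U (p, j) * cnj (U (q, j)))" for p q
  have RR: "(\<Sum>q<n. R p q * R q r) = R p r" for p r
  proof -
    have "(\<Sum>q<n. R p q * R q r)
        = (\<Sum>q<n. \<Sum>i<n. \<Sum>j<n. U (p, i) * cnj (U (r, j)) * (cnj (U (q, i)) * U (q, j)))"
      unfolding R_def sum_product by (intro sum.cong refl) (simp add: mult_ac)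
    also have "\<dots> = (\<Sum>i<n. \<Sum>q<n. \<Sum>j<n. U (p, i) * cnj (U (r, j)) * (cnj (U (q, i)) * U (q, j)))"
      by (rule sum.swap)
    also have "\<dots> = (\<Sum>i<n. \<Sum>j<n. \<Sum>q<n. U (p, i) * cnj (U (r, j)) * (cnj (U (q, i)) * U (q, j)))"
      by (intro sum.cong refl sum.swap)
    also have "\<dots> = (\<Sum>i<n. \<Sum>j<n. U (p, i) * cnj (U (r, j)) * (if i = j then 1 else 0))"
      unfolding sum_distrib_left[symmetric] using U[unfolded isometry_matrix_def]
      by (intro sum.cong refl) simp
    also have "\<dots> = R p r" unfolding R_def by (simp add: if_distrib cong: if_cong)
    finally show ?thesis .
  qed
  have cR: "R q p = cnj (R p q)" for p q unfolding R_def by (simp add: mult.commute)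
  define d where "d p = (\<Sum>j<n. (cmod (U (p, j)))\<^sup>2)" for p
  have Rd: "R p p = of_real (d p)" for p unfolding R_def d_def of_real_sum complex_norm_square ..
  have sq: "(\<Sum>q<n. (cmod (R p q))\<^sup>2) = d p" for p
  proof -
    have "of_real (\<Sum>q<n. (cmod (R p q))\<^sup>2) = (\<Sum>q<n. R p q * R q p)"
      unfolding cR[of _ p] by (simp only: of_real_sum complex_norm_square)
    then show ?thesis unfolding RR Rd by (simp only: of_real_eq_iff)
  qed
  have split: "(cmod (R p p))\<^sup>2 + (\<Sum>q\<in>{..<n}-{p}. (cmod (R p q))\<^sup>2) = d p" if "p < n" for p
    using sq[of p] sum.remove[of "{..<n}" p "\<lambda>q. (cmod (R p q))\<^sup>2"] that by simp
  have d0: "0 \<le> d p" for p unfolding d_def by (simp add: sum_nonneg)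
  have d1: "d p \<le> 1" if "p < n" for p
  proof -
    have "0 \<le> (\<Sum>q\<in>{..<n}-{p}. (cmod (R p q))\<^sup>2)" by (simp add: sum_nonneg)
    then have "(d p)\<^sup>2 \<le> d p" using split[OF that] by (simp add: Rd)
    then show ?thesis using d0[of p] by (cases "d p = 0") (simp_all add: power2_eq_square mult_le_cancel_right2)
  qed
  have "(\<Sum>p<n. d p) = real n"
  proof -
    have "of_real (\<Sum>p<n. d p) = (\<Sum>j<n. \<Sum>p<n. cnj (U (p, j)) * U (p, j))"
      unfolding d_def of_real_sum complex_norm_square
      by (subst sum.swap) (simp add: mult.commute)
    also have "\<dots> = of_nat n" using U by (simp add: isometry_matrix_def)
    finally show ?thesis by (metis of_real_eq_iff of_real_of_nat_eq)
  qed
  then have "(\<Sum>p<n. 1 - d p) = 0" by (simp add: sum_subtractf)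
  then have dp: "d p = 1" if "p < n" for p
    using that d1 by (subst (asm) sum_nonneg_eq_0_iff) auto
  have "(\<Sum>q\<in>{..<n}-{p}. (cmod (R p q))\<^sup>2) = 0"
    using split[OF \<open>p < n\<close>] by (simp add: Rd dp[OF \<open>p < n\<close>])
  then have "R p q = 0" if "q \<noteq> p"
    using that \<open>q < n\<close> by (subst (asm) sum_nonneg_eq_0_iff) auto
  then show ?thesis using Rd[of p] dp[OF \<open>p < n\<close>] unfolding R_def by auto
qed

text \<open>If two vectors are not orthogonal, turning the longer one slightly towards the other
  makes it longer still. The sum of the two squared norms does not change, and moving two numbers
  with fixed sum apart increases the sum of their squares.\<close>

lemma two_dim_rotation:
  fixes x y :: "'a::chilbert_space"
  assumes "cinner x y \<noteq> 0"
  shows "\<exists>\<alpha> \<beta>. (cmod \<alpha>)\<^sup>2 + (cmod \<beta>)\<^sup>2 = 1 \<and>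
    norm x ^ 4 + norm y ^ 4 < norm (\<alpha> *\<^sub>C x + \<beta> *\<^sub>C y) ^ 4 + norm (- cnj \<beta> *\<^sub>C x + cnj \<alpha> *\<^sub>C y) ^ 4"
proof -
  have *: "\<exists>\<alpha> \<beta>. (cmod \<alpha>)\<^sup>2 + (cmod \<beta>)\<^sup>2 = 1 \<and> (norm x)\<^sup>2 < (norm (\<alpha> *\<^sub>C x + \<beta> *\<^sub>C y))\<^sup>2"
    if xy: "cinner x y \<noteq> 0" and ge: "(norm x)\<^sup>2 \<ge> (norm y)\<^sup>2" for x y :: 'a
  proof -
    define a b c where "a = (norm x)\<^sup>2" and "b = (norm y)\<^sup>2" and "c = cmod (cinner x y)"
    have c: "0 < c" using xy by (simp add: c_def)
    \<comment> \<open>The tangent of the rotation angle. It is so small that the gain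
      \<open>2 * e * c\<close> exceeds the loss \<open>e\<^sup>2 * (a - b)\<close>. The phase of
      \<open>cinner x y\<close> in \<open>\<beta>\<close> makes the cross term positive.\<close>
    define e where "e = c / (a - b + 1)"
    have ab: "0 \<le> a - b" using ge by (simp add: a_def b_def)
    have e: "0 < e" using c ab by (simp add: e_def)
    have "e * (a - b) \<le> c" using c ab by (simp add: e_def field_simps)
    then have small: "e * (a - b) < 2 * c" using c by linarith
    define N where "N = sqrt (1 + e\<^sup>2)"
    have N: "0 < N" "N\<^sup>2 = 1 + e\<^sup>2" by (simp_all add: N_def add_pos_nonneg)
    define \<alpha> \<beta> where "\<alpha> = complex_of_real (1 / N)" and "\<beta> = of_real (e / (N * c)) * cinner x y"
    have ca: "cmod \<alpha> = 1 / N" and cb: "cmod \<beta> = e / N"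
      using N c e by (simp_all add: \<alpha>_def \<beta>_def norm_mult norm_divide c_def[symmetric])
    have "(norm (\<alpha> *\<^sub>C x + \<beta> *\<^sub>C y))\<^sup>2 = a / N\<^sup>2 + 2 * (e * c / N\<^sup>2) + b * e\<^sup>2 / N\<^sup>2"
    proof -
      have "cinner (\<alpha> *\<^sub>C x) (\<beta> *\<^sub>C y) = of_real (1 / N * (e / (N * c))) * (cinner x y * cnj (cinner x y))"
        by (simp add: cinner_scaleC_left cinner_scaleC_right \<alpha>_def \<beta>_def mult_ac)
      also have "cinner x y * cnj (cinner x y) = of_real (c\<^sup>2)"
        unfolding c_def by (metis complex_norm_square)
      finally have "Re (cinner (\<alpha> *\<^sub>C x) (\<beta> *\<^sub>C y)) = (1 / N * (e / (N * c))) * c\<^sup>2"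
        by (simp flip: of_real_mult)
      then have "Re (cinner (\<alpha> *\<^sub>C x) (\<beta> *\<^sub>C y)) = e * c / N\<^sup>2"
        using c by (simp add: power2_eq_square)
      then show ?thesis
        by (simp add: norm_add_squared norm_scaleC power_mult_distrib ca cb power_divide a_def b_def)
    qed
    also have "\<dots> = (a + 2 * (e * c) + b * e\<^sup>2) / N\<^sup>2" by (simp add: add_divide_distrib)
    also have "\<dots> > a"
    proof -
      have "a * N\<^sup>2 = a + a * e\<^sup>2" by (simp add: N(2) algebra_simps)
      moreover have "e * (e * (a - b)) < e * (2 * c)" using small e by simp
      then have "a * e\<^sup>2 < 2 * (e * c) + b * e\<^sup>2" by (simp add: algebra_simps power2_eq_square)
      ultimately have "a * N\<^sup>2 < a + 2 * (e * c) + b * e\<^sup>2" by linarith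
      then show ?thesis using zero_less_power[OF N(1), of 2] by (simp only: pos_less_divide_eq)
    qed
    finally have "a < (norm (\<alpha> *\<^sub>C x + \<beta> *\<^sub>C y))\<^sup>2" .
    moreover have "(cmod \<alpha>)\<^sup>2 + (cmod \<beta>)\<^sup>2 = 1"
    proof -
      have "(cmod \<alpha>)\<^sup>2 + (cmod \<beta>)\<^sup>2 = (1 + e\<^sup>2) / N\<^sup>2" by (simp add: ca cb power_divide add_divide_distrib)
      moreover have "1 + e\<^sup>2 \<noteq> 0" using zero_le_power2[of e] by linarith
      ultimately show ?thesis using N by simp
    qed
    ultimately show ?thesis unfolding a_def by blast
  qed
  have tot: "(norm (\<alpha> *\<^sub>C x + \<beta> *\<^sub>C y))\<^sup>2 + (norm (- cnj \<beta> *\<^sub>C x + cnj \<alpha> *\<^sub>C y))\<^sup>2 = (norm x)\<^sup>2 + (norm y)\<^sup>2"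
    if "(cmod \<alpha>)\<^sup>2 + (cmod \<beta>)\<^sup>2 = 1" for \<alpha> \<beta>
  proof -
    have "(norm (\<alpha> *\<^sub>C x + \<beta> *\<^sub>C y))\<^sup>2 + (norm (- cnj \<beta> *\<^sub>C x + cnj \<alpha> *\<^sub>C y))\<^sup>2
        = ((cmod \<alpha>)\<^sup>2 + (cmod \<beta>)\<^sup>2) * (norm x)\<^sup>2 + ((cmod \<alpha>)\<^sup>2 + (cmod \<beta>)\<^sup>2) * (norm y)\<^sup>2"
      unfolding norm_add_squared
      by (simp add: norm_scaleC power_mult_distrib cinner_scaleC_left cinner_scaleC_right algebra_simps)
    then show ?thesis using that by simp
  qed
  have fin: "a\<^sup>2 + b\<^sup>2 < a'\<^sup>2 + b'\<^sup>2" if "a < a'" "b \<le> a" "a' + b' = a + b" for a b a' b' :: real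
  proof -
    have "b' = a + b - a'" using that by simp
    then have "a'\<^sup>2 + b'\<^sup>2 - (a\<^sup>2 + b\<^sup>2) = 2 * (a' - a) * (a' - b)"
      by (simp only: power2_eq_square) (simp add: algebra_simps)
    moreover have "0 < 2 * (a' - a) * (a' - b)" using that by simp
    ultimately show ?thesis by linarith
  qed
  have p4: "norm z ^ 4 = ((norm z)\<^sup>2)\<^sup>2" for z :: 'a by simp
  show ?thesis
  proof (cases "(norm x)\<^sup>2 \<ge> (norm y)\<^sup>2")
    case True
    then obtain \<alpha> \<beta> where ab: "(cmod \<alpha>)\<^sup>2 + (cmod \<beta>)\<^sup>2 = 1" "(norm x)\<^sup>2 < (norm (\<alpha> *\<^sub>C x + \<beta> *\<^sub>C y))\<^sup>2"
      using *[OF assms] by blast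
    show ?thesis
      using ab fin[OF ab(2) True tot[OF ab(1)]] unfolding p4 by blast
  next
    case False
    have "cinner y x \<noteq> 0" using assms cinner_commute[of x y] by auto
    then obtain \<alpha> \<beta> where ab: "(cmod \<alpha>)\<^sup>2 + (cmod \<beta>)\<^sup>2 = 1" "(norm y)\<^sup>2 < (norm (\<alpha> *\<^sub>C y + \<beta> *\<^sub>C x))\<^sup>2"
      using *[of y x] False by auto
    \<comment> \<open>With these coefficients the rotation found for the pair \<open>y\<close>,
      \<open>x\<close> becomes one of the pair \<open>x\<close>, \<open>y\<close>.\<close>
    define \<alpha>' \<beta>' where "\<alpha>' = cnj \<alpha>" and "\<beta>' = - cnj \<beta>"
    have ab': "(cmod \<alpha>')\<^sup>2 + (cmod \<beta>')\<^sup>2 = 1" using ab by (simp add: \<alpha>'_def \<beta>'_def)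
    have "\<alpha> *\<^sub>C y + \<beta> *\<^sub>C x = - cnj \<beta>' *\<^sub>C x + cnj \<alpha>' *\<^sub>C y"
      by (simp add: \<alpha>'_def \<beta>'_def add.commute)
    then have "(norm y)\<^sup>2 < (norm (- cnj \<beta>' *\<^sub>C x + cnj \<alpha>' *\<^sub>C y))\<^sup>2" using ab(2) by simp
    from fin[OF this] False tot[OF ab'] ab' show ?thesis unfolding p4 by (metis add.commute linear)
  qed
qed

text \<open>Jacobi's method: among all unitary changes of the family, one maximising \<open>\<Sum>\<parallel>k\<^sub>p\<parallel>\<^sup>4\<close> is orthogonal,
  since otherwise a rotation of two of its members would increase the sum.\<close>

lemma exists_orthogonalizing_isometry:
  fixes k :: "nat \<Rightarrow> 'a::chilbert_space"
  shows "\<exists>U. isometry_matrix n U \<and>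
    (\<forall>p<n. \<forall>q<n. p \<noteq> q \<longrightarrow> cinner (\<Sum>j<n. U (p, j) *\<^sub>C k j) (\<Sum>j<n. U (q, j) *\<^sub>C k j) = 0)"
proof -
  define S where "S = {U :: nat \<times> nat \<Rightarrow> complex. isometry_matrix n U \<and> (\<forall>x. cmod (U x) \<le> 1)}"
  define f where "f U = (\<Sum>p<n. norm (\<Sum>j<n. U (p, j) *\<^sub>C k j) ^ 4)" for U
  have "closed {U. isometry_matrix n U}"
    unfolding isometry_matrix_def
    by (intro closed_Collect_all closed_Collect_imp closed_Collect_eq continuous_intros
        continuous_on_product_coordinates) auto
  then have S: "compact S"
    unfolding S_def using compact_bounded_functions[of "\<lambda>_. 1"]
    unfolding Collect_conj_eq by (intro closed_Int_compact)
  have "(\<Sum>p<n. cnj (if p = j then 1 else 0) * (if p = j' then 1 else 0)) = (if j = j' then 1 else 0 :: complex)"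
    if "j < n" for j j'
  proof -
    have "(\<Sum>p<n. cnj (if p = j then 1 else 0) * (if p = j' then 1 else 0))
        = (\<Sum>p<n. if p = j then (if j = j' then 1 else 0) else 0 :: complex)"
      by (rule sum.cong) auto
    then show ?thesis using that by simp
  qed
  then have "(\<lambda>x. if fst x = snd x then 1 else 0) \<in> S"
    unfolding S_def isometry_matrix_def by simp
  then have "S \<noteq> {}" by blast
  have "continuous_on S f"
    unfolding f_def
    by (intro continuous_intros bounded_linear.continuous_on[OF bounded_linear_scaleC_left]
        continuous_on_subset[OF continuous_on_product_coordinates]) auto
  then obtain U where U: "U \<in> S" and max: "\<And>V. V \<in> S \<Longrightarrow> f V \<le> f U"
    using continuous_attains_sup[OF S \<open>S \<noteq> {}\<close>] by blast
  have "cinner (\<Sum>j<n. U (p, j) *\<^sub>C k j) (\<Sum>j<n. U (q, j) *\<^sub>C k j) = 0"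
    if p: "p < n" and q: "q < n" and pq: "p \<noteq> q" for p q
  proof (rule ccontr)
    let ?k = "\<lambda>p. \<Sum>j<n. U (p, j) *\<^sub>C k j"
    assume "cinner (?k p) (?k q) \<noteq> 0"
    then obtain \<alpha> \<beta> where ab: "(cmod \<alpha>)\<^sup>2 + (cmod \<beta>)\<^sup>2 = 1"
      and less: "norm (?k p) ^ 4 + norm (?k q) ^ 4
        < norm (\<alpha> *\<^sub>C ?k p + \<beta> *\<^sub>C ?k q) ^ 4 + norm (- cnj \<beta> *\<^sub>C ?k p + cnj \<alpha> *\<^sub>C ?k q) ^ 4"
      using two_dim_rotation by blast
    define \<gamma> where "\<gamma> = - cnj \<beta>"
    have ab': "\<alpha> * cnj \<alpha> + \<beta> * cnj \<beta> = 1" using ab by (metis complex_norm_square of_real_1 of_real_add)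
    \<comment> \<open>Only the rows \<open>p\<close> and \<open>q\<close> are rotated. Entries
      beyond \<open>n\<close> are reset to \<open>0\<close>, which respects the bound
      \<open>1\<close> demanded in \<open>S\<close>; inside the matrix that bound follows from the
      columns being unit vectors.\<close>
    define V where "V x = (if fst x < n \<and> snd x < n then
      (if fst x = p then \<alpha> * U (p, snd x) + \<beta> * U (q, snd x)
       else if fst x = q then \<gamma> * U (p, snd x) + cnj \<alpha> * U (q, snd x) else U x) else 0)" for x
    have two: "(\<Sum>r<n. g r) = g p + g q + (\<Sum>r\<in>{..<n}-{p,q}. g r)" for g :: "nat \<Rightarrow> 'b::comm_monoid_add"
    proof -
      have "{..<n} = insert p (insert q ({..<n}-{p,q}))" using p q by auto
      then have "(\<Sum>r<n. g r) = (\<Sum>r\<in>insert p (insert q ({..<n}-{p,q})). g r)" by simp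
      also have "\<dots> = g p + g q + (\<Sum>r\<in>{..<n}-{p,q}. g r)" using pq by (simp add: add.assoc)
      finally show ?thesis .
    qed
    have iso: "isometry_matrix n V"
      unfolding isometry_matrix_def
    proof (intro allI impI)
      fix i j assume ij: "i < n" "j < n"
      have "cnj (\<alpha> * a + \<beta> * b) * (\<alpha> * c + \<beta> * d) + cnj (- cnj \<beta> * a + cnj \<alpha> * b) * (- cnj \<beta> * c + cnj \<alpha> * d)
          = (\<alpha> * cnj \<alpha> + \<beta> * cnj \<beta>) * (cnj a * c + cnj b * d)" for a b c d :: complex
        by (simp add: algebra_simps)
      then have "(\<Sum>r<n. cnj (V (r, i)) * V (r, j)) = (\<Sum>r<n. cnj (U (r, i)) * U (r, j))"
        unfolding two using pq p q ij ab' by (simp add: V_def \<gamma>_def)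
      also have "\<dots> = (if i = j then 1 else 0)" using U ij by (simp add: S_def isometry_matrix_def)
      finally show "(\<Sum>r<n. cnj (V (r, i)) * V (r, j)) = (if i = j then 1 else 0)" .
    qed
    have "cmod (V (r, j)) \<le> 1" for r j
    proof (cases "r < n \<and> j < n")
      case True
      have "of_real (\<Sum>r<n. (cmod (V (r, j)))\<^sup>2) = (\<Sum>r<n. cnj (V (r, j)) * V (r, j))"
        unfolding of_real_sum complex_norm_square by (simp add: mult.commute)
      also have "\<dots> = 1" using iso True by (simp add: isometry_matrix_def)
      finally have "(\<Sum>r<n. (cmod (V (r, j)))\<^sup>2) = 1" by (metis of_real_eq_1_iff)
      moreover have "(cmod (V (r, j)))\<^sup>2 \<le> (\<Sum>r<n. (cmod (V (r, j)))\<^sup>2)"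
        using True by (intro member_le_sum) auto
      ultimately have "(cmod (V (r, j)))\<^sup>2 \<le> 1" by simp
      then show ?thesis by (simp add: power_le_one_iff)
    qed (auto simp: V_def)
    then have "V \<in> S" using iso by (auto simp: S_def)
    moreover have "f U < f V"
    proof -
      have Vp: "(\<Sum>j<n. V (p, j) *\<^sub>C k j) = \<alpha> *\<^sub>C ?k p + \<beta> *\<^sub>C ?k q"
        using p by (simp add: V_def scaleC_add_left complex_vector.scale_sum_right scaleC_scaleC sum.distrib)
      have Vq: "(\<Sum>j<n. V (q, j) *\<^sub>C k j) = \<gamma> *\<^sub>C ?k p + cnj \<alpha> *\<^sub>C ?k q"
        using q pq by (simp add: V_def scaleC_add_left complex_vector.scale_sum_right scaleC_scaleC sum.distrib)
      have Vr: "(\<Sum>j<n. V (r, j) *\<^sub>C k j) = ?k r" if "r \<in> {..<n}-{p,q}" for r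
        using that by (simp add: V_def)
      have "f U = norm (?k p) ^ 4 + norm (?k q) ^ 4 + (\<Sum>r\<in>{..<n}-{p,q}. norm (?k r) ^ 4)"
        unfolding f_def by (rule two)
      also have "\<dots> < norm (\<Sum>j<n. V (p, j) *\<^sub>C k j) ^ 4 + norm (\<Sum>j<n. V (q, j) *\<^sub>C k j) ^ 4
          + (\<Sum>r\<in>{..<n}-{p,q}. norm (\<Sum>j<n. V (r, j) *\<^sub>C k j) ^ 4)"
      proof -
        have "(\<Sum>r\<in>{..<n}-{p,q}. norm (\<Sum>j<n. V (r, j) *\<^sub>C k j) ^ 4) = (\<Sum>r\<in>{..<n}-{p,q}. norm (?k r) ^ 4)"
          by (intro sum.cong refl) (simp only: Vr)
        then show ?thesis unfolding Vp Vq using less[folded \<gamma>_def] by linarith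
      qed
      also have "\<dots> = f V" unfolding f_def by (rule two[symmetric])
      finally show ?thesis .
    qed
    ultimately show False using max[of V] by simp
  qed
  then show ?thesis using U unfolding S_def by blast
qed

text \<open>An orthonormal basis for the first factor leaves coefficient vectors \<open>c j\<close>,
  which a unitary matrix makes orthogonal; each singular value is then split into two square roots.
  Two tensors are identified through their pairings with elementary tensors, as in the first
  conjunct.\<close>

lemma tensor_singular_value_decomposition:
  fixes h :: "'p \<Rightarrow> 'h::chilbert_space" and k :: "'p \<Rightarrow> 'k::chilbert_space"
  assumes P: "finite P"
  shows "\<exists>n::nat. \<exists>g g'.
    (\<forall>x y. (\<Sum>p\<in>P. cinner (h p) x * cinner (k p) y) = (\<Sum>p<n. cinner (g p) x * cinner (g' p) y)) \<and>
    (\<forall>p<n. \<forall>q<n. p \<noteq> q \<longrightarrow> cinner (g p) (g q) = 0 \<and> cinner (g' p) (g' q) = 0) \<and>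
    (\<forall>p<n. norm (g p) = norm (g' p))"
proof -
  obtain B where B: "finite B" "\<forall>b\<in>B. \<forall>b'\<in>B. cinner b b' = (if b = b' then 1 else 0)"
    and hB: "\<forall>x\<in>h ` P. x = (\<Sum>b\<in>B. cinner x b *\<^sub>C b)"
    using Gram_Schmidt[of "h ` P"] P by auto
  define n where "n = card B"
  obtain a where a: "bij_betw a {..<n} B"
    using ex_bij_betw_nat_finite[OF B(1)] unfolding n_def atLeast0LessThan by blast
  have ortho: "cinner (a i) (a j) = (if i = j then 1 else 0)" if "i < n" "j < n" for i j
    using that a B(2) unfolding bij_betw_def inj_on_def by auto
  define c where "c j = (\<Sum>p\<in>P. cinner (h p) (a j) *\<^sub>C k p)" for j
  have ac: "(\<Sum>p\<in>P. cinner (h p) x * cinner (k p) y) = (\<Sum>j<n. cinner (a j) x * cinner (c j) y)" for x y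
  proof -
    have "(\<Sum>p\<in>P. cinner (h p) x * cinner (k p) y)
        = (\<Sum>p\<in>P. \<Sum>j<n. cinner (h p) (a j) * cinner (a j) x * cinner (k p) y)"
    proof (rule sum.cong[OF refl])
      fix p assume "p \<in> P"
      then have "cinner (h p) x = (\<Sum>b\<in>B. cinner (h p) b * cinner b x)"
        using hB by (intro cinner_orthonormal_expansion) blast
      also have "\<dots> = (\<Sum>j<n. cinner (h p) (a j) * cinner (a j) x)"
        by (rule sum.reindex_bij_betw[OF a, symmetric])
      finally show "cinner (h p) x * cinner (k p) y
          = (\<Sum>j<n. cinner (h p) (a j) * cinner (a j) x * cinner (k p) y)"
        by (simp add: sum_distrib_right)
    qed
    also have "\<dots> = (\<Sum>j<n. \<Sum>p\<in>P. cinner (h p) (a j) * cinner (a j) x * cinner (k p) y)"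
      by (rule sum.swap)
    also have "\<dots> = (\<Sum>j<n. cinner (a j) x * cinner (c j) y)"
      unfolding c_def by (simp add: cinner_sum_left cinner_scaleC_left sum_distrib_left mult_ac)
    finally show ?thesis .
  qed
  obtain U where U: "isometry_matrix n U"
    and Uc: "\<And>p q. p < n \<Longrightarrow> q < n \<Longrightarrow> p \<noteq> q \<Longrightarrow>
      cinner (\<Sum>j<n. U (p, j) *\<^sub>C c j) (\<Sum>j<n. U (q, j) *\<^sub>C c j) = 0"
    using exists_orthogonalizing_isometry[of n c] by blast
  \<comment> \<open>The tensor is preserved if \<open>U\<close> acts on the \<open>c j\<close> and
    its inverse transpose on the \<open>a j\<close>. For a unitary matrix this is the entrywise
    conjugate.\<close>
  define e where "e p = (\<Sum>j<n. cnj (U (p, j)) *\<^sub>C a j)" for p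
  define d where "d p = (\<Sum>j<n. U (p, j) *\<^sub>C c j)" for p
  have ed: "(\<Sum>j<n. cinner (a j) x * cinner (c j) y) = (\<Sum>p<n. cinner (e p) x * cinner (d p) y)" for x y
  proof -
    have "(\<Sum>p<n. cinner (e p) x * cinner (d p) y)
        = (\<Sum>p<n. \<Sum>i<n. \<Sum>j<n. (cinner (a i) x * cinner (c j) y) * (cnj (U (p, i)) * U (p, j)))"
      unfolding e_def d_def cinner_sum_left cinner_scaleC_left sum_product
      by (intro sum.cong refl) (simp add: mult_ac)
    also have "\<dots> = (\<Sum>i<n. \<Sum>p<n. \<Sum>j<n. (cinner (a i) x * cinner (c j) y) * (cnj (U (p, i)) * U (p, j)))"
      by (rule sum.swap)
    also have "\<dots> = (\<Sum>i<n. \<Sum>j<n. \<Sum>p<n. (cinner (a i) x * cinner (c j) y) * (cnj (U (p, i)) * U (p, j)))"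
      by (intro sum.cong refl sum.swap)
    also have "\<dots> = (\<Sum>i<n. \<Sum>j<n. (cinner (a i) x * cinner (c j) y) * (if i = j then 1 else 0))"
      unfolding sum_distrib_left[symmetric] using U[unfolded isometry_matrix_def]
      by (intro sum.cong refl) simp
    also have "\<dots> = (\<Sum>j<n. cinner (a j) x * cinner (c j) y)" by (simp add: if_distrib cong: if_cong)
    finally show ?thesis by simp
  qed
  have ee: "cinner (e p) (e q) = (if p = q then 1 else 0)" if pq: "p < n" "q < n" for p q
  proof -
    have "cinner (e p) (e q) = (\<Sum>i<n. \<Sum>j<n. cnj (U (p, i)) * U (q, j) * cinner (a i) (a j))"
      unfolding e_def cinner_sum_left unfolding cinner_sum_right
      by (simp add: cinner_scaleC_left cinner_scaleC_right mult_ac)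
    also have "\<dots> = (\<Sum>i<n. \<Sum>j<n. if i = j then cnj (U (p, i)) * U (q, j) else 0)"
      by (intro sum.cong refl) (simp add: ortho)
    also have "\<dots> = (\<Sum>i<n. U (q, i) * cnj (U (p, i)))" by (simp add: mult.commute)
    also have "\<dots> = (if p = q then 1 else 0)" using isometry_matrix_rows[OF U pq(2) pq(1)] by auto
    finally show ?thesis .
  qed
  \<comment> \<open>If \<open>d p = 0\<close>, division by zero gives \<open>g' p = 0\<close>, and
    \<open>g p = 0\<close> as well, so the product formula and the equality of norms
    persist.\<close>
  define \<tau> where "\<tau> p = sqrt (norm (d p))" for p
  define g where "g p = complex_of_real (\<tau> p) *\<^sub>C e p" for p
  define g' where "g' p = complex_of_real (1 / \<tau> p) *\<^sub>C d p" for p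
  have "cinner (e p) x * cinner (d p) y = cinner (g p) x * cinner (g' p) y" for p x y
    unfolding g_def g'_def \<tau>_def cinner_scaleC_left by (cases "d p = 0") simp_all
  moreover have "cinner (g p) (g q) = 0 \<and> cinner (g' p) (g' q) = 0" if "p < n" "q < n" "p \<noteq> q" for p q
    using ee[OF that(1,2)] Uc[OF that] that(3)
    by (simp add: g_def g'_def d_def cinner_scaleC_left cinner_scaleC_right)
  moreover have "norm (g p) = norm (g' p)" if "p < n" for p
  proof -
    have "norm (e p) = 1" using ee[OF that that] by (simp add: norm_eq_sqrt_cinner)
    then have "norm (g p) = \<tau> p" by (simp add: g_def norm_scaleC \<tau>_def)
    moreover have "norm (g' p) = \<tau> p"
      unfolding g'_def norm_scaleC by (simp add: \<tau>_def norm_divide real_div_sqrt)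
    ultimately show ?thesis by simp
  qed
  ultimately show ?thesis unfolding ac ed by (intro exI[of _ n] exI[of _ g] exI[of _ g']) simp
qed

section \<open>Positive tests for the minimal tensor norm\<close>

text \<open>The squared Hilbert-Schmidt norm of the positive operator that maps \<open>x\<close> to
  the sum of all \<open>cinner x (h l) *\<^sub>C h l\<close>.\<close>

definition gram_square :: "nat \<Rightarrow> (nat \<Rightarrow> 'h::chilbert_space) \<Rightarrow> real"
  where "gram_square m h = (\<Sum>l<m. \<Sum>l'<m. (cmod (cinner (h l) (h l')))\<^sup>2)"

lemma gram_square_nonneg: "0 \<le> gram_square m h"
  unfolding gram_square_def by (intro sum_nonneg) auto

definition orthogonal_family :: "nat \<Rightarrow> (nat \<Rightarrow> 'h::chilbert_space) \<Rightarrow> bool"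
  where "orthogonal_family n g \<longleftrightarrow> (\<forall>p<n. \<forall>q<n. p \<noteq> q \<longrightarrow> cinner (g p) (g q) = 0)"

lemma gram_square_orthogonal:
  assumes "orthogonal_family n g"
  shows "gram_square n g = (\<Sum>p<n. norm (g p) ^ 4)"
proof -
  have "(cmod (cinner (g l) (g l')))\<^sup>2 = (if l = l' then norm (g l) ^ 4 else 0)" if "l < n" "l' < n" for l l'
    using assms that unfolding orthogonal_family_def by (auto simp: cinner_self norm_power)
  then show ?thesis unfolding gram_square_def by simp
qed

lemma tensor_norm_conjugate_self: "tensor_norm {..<m} h (\<lambda>l. conjugate (h l)) = sqrt (gram_square m h)"
  unfolding tensor_norm_def gram_square_def
  by (simp add: cinner_conjugate.rep_eq conjugate_inverse complex_norm_square[symmetric]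
      flip: of_real_sum of_real_power)

text \<open>Distributing the singular values evenly makes the fourth power sum of the norms of each family equal
  to the squared tensor norm.\<close>

lemma balanced_tensor_decomposition:
  fixes h :: "'p \<Rightarrow> 'h::chilbert_space" and k :: "'p \<Rightarrow> 'k::chilbert_space"
  assumes P: "finite P"
  obtains n :: nat and g g' where
    "\<And>x y. (\<Sum>p\<in>P. cinner (h p) x * cinner (k p) y) = (\<Sum>p<n. cinner (g p) x * cinner (g' p) y)"
    "gram_square n g = (tensor_norm P h k)\<^sup>2" "gram_square n g' = (tensor_norm P h k)\<^sup>2"
    "orthogonal_family n g" "orthogonal_family n g'"
proof -
  obtain n :: nat and g g' where
    eq: "\<And>x y. (\<Sum>p\<in>P. cinner (h p) x * cinner (k p) y) = (\<Sum>p<n. cinner (g p) x * cinner (g' p) y)"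
    and orth: "\<forall>p<n. \<forall>q<n. p \<noteq> q \<longrightarrow> cinner (g p) (g q) = 0 \<and> cinner (g' p) (g' q) = 0"
    and norms: "\<forall>p<n. norm (g p) = norm (g' p)"
    using tensor_singular_value_decomposition[OF P, of h k] by blast
  \<comment> \<open>Only pairings with fixed elementary tensors are known to agree. The
    decomposition is therefore inserted in one argument, the roles are exchanged by conjugation, and
    it is inserted again.\<close>
  have "tensor_inner P h k P h k = (\<Sum>q\<in>P. \<Sum>p\<in>P. cinner (h p) (h q) * cinner (k p) (k q))"
    unfolding tensor_inner_def by (rule sum.swap)
  also have "\<dots> = (\<Sum>q\<in>P. \<Sum>p<n. cinner (g p) (h q) * cinner (g' p) (k q))" by (simp add: eq)
  also have "\<dots> = (\<Sum>p<n. \<Sum>q\<in>P. cinner (g p) (h q) * cinner (g' p) (k q))" by (rule sum.swap)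
  also have "\<dots> = (\<Sum>p<n. cnj (\<Sum>q\<in>P. cinner (h q) (g p) * cinner (k q) (g' p)))"
    by (simp flip: cinner_commute)
  also have "\<dots> = (\<Sum>p<n. cnj (\<Sum>q<n. cinner (g q) (g p) * cinner (g' q) (g' p)))" by (simp add: eq)
  also have "\<dots> = (\<Sum>p<n. \<Sum>q<n. cinner (g p) (g q) * cinner (g' p) (g' q))"
    by (simp flip: cinner_commute)
  also have "\<dots> = (\<Sum>p<n. \<Sum>q<n. if p = q then of_real (norm (g p) ^ 4) else 0)"
    by (intro sum.cong refl) (use orth norms in \<open>auto simp: cinner_self power_mult[symmetric] simp flip: power_add\<close>)
  also have "\<dots> = of_real (\<Sum>p<n. norm (g p) ^ 4)" by simp
  finally have t: "(tensor_norm P h k)\<^sup>2 = (\<Sum>p<n. norm (g p) ^ 4)"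
    unfolding tensor_norm_power2[OF P, symmetric] of_real_eq_iff .
  have "gram_square n g = (tensor_norm P h k)\<^sup>2"
    unfolding t by (rule gram_square_orthogonal) (use orth in \<open>simp add: orthogonal_family_def\<close>)
  moreover have "gram_square n g' = (tensor_norm P h k)\<^sup>2"
  proof -
    have "gram_square n g' = (\<Sum>p<n. norm (g' p) ^ 4)"
      by (rule gram_square_orthogonal) (use orth in \<open>simp add: orthogonal_family_def\<close>)
    then show ?thesis unfolding t using norms by simp
  qed
  moreover have "orthogonal_family n g" "orthogonal_family n g'"
    using orth unfolding orthogonal_family_def by blast+
  ultimately show thesis using eq by (intro that)
qed

lemma bounded_operatorsD: "x \<in> bounded_operators \<Longrightarrow> blinfun_apply x (c *\<^sub>C h) = c *\<^sub>C blinfun_apply x h"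
  unfolding bounded_operators_def by blast

lemma conj_op_apply: "blinfun_apply (conj_op x) k = conjugate (blinfun_apply x (of_conjugate k))"
  by (simp add: conj_op.rep_eq)

lemma norm_conj_op_apply_le: "norm (blinfun_apply (conj_op x) k) \<le> norm x * norm k"
  by (simp add: conj_op_apply norm_conjugate.rep_eq conjugate_inverse norm_blinfun)

lemma conj_op_apply_scaleC:
  assumes "x \<in> bounded_operators"
  shows "blinfun_apply (conj_op x) (c *\<^sub>C k) = c *\<^sub>C blinfun_apply (conj_op x) k"
  by (simp add: conj_op_apply scaleC_conjugate.rep_eq scaleC_conjugate.abs_eq bounded_operatorsD[OF assms])

lemma tensor_inner_Times:
  assumes "finite J"
  shows "tensor_inner (J \<times> P) h k Q h' k' = (\<Sum>i\<in>J. tensor_inner P (\<lambda>p. h (i, p)) (\<lambda>p. k (i, p)) Q h' k')"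
  unfolding tensor_inner_def by (rule sum.cartesian_product')

text \<open>The triangle inequality for \<open>tensor_norm\<close>, obtained by pairing the tensor
  with itself and cancelling one factor.\<close>

lemma tensor_norm_Times_le:
  assumes "finite J" "finite P"
  shows "tensor_norm (J \<times> P) h k \<le> (\<Sum>i\<in>J. tensor_norm P (\<lambda>p. h (i, p)) (\<lambda>p. k (i, p)))"
proof (cases "tensor_norm (J \<times> P) h k = 0")
  case True
  then show ?thesis using assms by (auto intro: sum_nonneg tensor_norm_nonneg)
next
  case False
  let ?t = "tensor_norm (J \<times> P) h k"
  have t: "0 < ?t" using False tensor_norm_nonneg[of "J \<times> P" h k] assms by simp
  have "?t\<^sup>2 = cmod (tensor_inner (J \<times> P) h k (J \<times> P) h k)"
    using assms by (simp flip: tensor_norm_power2 add: norm_power)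
  also have "\<dots> \<le> (\<Sum>i\<in>J. cmod (tensor_inner P (\<lambda>p. h (i, p)) (\<lambda>p. k (i, p)) (J \<times> P) h k))"
    unfolding tensor_inner_Times[OF assms(1)] by (rule norm_sum)
  also have "\<dots> \<le> (\<Sum>i\<in>J. tensor_norm P (\<lambda>p. h (i, p)) (\<lambda>p. k (i, p)) * ?t)"
    using assms by (intro sum_mono tensor_Cauchy_Schwarz) auto
  also have "\<dots> = (\<Sum>i\<in>J. tensor_norm P (\<lambda>p. h (i, p)) (\<lambda>p. k (i, p))) * ?t"
    by (simp add: sum_distrib_right)
  finally show ?thesis using t by (simp add: power2_eq_square)
qed

section \<open>Bounds for the minimal tensor norm and their reduction to positive tests\<close>

definition min_tensor_bound ::
    "'i set \<Rightarrow> ('i \<Rightarrow> 'h::chilbert_space \<Rightarrow>\<^sub>L 'h) \<Rightarrow> ('i \<Rightarrow> 'k::chilbert_space \<Rightarrow>\<^sub>L 'k) \<Rightarrow> real \<Rightarrow> bool"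
  where "min_tensor_bound J x y c \<longleftrightarrow> 0 \<le> c \<and>
    (\<forall>m h k. tensor_norm (J \<times> {..<m}) (\<lambda>(i, p). x i (h p)) (\<lambda>(i, p). y i (k p))
      \<le> c * tensor_norm {..<m::nat} h k)"

lemma min_tensor_norm_eq_Inf: "min_tensor_norm J x y = Inf {c. min_tensor_bound J x y c}"
  unfolding min_tensor_norm_def min_tensor_bound_def ..

lemma min_tensor_norm_le: "min_tensor_bound J x y c \<Longrightarrow> min_tensor_norm J x y \<le> c"
  unfolding min_tensor_norm_eq_Inf
  by (rule cInf_lower) (auto simp: min_tensor_bound_def intro!: bdd_belowI[of _ 0])

text \<open>A crude bound, one summand at a time. It guarantees that the infimum defining the
  minimal tensor norm runs over a nonempty set.\<close>

lemma min_tensor_bound_sum_norm: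
  assumes J: "finite J" and x: "\<And>i. i \<in> J \<Longrightarrow> x i \<in> bounded_operators"
  shows "min_tensor_bound J x (\<lambda>i. conj_op (x i)) (\<Sum>i\<in>J. (norm (x i))\<^sup>2)"
  unfolding min_tensor_bound_def
proof (intro conjI allI)
  fix m :: nat and h k
  have 1: "tensor_norm {..<m} (\<lambda>p. x i (h p)) (\<lambda>p. conj_op (x i) (k p)) \<le> (norm (x i))\<^sup>2 * tensor_norm {..<m} h k"
    if i: "i \<in> J" for i
  proof -
    have "tensor_norm {..<m} (\<lambda>p. x i (h p)) (\<lambda>p. conj_op (x i) (k p))
        \<le> norm (x i) * tensor_norm {..<m} h (\<lambda>p. conj_op (x i) (k p))"
      by (rule tensor_norm_contract[where T="blinfun_apply (x i)"])
         (auto simp: blinfun.add_right bounded_operatorsD[OF x[OF i]] norm_blinfun)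
    also have "tensor_norm {..<m} h (\<lambda>p. conj_op (x i) (k p)) \<le> norm (x i) * tensor_norm {..<m} h k"
      by (subst (1 2) tensor_norm_commute, rule tensor_norm_contract[where T="blinfun_apply (conj_op (x i))"])
         (auto simp: blinfun.add_right conj_op_apply_scaleC[OF x[OF i]] norm_conj_op_apply_le)
    finally show ?thesis by (simp add: power2_eq_square mult_left_mono mult.assoc)
  qed
  have "tensor_norm (J \<times> {..<m}) (\<lambda>(i, p). x i (h p)) (\<lambda>(i, p). conj_op (x i) (k p))
      \<le> (\<Sum>i\<in>J. tensor_norm {..<m} (\<lambda>p. x i (h p)) (\<lambda>p. conj_op (x i) (k p)))"
    using tensor_norm_Times_le[OF J, of "{..<m}" "\<lambda>(i, p). x i (h p)" "\<lambda>(i, p). conj_op (x i) (k p)"] by simp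
  also have "\<dots> \<le> (\<Sum>i\<in>J. (norm (x i))\<^sup>2 * tensor_norm {..<m} h k)" by (intro sum_mono 1)
  finally show "tensor_norm (J \<times> {..<m}) (\<lambda>(i, p). x i (h p)) (\<lambda>(i, p). conj_op (x i) (k p))
      \<le> (\<Sum>i\<in>J. (norm (x i))\<^sup>2) * tensor_norm {..<m} h k" by (simp add: sum_distrib_right)
qed (simp add: sum_nonneg)

lemma min_tensor_norm_attained:
  fixes x :: "'i \<Rightarrow> 'h::chilbert_space \<Rightarrow>\<^sub>L 'h" and y :: "'i \<Rightarrow> 'k::chilbert_space \<Rightarrow>\<^sub>L 'k"
  assumes ex: "\<exists>c. min_tensor_bound J x y c"
  shows "min_tensor_bound J x y (min_tensor_norm J x y)"
  unfolding min_tensor_bound_def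
proof (intro conjI allI)
  let ?S = "{c. min_tensor_bound J x y c}"
  have ne: "?S \<noteq> {}" using ex by blast
  show "0 \<le> min_tensor_norm J x y"
    unfolding min_tensor_norm_eq_Inf by (rule cInf_greatest[OF ne]) (auto simp: min_tensor_bound_def)
  fix m :: nat and h :: "nat \<Rightarrow> 'h" and k :: "nat \<Rightarrow> 'k"
  have t: "0 \<le> tensor_norm {..<m} h k" by (simp add: tensor_norm_nonneg)
  let ?l = "tensor_norm (J \<times> {..<m}) (\<lambda>(i, p). x i (h p)) (\<lambda>(i, p). y i (k p))"
  show "?l \<le> min_tensor_norm J x y * tensor_norm {..<m} h k"
  proof (cases "tensor_norm {..<m} h k = 0")
    \<comment> \<open>Division by the norm is impossible, but any single bound forces the left side
      to be at most \<open>0\<close>.\<close>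
    case True
    then show ?thesis using ex unfolding min_tensor_bound_def by (metis mult_zero_right)
  next
    case False
    then have t: "0 < tensor_norm {..<m} h k" using t by simp
    have "?l / tensor_norm {..<m} h k \<le> Inf ?S"
    proof (rule cInf_greatest[OF ne])
      fix c assume "c \<in> ?S"
      then have "?l \<le> c * tensor_norm {..<m} h k" by (simp add: min_tensor_bound_def)
      then show "?l / tensor_norm {..<m} h k \<le> c" using t by (simp add: field_simps)
    qed
    then show ?thesis using t by (simp add: min_tensor_norm_eq_Inf field_simps)
  qed
qed

text \<open>With \<open>S\<close> and \<open>S'\<close> the positive operators of the families
  \<open>h\<close> and \<open>h'\<close>, the left side is the Hilbert-Schmidt inner product of
  \<open>S'\<close> with the sum over \<open>i\<close> of \<open>x i\<close> composed with
  \<open>S\<close> and the adjoint of \<open>x i\<close>; the right side contains the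
  Hilbert-Schmidt norms of \<open>S\<close> and \<open>S'\<close>.\<close>

definition conj_square_test :: "'i set \<Rightarrow> ('i \<Rightarrow> 'h::chilbert_space \<Rightarrow>\<^sub>L 'h) \<Rightarrow> real \<Rightarrow> bool"
  where "conj_square_test J x c \<longleftrightarrow> (\<forall>m m' h h'.
    (\<Sum>i\<in>J. \<Sum>k<m'. \<Sum>l<m. (cmod (cinner (x i (h l)) (h' k)))\<^sup>2)
      \<le> c\<^sup>2 * sqrt (gram_square m h * gram_square m' h'))"

text \<open>Only tests against tensors of the form \<open>\<Sum> h \<otimes> \<bar>h\<close> are needed, because the operator
  \<open>\<Sum> x i \<otimes> \<bar>x i\<close> acts on Hilbert--Schmidt operators as a positive map.\<close>

lemma min_tensor_bound_test:
  fixes x :: "'i \<Rightarrow> 'h::chilbert_space \<Rightarrow>\<^sub>L 'h"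
  assumes J: "finite J" and b: "min_tensor_bound J x (\<lambda>i. conj_op (x i)) (c\<^sup>2)"
  shows "conj_square_test J x c"
  unfolding conj_square_test_def
proof (intro allI)
  fix m m' :: nat and h h' :: "nat \<Rightarrow> 'h"
  have "complex_of_real (\<Sum>i\<in>J. \<Sum>k<m'. \<Sum>l<m. (cmod (cinner (x i (h l)) (h' k)))\<^sup>2)
      = (\<Sum>i\<in>J. \<Sum>k<m'. \<Sum>l<m. cinner (x i (h l)) (h' k) * cinner (conj_op (x i) (conjugate (h l))) (conjugate (h' k)))"
    by (simp only: of_real_sum complex_norm_square conj_op_apply cinner_conjugate.rep_eq conjugate_inverse UNIV_I)
  also have "\<dots> = (\<Sum>i\<in>J. \<Sum>l<m. \<Sum>k<m'. cinner (x i (h l)) (h' k) * cinner (conj_op (x i) (conjugate (h l))) (conjugate (h' k)))"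
    by (intro sum.cong refl sum.swap)
  also have "\<dots> = tensor_inner (J \<times> {..<m}) (\<lambda>(i, p). x i (h p)) (\<lambda>(i, p). conj_op (x i) (conjugate (h p)))
      {..<m'} h' (\<lambda>k. conjugate (h' k))"
    unfolding tensor_inner_Times[OF J] by (simp add: tensor_inner_def)
  finally have "(\<Sum>i\<in>J. \<Sum>k<m'. \<Sum>l<m. (cmod (cinner (x i (h l)) (h' k)))\<^sup>2)
      = Re (tensor_inner (J \<times> {..<m}) (\<lambda>(i, p). x i (h p)) (\<lambda>(i, p). conj_op (x i) (conjugate (h p)))
      {..<m'} h' (\<lambda>k. conjugate (h' k)))" (is "?L = Re ?T") by (metis Re_complex_of_real)
  also have "\<dots> \<le> cmod ?T" by (rule complex_Re_le_cmod)
  also have "\<dots> \<le> tensor_norm (J \<times> {..<m}) (\<lambda>(i, p). x i (h p)) (\<lambda>(i, p). conj_op (x i) (conjugate (h p)))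
      * tensor_norm {..<m'} h' (\<lambda>k. conjugate (h' k))"
    using J by (intro tensor_Cauchy_Schwarz) auto
  also have "\<dots> \<le> (c\<^sup>2 * tensor_norm {..<m} h (\<lambda>l. conjugate (h l))) * tensor_norm {..<m'} h' (\<lambda>k. conjugate (h' k))"
    using b unfolding min_tensor_bound_def by (intro mult_right_mono tensor_norm_nonneg) auto
  also have "\<dots> = c\<^sup>2 * sqrt (gram_square m h * gram_square m' h')"
    unfolding tensor_norm_conjugate_self by (simp add: real_sqrt_mult mult.assoc)
  finally show "?L \<le> c\<^sup>2 * sqrt (gram_square m h * gram_square m' h')" .
qed

lemma gram_square_of_conjugate: "gram_square n (\<lambda>p. of_conjugate (g p)) = gram_square n g"
  unfolding gram_square_def by (simp add: cinner_conjugate.rep_eq)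

text \<open>The value of the adjoint of \<open>T\<close> at the single vector \<open>a\<close>, by
  the Riesz representation.\<close>

lemma exists_adjoint:
  fixes T :: "'a::chilbert_space \<Rightarrow> 'b::chilbert_space"
  assumes "\<And>x y. T (x + y) = T x + T y" "\<And>c x. T (c *\<^sub>C x) = c *\<^sub>C T x" "\<And>x. norm (T x) \<le> K * norm x"
  shows "\<exists>p. \<forall>x. cinner (T x) a = cinner x p"
proof -
  have "\<exists>p\<in>closure UNIV. \<forall>x\<in>UNIV. cinner x p = cinner (T x) a"
  proof (rule Riesz_subspace)
    fix x
    have "cmod (cinner (T x) a) \<le> norm (T x) * norm a" by (rule cinner_Cauchy_Schwarz)
    also have "\<dots> \<le> K * norm x * norm a" by (intro mult_right_mono assms(3)) simp
    finally show "cmod (cinner (T x) a) \<le> (K * norm a) * norm x" by (simp add: mult_ac)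
  qed (simp_all add: complex_vector.subspace_UNIV assms cinner_add_left cinner_scaleC_left)
  then obtain p where "\<forall>x\<in>UNIV. cinner x p = cinner (T x) a" by blast
  then show ?thesis by (intro exI[of _ p]) simp
qed

lemma orthogonal_family_of_conjugate:
  "orthogonal_family n g \<Longrightarrow> orthogonal_family n (\<lambda>p. of_conjugate (g p))"
  unfolding orthogonal_family_def by (simp add: cinner_conjugate.rep_eq)

text \<open>Both the given tensor and its image are replaced by balanced decompositions. The squared
  norm \<open>?L\<^sup>2\<close> of the image then is a sum of products of a coefficient of
  \<open>x i\<close> and one of its conjugate; the Cauchy-Schwarz inequality separates the two, and
  each resulting sum is a positive test bounded by \<open>c\<^sup>2 * (?t * ?L)\<close>. Orthogonal
  families suffice as tests because balanced decompositions are orthogonal.\<close>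

lemma min_tensor_bound_of_test:
  fixes x :: "'i \<Rightarrow> 'h::chilbert_space \<Rightarrow>\<^sub>L 'h"
  assumes J: "finite J" and x: "\<And>i. i \<in> J \<Longrightarrow> x i \<in> bounded_operators"
    and t: "\<And>m m' h h'. orthogonal_family m h \<Longrightarrow> orthogonal_family m' h' \<Longrightarrow>
      (\<Sum>i\<in>J. \<Sum>k<m'. \<Sum>l<m. (cmod (cinner (x i (h l)) (h' k)))\<^sup>2)
        \<le> c\<^sup>2 * sqrt (gram_square m h * gram_square m' h')"
  shows "min_tensor_bound J x (\<lambda>i. conj_op (x i)) (c\<^sup>2)"
  unfolding min_tensor_bound_def
proof (intro conjI allI)
  fix m :: nat and h :: "nat \<Rightarrow> 'h" and k :: "nat \<Rightarrow> 'h conjugate"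
  obtain n g g' where
    eq: "\<And>x y. (\<Sum>p<m. cinner (h p) x * cinner (k p) y) = (\<Sum>p<n. cinner (g p) x * cinner (g' p) y)"
    and gg: "gram_square n g = (tensor_norm {..<m} h k)\<^sup>2" "gram_square n g' = (tensor_norm {..<m} h k)\<^sup>2"
    and og: "orthogonal_family n g" "orthogonal_family n g'"
    by (rule balanced_tensor_decomposition[OF finite_lessThan, where h=h and k=k]) (rule that)
  let ?H = "\<lambda>(i, p). blinfun_apply (x i) (h p)" and ?K = "\<lambda>(i, p). blinfun_apply (conj_op (x i)) (k p)"
  let ?P = "J \<times> {..<m}"
  obtain r f f' where
    eq': "\<And>x y. (\<Sum>p\<in>?P. cinner (?H p) x * cinner (?K p) y) = (\<Sum>p<r. cinner (f p) x * cinner (f' p) y)"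
    and ff: "gram_square r f = (tensor_norm ?P ?H ?K)\<^sup>2" "gram_square r f' = (tensor_norm ?P ?H ?K)\<^sup>2"
    and off: "orthogonal_family r f" "orthogonal_family r f'"
    by (rule balanced_tensor_decomposition[OF finite_cartesian_product[OF J finite_lessThan], where h="?H" and k="?K"]) (rule that)
  let ?L = "tensor_norm ?P ?H ?K" and ?t = "tensor_norm {..<m} h k"
  have P: "finite ?P" using J by simp
  have L0: "0 \<le> ?L" and t0: "0 \<le> ?t" using P by (simp_all add: tensor_norm_nonneg)
  \<comment> \<open>The identity \<open>eq\<close> concerns pairings with fixed vectors, so
    \<open>x i\<close> and its conjugate are first moved to the other side by adjoints.\<close>
  have transfer: "(\<Sum>p<m. cinner (x i (h p)) a * cinner (conj_op (x i) (k p)) b)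
      = (\<Sum>p<n. cinner (x i (g p)) a * cinner (conj_op (x i) (g' p)) b)" if i: "i \<in> J" for i a b
  proof -
    obtain a' where a': "\<And>z. cinner (x i z) a = cinner z a'"
      using exists_adjoint[of "blinfun_apply (x i)" "norm (x i)" a]
      by (auto simp: blinfun.add_right bounded_operatorsD[OF x[OF i]] norm_blinfun)
    obtain b' where b': "\<And>z. cinner (conj_op (x i) z) b = cinner z b'"
      using exists_adjoint[of "blinfun_apply (conj_op (x i))" "norm (x i)" b]
      by (auto simp: blinfun.add_right conj_op_apply_scaleC[OF x[OF i]] norm_conj_op_apply_le)
    show ?thesis unfolding a' b' by (rule eq)
  qed
  let ?A = "J \<times> {..<r} \<times> {..<n}"
  let ?u = "\<lambda>(i, s, p). cinner (x i (g p)) (f s)" and ?v = "\<lambda>(i, s, p). cinner (conj_op (x i) (g' p)) (f' s)"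
  have "complex_of_real (?L\<^sup>2) = (\<Sum>q\<in>?P. \<Sum>p\<in>?P. cinner (?H p) (?H q) * cinner (?K p) (?K q))"
    unfolding tensor_norm_power2[OF P] tensor_inner_def by (rule sum.swap)
  also have "\<dots> = (\<Sum>q\<in>?P. \<Sum>s<r. cinner (f s) (?H q) * cinner (f' s) (?K q))" by (simp only: eq')
  also have "\<dots> = (\<Sum>s<r. \<Sum>q\<in>?P. cinner (f s) (?H q) * cinner (f' s) (?K q))" by (rule sum.swap)
  also have "\<dots> = (\<Sum>s<r. \<Sum>q\<in>?P. cnj (cinner (?H q) (f s) * cinner (?K q) (f' s)))"
    by (simp flip: cinner_commute)
  also have "\<dots> = cnj (\<Sum>s<r. \<Sum>i\<in>J. \<Sum>p<m. cinner (x i (h p)) (f s) * cinner (conj_op (x i) (k p)) (f' s))"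
    by (simp only: sum.cartesian_product' case_prod_conv cnj_sum)
  also have "\<dots> = cnj (\<Sum>s<r. \<Sum>i\<in>J. \<Sum>p<n. cinner (x i (g p)) (f s) * cinner (conj_op (x i) (g' p)) (f' s))"
    by (simp only: transfer cong: sum.cong)
  also have "\<dots> = cnj (\<Sum>i\<in>J. \<Sum>s<r. \<Sum>p<n. cinner (x i (g p)) (f s) * cinner (conj_op (x i) (g' p)) (f' s))"
    by (subst sum.swap) (rule refl)
  also have "\<dots> = cnj (\<Sum>a\<in>?A. ?u a * ?v a)"
    by (simp only: sum.cartesian_product' case_prod_conv)
  finally have L2: "complex_of_real (?L\<^sup>2) = cnj (\<Sum>a\<in>?A. ?u a * ?v a)" .
  have "?L\<^sup>2 = cmod (complex_of_real (?L\<^sup>2))" unfolding norm_of_real by simp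
  also have "\<dots> = cmod (cnj (\<Sum>a\<in>?A. ?u a * ?v a))" unfolding L2 ..
  also have "\<dots> \<le> (\<Sum>a\<in>?A. cmod (?u a) * cmod (?v a))"
    unfolding complex_mod_cnj by (rule order.trans[OF norm_sum]) (simp only: norm_mult order.refl)
  also have "\<dots> \<le> sqrt (\<Sum>a\<in>?A. (cmod (?u a))\<^sup>2) * sqrt (\<Sum>a\<in>?A. (cmod (?v a))\<^sup>2)"
    by (rule sum_cmod_mult_le)
  also have "\<dots> \<le> sqrt (c\<^sup>2 * (?t * ?L)) * sqrt (c\<^sup>2 * (?t * ?L))"
  proof -
    have "(\<Sum>a\<in>?A. (cmod (?u a))\<^sup>2) = (\<Sum>i\<in>J. \<Sum>s<r. \<Sum>p<n. (cmod (cinner (x i (g p)) (f s)))\<^sup>2)"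
      by (simp only: sum.cartesian_product' case_prod_conv)
    also have "\<dots> \<le> c\<^sup>2 * sqrt (gram_square n g * gram_square r f)"
      by (rule t[OF og(1) off(1)])
    also have "\<dots> = c\<^sup>2 * (?t * ?L)" unfolding gg ff using L0 t0 by (simp add: real_sqrt_mult)
    finally have 1: "(\<Sum>a\<in>?A. (cmod (?u a))\<^sup>2) \<le> c\<^sup>2 * (?t * ?L)" .
    have "(\<Sum>a\<in>?A. (cmod (?v a))\<^sup>2)
        = (\<Sum>i\<in>J. \<Sum>s<r. \<Sum>p<n. (cmod (cinner (x i (of_conjugate (g' p))) (of_conjugate (f' s))))\<^sup>2)"
      by (simp only: sum.cartesian_product' case_prod_conv conj_op_apply cinner_conjugate.rep_eq conjugate_inverse
          UNIV_I complex_mod_cnj)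
    also have "\<dots> \<le> c\<^sup>2 * sqrt (gram_square n (\<lambda>p. of_conjugate (g' p)) * gram_square r (\<lambda>s. of_conjugate (f' s)))"
      by (rule t[OF orthogonal_family_of_conjugate[OF og(2)] orthogonal_family_of_conjugate[OF off(2)]])
    also have "\<dots> = c\<^sup>2 * (?t * ?L)" unfolding gram_square_of_conjugate gg ff using L0 t0 by (simp add: real_sqrt_mult)
    finally have 2: "(\<Sum>a\<in>?A. (cmod (?v a))\<^sup>2) \<le> c\<^sup>2 * (?t * ?L)" .
    show ?thesis by (intro mult_mono real_sqrt_le_mono 1 2) (auto intro!: sum_nonneg mult_nonneg_nonneg t0 L0)
  qed
  also have "\<dots> = c\<^sup>2 * ?t * ?L" using t0 L0 by simp
  finally have "?L * ?L \<le> (c\<^sup>2 * ?t) * ?L" by (simp add: power2_eq_square)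
  then show "?L \<le> c\<^sup>2 * ?t" using L0 t0 by (cases "?L = 0") (auto simp: mult_le_cancel_right)
qed simp

lemma conj_square_norm_leI:
  fixes x :: "'i \<Rightarrow> 'h::chilbert_space \<Rightarrow>\<^sub>L 'h"
  assumes "finite J" and "\<And>i. i \<in> J \<Longrightarrow> x i \<in> bounded_operators" and c: "0 \<le> c"
    and "\<And>m m' h h'. orthogonal_family m h \<Longrightarrow> orthogonal_family m' h' \<Longrightarrow>
      (\<Sum>i\<in>J. \<Sum>k<m'. \<Sum>l<m. (cmod (cinner (x i (h l)) (h' k)))\<^sup>2)
        \<le> c\<^sup>2 * sqrt (gram_square m h * gram_square m' h')"
  shows "conj_square_norm J x \<le> c"
proof -
  have "min_tensor_norm J x (\<lambda>i. conj_op (x i)) \<le> c\<^sup>2"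
    by (intro min_tensor_norm_le min_tensor_bound_of_test assms)
  then show ?thesis unfolding conj_square_norm_def using c by (simp add: real_le_lsqrt)
qed

theorem conj_square_norm_le_iff:
  assumes J: "finite J" and x: "\<And>i. i \<in> J \<Longrightarrow> x i \<in> bounded_operators" and c: "0 \<le> c"
  shows "conj_square_norm J x \<le> c \<longleftrightarrow> conj_square_test J x c"
proof
  let ?N = "min_tensor_norm J x (\<lambda>i. conj_op (x i))"
  have att: "min_tensor_bound J x (\<lambda>i. conj_op (x i)) ?N"
    using min_tensor_norm_attained min_tensor_bound_sum_norm[where x=x, OF J x] by blast
  assume "conj_square_norm J x \<le> c"
  then have N: "?N \<le> c\<^sup>2" using c unfolding conj_square_norm_def by (metis sqrt_le_D)
  have "min_tensor_bound J x (\<lambda>i. conj_op (x i)) (c\<^sup>2)"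
    unfolding min_tensor_bound_def
  proof (intro conjI allI)
    fix m :: nat and h k
    have "tensor_norm (J \<times> {..<m}) (\<lambda>(i, p). x i (h p)) (\<lambda>(i, p). conj_op (x i) (k p)) \<le> ?N * tensor_norm {..<m} h k"
      using att unfolding min_tensor_bound_def by blast
    also have "\<dots> \<le> c\<^sup>2 * tensor_norm {..<m} h k" by (intro mult_right_mono N tensor_norm_nonneg) simp
    finally show "tensor_norm (J \<times> {..<m}) (\<lambda>(i, p). x i (h p)) (\<lambda>(i, p). conj_op (x i) (k p)) \<le> c\<^sup>2 * tensor_norm {..<m} h k" .
  qed simp
  then show "conj_square_test J x c" by (rule min_tensor_bound_test[OF J])
next
  assume t: "conj_square_test J x c"
  show "conj_square_norm J x \<le> c"
    by (rule conj_square_norm_leI[OF J x c]) (use t in \<open>auto simp: conj_square_test_def\<close>)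
qed

lemma conj_square_norm_nonneg:
  assumes "finite J" "\<And>i. i \<in> J \<Longrightarrow> x i \<in> bounded_operators"
  shows "0 \<le> conj_square_norm J x"
  using min_tensor_norm_attained[OF exI, OF min_tensor_bound_sum_norm[where x=x, OF assms]]
  by (simp add: conj_square_norm_def min_tensor_bound_def)

lemma conj_square_norm_le_sum_norm:
  assumes "finite J" "\<And>i. i \<in> J \<Longrightarrow> x i \<in> bounded_operators"
  shows "conj_square_norm J x \<le> sqrt (\<Sum>i\<in>J. (norm (x i))\<^sup>2)"
  unfolding conj_square_norm_def
  by (intro real_sqrt_le_mono min_tensor_norm_le min_tensor_bound_sum_norm assms)

lemma conj_square_norm_test:
  assumes "finite J" "\<And>i. i \<in> J \<Longrightarrow> x i \<in> bounded_operators"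
  shows "conj_square_test J x (conj_square_norm J x)"
  using conj_square_norm_le_iff[of J x "conj_square_norm J x"] conj_square_norm_nonneg[of J x] assms by blast

section \<open>Matrix norms of the operator Hilbert space\<close>

text \<open>In the tensor that represents the positive operator of \<open>h\<close>, the contraction
  is applied to one factor after the other.\<close>

lemma gram_square_contract:
  fixes T :: "'a::chilbert_space \<Rightarrow> 'b::chilbert_space"
  assumes add: "\<And>x y. T (x + y) = T x + T y" and scale: "\<And>c x. T (c *\<^sub>C x) = c *\<^sub>C T x"
    and le: "\<And>x. norm (T x) \<le> norm x"
  shows "gram_square m (\<lambda>l. T (h l)) \<le> gram_square m h"
proof -
  have "tensor_norm {..<m} (\<lambda>l. T (h l)) (\<lambda>l. conjugate (T (h l)))
      \<le> 1 * tensor_norm {..<m} h (\<lambda>l. conjugate (T (h l)))"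
    by (rule tensor_norm_contract) (use add scale le in auto)
  also have "tensor_norm {..<m} h (\<lambda>l. conjugate (T (h l)))
      = tensor_norm {..<m} (\<lambda>l. conjugate (T (of_conjugate (conjugate (h l))))) h"
    by (simp add: tensor_norm_commute[of _ h] conjugate_inverse)
  also have "\<dots> \<le> 1 * tensor_norm {..<m} (\<lambda>l. conjugate (h l)) h"
    by (rule tensor_norm_contract[where T="\<lambda>x. conjugate (T (of_conjugate x))"])
       (use add scale le in \<open>auto simp: plus_conjugate.rep_eq plus_conjugate.abs_eq scaleC_conjugate.rep_eq
          scaleC_conjugate.abs_eq norm_conjugate.rep_eq conjugate_inverse\<close>)
  also have "tensor_norm {..<m} (\<lambda>l. conjugate (h l)) h = tensor_norm {..<m} h (\<lambda>l. conjugate (h l))"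
    by (rule tensor_norm_commute)
  finally show ?thesis unfolding tensor_norm_conjugate_self by simp
qed

section \<open>Coordinates, finite supports and truncations of square summable families\<close>

lemma ell2_nth_sum: "ell2_nth (\<Sum>a\<in>A. f a) i = (\<Sum>a\<in>A. ell2_nth (f a) i)"
  by (induction A rule: infinite_finite_induct) simp_all

lemma ell2_nth_basis: "ell2_nth (ell2_basis i) j = (if j = i then 1 else 0)"
  by (simp add: ell2_basis.rep_eq)

lemma norm_ell2_power2: "(norm f)\<^sup>2 = (\<Sum>\<^sub>\<infinity>i. (cmod (ell2_nth f i))\<^sup>2)"
  unfolding norm_ell2_def by (simp add: infsum_nonneg)

lemma norm_ell2_finite_support:
  assumes "finite J" "\<And>i. i \<notin> J \<Longrightarrow> ell2_nth f i = 0"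
  shows "(norm f)\<^sup>2 = (\<Sum>i\<in>J. (cmod (ell2_nth f i))\<^sup>2)"
proof -
  have "(\<Sum>\<^sub>\<infinity>i. (cmod (ell2_nth f i))\<^sup>2) = (\<Sum>\<^sub>\<infinity>i\<in>J. (cmod (ell2_nth f i))\<^sup>2)"
    by (rule infsum_cong_neutral) (use assms in auto)
  then show ?thesis using assms by (simp add: norm_ell2_power2)
qed

lemma cinner_ell2_finite_support:
  assumes "finite J" "\<And>i. i \<notin> J \<Longrightarrow> ell2_nth g i = 0"
  shows "cinner f g = (\<Sum>i\<in>J. ell2_nth f i * cnj (ell2_nth g i))"
proof -
  have "cinner f g = (\<Sum>\<^sub>\<infinity>i\<in>J. ell2_nth f i * cnj (ell2_nth g i))"
    unfolding cinner_ell2_def by (rule infsum_cong_neutral) (use assms in auto)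
  then show ?thesis using assms by simp
qed

lemma cinner_ell2_basis: "cinner f (ell2_basis i) = ell2_nth f i"
  by (subst cinner_ell2_finite_support[of "{i}"]) (auto simp: ell2_nth_basis)

lemma sum_ell2_nth_le: "finite J \<Longrightarrow> (\<Sum>i\<in>J. (cmod (ell2_nth f i))\<^sup>2) \<le> (norm f)\<^sup>2"
  unfolding norm_ell2_power2 by (intro finite_sum_le_infsum ell2_nth_summable) auto

lemma sum_norm_ell2_le:
  fixes f :: "'a \<Rightarrow> 'i ell2"
  assumes "finite A" and le: "\<And>J. finite J \<Longrightarrow> (\<Sum>i\<in>J. \<Sum>a\<in>A. (cmod (ell2_nth (f a) i))\<^sup>2) \<le> c"
  shows "(\<Sum>a\<in>A. (norm (f a))\<^sup>2) \<le> c"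
proof -
  have s: "((\<lambda>i. \<Sum>a\<in>A. (cmod (ell2_nth (f a) i))\<^sup>2) has_sum (\<Sum>a\<in>A. (norm (f a))\<^sup>2)) UNIV"
    using \<open>finite A\<close>
  proof (induction A)
    case (insert a A)
    have "((\<lambda>i. (cmod (ell2_nth (f a) i))\<^sup>2) has_sum (norm (f a))\<^sup>2) UNIV"
      unfolding norm_ell2_power2 by (rule has_sum_infsum[OF ell2_nth_summable])
    from has_sum_add[OF this insert.IH] show ?case using insert.hyps by simp
  qed simp
  then show ?thesis by (rule has_sum_le_finite_sums) (rule le)
qed

definition truncation :: "nat \<Rightarrow> (nat \<Rightarrow> complex) \<Rightarrow> nat ell2"
  where "truncation n g = (\<Sum>p<n. g p *\<^sub>C ell2_basis p)"

lemma ell2_nth_truncation: "ell2_nth (truncation n g) p = (if p < n then g p else 0)"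
  unfolding truncation_def by (simp add: ell2_nth_sum ell2_nth_basis if_distrib cong: if_cong)

lemma cinner_truncation: "cinner f (truncation n g) = (\<Sum>p<n. ell2_nth f p * cnj (g p))"
  by (subst cinner_ell2_finite_support[of "{..<n}"]) (auto simp: ell2_nth_truncation)

definition coef_gram :: "nat \<Rightarrow> nat \<Rightarrow> (nat \<Rightarrow> nat \<Rightarrow> complex) \<Rightarrow> real"
  where "coef_gram n m g = (\<Sum>l<m. \<Sum>l'<m. (cmod (\<Sum>p<n. g l p * cnj (g l' p)))\<^sup>2)"

lemma coef_gram_nonneg: "0 \<le> coef_gram n m g"
  unfolding coef_gram_def by (intro sum_nonneg) auto

lemma gram_square_truncation: "gram_square m (\<lambda>l. truncation n (g l)) = coef_gram n m g"
  unfolding gram_square_def coef_gram_def cinner_truncation by (simp add: ell2_nth_truncation)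

lemma coef_gram_le_gram_square: "coef_gram n m (\<lambda>l. ell2_nth (f l)) \<le> gram_square m f"
proof -
  have "norm (truncation n (ell2_nth f)) \<le> norm f" for f
  proof -
    have "(norm (truncation n (ell2_nth f)))\<^sup>2 \<le> (norm f)\<^sup>2"
    proof -
      have "(norm (truncation n (ell2_nth f)))\<^sup>2 = (\<Sum>i<n. (cmod (ell2_nth (truncation n (ell2_nth f)) i))\<^sup>2)"
        by (rule norm_ell2_finite_support) (simp_all add: ell2_nth_truncation)
      also have "\<dots> = (\<Sum>i<n. (cmod (ell2_nth f i))\<^sup>2)" by (simp add: ell2_nth_truncation)
      also have "\<dots> \<le> (norm f)\<^sup>2" by (rule sum_ell2_nth_le) simp
      finally show ?thesis .
    qed
    then show ?thesis by (rule power2_le_imp_le) simp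
  qed
  moreover have "truncation n (ell2_nth (x + y)) = truncation n (ell2_nth x) + truncation n (ell2_nth y)" for x y
    by (rule ell2_eqI) (simp add: ell2_nth_truncation)
  moreover have "truncation n (ell2_nth (c *\<^sub>C x)) = c *\<^sub>C truncation n (ell2_nth x)" for c x
    by (rule ell2_eqI) (simp add: ell2_nth_truncation)
  ultimately have "gram_square m (\<lambda>l. truncation n (ell2_nth (f l))) \<le> gram_square m f"
    by (intro gram_square_contract[where T="\<lambda>f. truncation n (ell2_nth f)"])
  then show ?thesis unfolding gram_square_truncation .
qed

lemma coef_gram_cnj: "coef_gram n m (\<lambda>l p. cnj (g l p)) = coef_gram n m g"
proof -
  have "cmod (\<Sum>p<n. cnj (g l p) * cnj (cnj (g l' p))) = cmod (\<Sum>p<n. g l p * cnj (g l' p))" for l l'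
  proof -
    have "(\<Sum>p<n. cnj (g l p) * cnj (cnj (g l' p))) = cnj (\<Sum>p<n. g l p * cnj (g l' p))" by simp
    then show ?thesis by (simp only: complex_mod_cnj)
  qed
  then show ?thesis unfolding coef_gram_def by simp
qed

text \<open>The entries of the product of the adjoint of \<open>g'\<close>, of \<open>X\<close> and of \<open>g\<close>, where \<open>g\<close> and \<open>g'\<close> are
  given by their columns.\<close>

definition compress ::
    "nat \<Rightarrow> (nat \<Rightarrow> nat \<Rightarrow> complex) \<Rightarrow> (nat \<Rightarrow> nat \<Rightarrow> complex) \<Rightarrow> (nat \<Rightarrow> nat \<Rightarrow> 'a::complex_vector) \<Rightarrow>
     nat \<Rightarrow> nat \<Rightarrow> 'a"
  where "compress n g g' X k l = (\<Sum>r<n. \<Sum>p<n. (cnj (g' k r) * g l p) *\<^sub>C X r p)"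

lemma corner_op_bounded: "corner_op n a \<in> bounded_operators"
  unfolding bounded_operators_def
  by (auto simp: corner_op.rep_eq complex_vector.scale_sum_right scaleC_scaleC sum_distrib_left mult_ac
      intro!: sum.cong)

lemma ell2_nth_corner_op:
  "ell2_nth (blinfun_apply (corner_op n a) f) k = (if k < n then \<Sum>l<n. a k l * ell2_nth f l else 0)"
  by (simp add: corner_op.rep_eq ell2_nth_sum ell2_nth_basis if_distrib cong: if_cong)

lemma cinner_corner_op:
  "cinner (blinfun_apply (corner_op n (\<lambda>k l. ell2_nth (X k l) i)) (f l)) (f' k)
    = ell2_nth (compress n (\<lambda>l. ell2_nth (f l)) (\<lambda>l. ell2_nth (f' l)) X k l) i"
proof -
  have "cinner (blinfun_apply (corner_op n (\<lambda>k l. ell2_nth (X k l) i)) (f l)) (f' k)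
      = cnj (cinner (f' k) (blinfun_apply (corner_op n (\<lambda>k l. ell2_nth (X k l) i)) (f l)))"
    by (rule cinner_commute)
  also have "\<dots> = (\<Sum>r<n. cnj (ell2_nth (f' k) r) * (\<Sum>p<n. ell2_nth (X r p) i * ell2_nth (f l) p))"
    by (subst cinner_ell2_finite_support[of "{..<n}"]) (auto simp: ell2_nth_corner_op)
  also have "\<dots> = ell2_nth (compress n (\<lambda>l. ell2_nth (f l)) (\<lambda>l. ell2_nth (f' l)) X k l) i"
    unfolding compress_def by (simp add: ell2_nth_sum sum_distrib_left mult_ac)
  finally show ?thesis .
qed

text \<open>The Hilbert-Schmidt norm dominates the operator norm. Summed over coordinates, this
  bounds all finite sections of a matrix over \<open>OH\<close> uniformly.\<close>

lemma norm_corner_op_le: "(norm (corner_op n a))\<^sup>2 \<le> (\<Sum>k<n. \<Sum>l<n. (cmod (a k l))\<^sup>2)"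
proof -
  let ?b = "\<Sum>k<n. \<Sum>l<n. (cmod (a k l))\<^sup>2"
  have b0: "0 \<le> ?b" by (intro sum_nonneg) auto
  have "norm (blinfun_apply (corner_op n a) f) \<le> sqrt ?b * norm f" for f
  proof (rule power2_le_imp_le)
    have "(norm (blinfun_apply (corner_op n a) f))\<^sup>2 = (\<Sum>k<n. (cmod (\<Sum>l<n. a k l * ell2_nth f l))\<^sup>2)"
      by (subst norm_ell2_finite_support[of "{..<n}"]) (auto simp: ell2_nth_corner_op)
    also have "\<dots> \<le> (\<Sum>k<n. (\<Sum>l<n. (cmod (a k l))\<^sup>2) * (norm f)\<^sup>2)"
    proof (rule sum_mono)
      fix k
      have "cmod (\<Sum>l<n. a k l * ell2_nth f l) \<le> (\<Sum>l<n. cmod (a k l) * cmod (ell2_nth f l))"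
        by (rule order.trans[OF norm_sum]) (simp add: norm_mult)
      also have "\<dots> \<le> sqrt (\<Sum>l<n. (cmod (a k l))\<^sup>2) * sqrt (\<Sum>l<n. (cmod (ell2_nth f l))\<^sup>2)"
        by (rule sum_cmod_mult_le)
      finally have "(cmod (\<Sum>l<n. a k l * ell2_nth f l))\<^sup>2
          \<le> (sqrt (\<Sum>l<n. (cmod (a k l))\<^sup>2) * sqrt (\<Sum>l<n. (cmod (ell2_nth f l))\<^sup>2))\<^sup>2"
        by (rule power_mono) simp
      also have "\<dots> = (\<Sum>l<n. (cmod (a k l))\<^sup>2) * (\<Sum>l<n. (cmod (ell2_nth f l))\<^sup>2)"
        by (simp add: power_mult_distrib sum_nonneg)
      also have "\<dots> \<le> (\<Sum>l<n. (cmod (a k l))\<^sup>2) * (norm f)\<^sup>2"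
        by (intro mult_left_mono sum_ell2_nth_le sum_nonneg) auto
      finally show "(cmod (\<Sum>l<n. a k l * ell2_nth f l))\<^sup>2 \<le> (\<Sum>l<n. (cmod (a k l))\<^sup>2) * (norm f)\<^sup>2" .
    qed
    also have "\<dots> = (sqrt ?b * norm f)\<^sup>2" using b0 by (simp add: power_mult_distrib sum_distrib_right)
    finally show "(norm (blinfun_apply (corner_op n a) f))\<^sup>2 \<le> (sqrt ?b * norm f)\<^sup>2" .
  qed (simp add: b0)
  then have "norm (corner_op n a) \<le> sqrt ?b" using b0 by (intro norm_blinfun_bound) auto
  then have "(norm (corner_op n a))\<^sup>2 \<le> (sqrt ?b)\<^sup>2" by (rule power_mono) simp
  then show ?thesis using b0 by simp
qed

text \<open>The positive test for the coefficient matrices of \<open>X\<close>, after summation over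
  the coordinates: these enter only through the norms of the compressions. This is why complete
  contractivity of a map into \<open>OH\<close> depends on nothing but the induced form.\<close>

definition oh_test :: "nat \<Rightarrow> (nat \<Rightarrow> nat \<Rightarrow> 'a::complex_normed_vector) \<Rightarrow> real \<Rightarrow> bool"
  where "oh_test n X c \<longleftrightarrow> (\<forall>m m' g g'.
    (\<Sum>k<m'. \<Sum>l<m. (norm (compress n g g' X k l))\<^sup>2) \<le> c\<^sup>2 * sqrt (coef_gram n m g * coef_gram n m' g'))"

text \<open>Corner operators only see the first \<open>n\<close> coordinates of the test vectors,
  and truncating the vectors does not increase their Gram square.\<close>

lemma conj_square_test_corner_op:
  "conj_square_test J (\<lambda>i. corner_op n (\<lambda>k l. ell2_nth (X k l) i)) c \<longleftrightarrow> (\<forall>m m' g g'.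
    (\<Sum>i\<in>J. \<Sum>k<m'. \<Sum>l<m. (cmod (ell2_nth (compress n g g' X k l) i))\<^sup>2)
      \<le> c\<^sup>2 * sqrt (coef_gram n m g * coef_gram n m' g'))" (is "_ \<longleftrightarrow> ?R")
proof
  assume t: "conj_square_test J (\<lambda>i. corner_op n (\<lambda>k l. ell2_nth (X k l) i)) c"
  show ?R
  proof (intro allI)
    fix m m' g g'
    have "compress n (\<lambda>l. ell2_nth (truncation n (g l))) (\<lambda>l. ell2_nth (truncation n (g' l))) X k l
        = compress n g g' X k l" for k l
      unfolding compress_def by (simp add: ell2_nth_truncation)
    then show "(\<Sum>i\<in>J. \<Sum>k<m'. \<Sum>l<m. (cmod (ell2_nth (compress n g g' X k l) i))\<^sup>2)
      \<le> c\<^sup>2 * sqrt (coef_gram n m g * coef_gram n m' g')"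
      using t[unfolded conj_square_test_def, THEN spec[of _ m], THEN spec[of _ m'],
          THEN spec[of _ "\<lambda>l. truncation n (g l)"], THEN spec[of _ "\<lambda>l. truncation n (g' l)"]]
      unfolding cinner_corner_op[where f="\<lambda>l. truncation n (g l)" and f'="\<lambda>l. truncation n (g' l)"]
        gram_square_truncation by simp
  qed
next
  assume R: ?R
  show "conj_square_test J (\<lambda>i. corner_op n (\<lambda>k l. ell2_nth (X k l) i)) c"
    unfolding conj_square_test_def cinner_corner_op
  proof (intro allI)
    fix m m' and h h' :: "nat \<Rightarrow> nat ell2"
    have "(\<Sum>i\<in>J. \<Sum>k<m'. \<Sum>l<m. (cmod (ell2_nth (compress n (\<lambda>l. ell2_nth (h l)) (\<lambda>l. ell2_nth (h' l)) X k l) i))\<^sup>2)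
      \<le> c\<^sup>2 * sqrt (coef_gram n m (\<lambda>l. ell2_nth (h l)) * coef_gram n m' (\<lambda>l. ell2_nth (h' l)))"
      using R by blast
    also have "\<dots> \<le> c\<^sup>2 * sqrt (gram_square m h * gram_square m' h')"
      by (intro mult_left_mono real_sqrt_le_mono mult_mono coef_gram_le_gram_square
          coef_gram_nonneg gram_square_nonneg) simp
    finally show "(\<Sum>i\<in>J. \<Sum>k<m'. \<Sum>l<m. (cmod (ell2_nth (compress n (\<lambda>l. ell2_nth (h l)) (\<lambda>l. ell2_nth (h' l)) X k l) i))\<^sup>2)
      \<le> c\<^sup>2 * sqrt (gram_square m h * gram_square m' h')" .
  qed
qed

lemma oh_test_iff_finite:
  "oh_test n X c \<longleftrightarrow> (\<forall>J. finite J \<longrightarrow> conj_square_test J (\<lambda>i. corner_op n (\<lambda>k l. ell2_nth (X k l) i)) c)"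
proof
  assume t: "oh_test n X c"
  show "\<forall>J. finite J \<longrightarrow> conj_square_test J (\<lambda>i. corner_op n (\<lambda>k l. ell2_nth (X k l) i)) c"
    unfolding conj_square_test_corner_op
  proof (intro allI impI)
    fix J :: "'a set" and m m' g g' assume J: "finite J"
    have "(\<Sum>i\<in>J. \<Sum>k<m'. \<Sum>l<m. (cmod (ell2_nth (compress n g g' X k l) i))\<^sup>2)
        = (\<Sum>k<m'. \<Sum>i\<in>J. \<Sum>l<m. (cmod (ell2_nth (compress n g g' X k l) i))\<^sup>2)"
      by (rule sum.swap)
    also have "\<dots> = (\<Sum>k<m'. \<Sum>l<m. \<Sum>i\<in>J. (cmod (ell2_nth (compress n g g' X k l) i))\<^sup>2)"
      by (intro sum.cong refl sum.swap)
    also have "\<dots> \<le> (\<Sum>k<m'. \<Sum>l<m. (norm (compress n g g' X k l))\<^sup>2)"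
      by (intro sum_mono sum_ell2_nth_le J)
    also have "\<dots> \<le> c\<^sup>2 * sqrt (coef_gram n m g * coef_gram n m' g')"
      using t unfolding oh_test_def by blast
    finally show "(\<Sum>i\<in>J. \<Sum>k<m'. \<Sum>l<m. (cmod (ell2_nth (compress n g g' X k l) i))\<^sup>2)
      \<le> c\<^sup>2 * sqrt (coef_gram n m g * coef_gram n m' g')" .
  qed
next
  assume R: "\<forall>J. finite J \<longrightarrow> conj_square_test J (\<lambda>i. corner_op n (\<lambda>k l. ell2_nth (X k l) i)) c"
  show "oh_test n X c" unfolding oh_test_def
  proof (intro allI)
    fix m m' g g'
    have "(\<Sum>(k, l)\<in>{..<m'} \<times> {..<m}. (norm (compress n g g' X k l))\<^sup>2)
        = (\<Sum>a\<in>{..<m'} \<times> {..<m}. (norm (case_prod (compress n g g' X) a))\<^sup>2)"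
      by (simp add: case_prod_unfold)
    also have "\<dots> \<le> c\<^sup>2 * sqrt (coef_gram n m g * coef_gram n m' g')"
    proof (rule sum_norm_ell2_le)
      fix J :: "'a set" assume "finite J"
      then have "(\<Sum>i\<in>J. \<Sum>k<m'. \<Sum>l<m. (cmod (ell2_nth (compress n g g' X k l) i))\<^sup>2)
          \<le> c\<^sup>2 * sqrt (coef_gram n m g * coef_gram n m' g')"
        using R unfolding conj_square_test_corner_op by blast
      then show "(\<Sum>i\<in>J. \<Sum>a\<in>{..<m'} \<times> {..<m}. (cmod (ell2_nth (case_prod (compress n g g' X) a) i))\<^sup>2)
          \<le> c\<^sup>2 * sqrt (coef_gram n m g * coef_gram n m' g')"
        by (simp only: sum.cartesian_product' case_prod_conv)
    qed simp
    finally show "(\<Sum>k<m'. \<Sum>l<m. (norm (compress n g g' X k l))\<^sup>2)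
        \<le> c\<^sup>2 * sqrt (coef_gram n m g * coef_gram n m' g')"
      by (simp only: sum.cartesian_product' case_prod_conv)
  qed
qed

text \<open>A bounded increasing net converges to its supremum; bounds on the \<open>Lim\<close> in
  \<open>oh_matrix_norm\<close> thereby reduce to bounds on finite sections.\<close>

lemma Lim_finite_subsets_le_iff:
  fixes f :: "'i set \<Rightarrow> real"
  assumes mono: "\<And>J J'. finite J' \<Longrightarrow> J \<subseteq> J' \<Longrightarrow> f J \<le> f J'"
    and bdd: "\<And>J. finite J \<Longrightarrow> f J \<le> b"
  shows "Lim (finite_subsets_at_top UNIV) f \<le> c \<longleftrightarrow> (\<forall>J. finite J \<longrightarrow> f J \<le> c)"
proof -
  let ?s = "SUP J\<in>Collect finite. f J"
  have B: "bdd_above (f ` Collect finite)" using bdd by (intro bdd_aboveI2[of _ _ b]) auto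
  have "(f \<longlongrightarrow> ?s) (finite_subsets_at_top UNIV)"
  proof (rule order_tendstoI)
    fix a assume "a < ?s"
    then obtain J where J: "finite J" "a < f J" using less_cSUP_iff[OF _ B] by auto
    then have "\<forall>J'. finite J' \<and> J \<subseteq> J' \<longrightarrow> a < f J'" using mono by (meson less_le_trans)
    then show "\<forall>\<^sub>F J in finite_subsets_at_top UNIV. a < f J"
      unfolding eventually_finite_subsets_at_top using J(1) by blast
  next
    fix a assume "?s < a"
    then have "f J < a" if "finite J" for J
      using cSUP_upper[OF _ B, of J] that by fastforce
    then show "\<forall>\<^sub>F J in finite_subsets_at_top UNIV. f J < a"
      unfolding eventually_finite_subsets_at_top by blast
  qed
  then have "Lim (finite_subsets_at_top UNIV) f = ?s" by (intro tendsto_Lim) simp_all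
  then show ?thesis using cSUP_le_iff[OF _ B, of c] by auto
qed

lemma oh_matrix_norm_le_iff_finite:
  "oh_matrix_norm n X \<le> c \<longleftrightarrow>
    (\<forall>J. finite J \<longrightarrow> conj_square_norm J (\<lambda>i. corner_op n (\<lambda>k l. ell2_nth (X k l) i)) \<le> c)"
proof -
  let ?x = "\<lambda>i. corner_op n (\<lambda>k l. ell2_nth (X k l) i)"
  have iff: "conj_square_norm J ?x \<le> c \<longleftrightarrow> conj_square_test J ?x c" if "finite J" "0 \<le> c" for J c
    using that by (intro conj_square_norm_le_iff corner_op_bounded)
  \<comment> \<open>Further indices only add nonnegative terms to the left side of every
    test.\<close>
  have mono: "conj_square_norm J ?x \<le> conj_square_norm J' ?x" if J: "finite J'" "J \<subseteq> J'" for J J'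
  proof -
    have fin: "finite J" using J finite_subset by blast
    let ?c = "conj_square_norm J' ?x"
    have "conj_square_test J' ?x ?c" by (intro conj_square_norm_test J corner_op_bounded)
    then have "conj_square_test J ?x ?c"
      unfolding conj_square_test_def
    proof (intro allI)
      fix m m' :: nat and h h' :: "nat \<Rightarrow> nat ell2"
      assume a: "\<forall>m m' h h'. (\<Sum>i\<in>J'. \<Sum>k<m'. \<Sum>l<m. (cmod (cinner (?x i (h l)) (h' k)))\<^sup>2) \<le> ?c\<^sup>2 * sqrt (gram_square m h * gram_square m' h')"
      have "(\<Sum>i\<in>J. \<Sum>k<m'. \<Sum>l<m. (cmod (cinner (?x i (h l)) (h' k)))\<^sup>2)
          \<le> (\<Sum>i\<in>J'. \<Sum>k<m'. \<Sum>l<m. (cmod (cinner (?x i (h l)) (h' k)))\<^sup>2)"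
        by (rule sum_mono2[OF J]) (auto intro!: sum_nonneg)
      also have "\<dots> \<le> ?c\<^sup>2 * sqrt (gram_square m h * gram_square m' h')" using a by blast
      finally show "(\<Sum>i\<in>J. \<Sum>k<m'. \<Sum>l<m. (cmod (cinner (?x i (h l)) (h' k)))\<^sup>2)
          \<le> ?c\<^sup>2 * sqrt (gram_square m h * gram_square m' h')" .
    qed
    then show ?thesis using iff[OF fin] by (simp add: conj_square_norm_nonneg J(1) corner_op_bounded)
  qed
  have bdd: "conj_square_norm J ?x \<le> sqrt (\<Sum>k<n. \<Sum>l<n. (norm (X k l))\<^sup>2)" if J: "finite J" for J
  proof -
    have "conj_square_norm J ?x \<le> sqrt (\<Sum>i\<in>J. (norm (?x i))\<^sup>2)"
      by (intro conj_square_norm_le_sum_norm J corner_op_bounded)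
    also have "(\<Sum>i\<in>J. (norm (?x i))\<^sup>2) \<le> (\<Sum>i\<in>J. \<Sum>k<n. \<Sum>l<n. (cmod (ell2_nth (X k l) i))\<^sup>2)"
      by (intro sum_mono norm_corner_op_le)
    also have "\<dots> = (\<Sum>k<n. \<Sum>i\<in>J. \<Sum>l<n. (cmod (ell2_nth (X k l) i))\<^sup>2)" by (rule sum.swap)
    also have "\<dots> = (\<Sum>k<n. \<Sum>l<n. \<Sum>i\<in>J. (cmod (ell2_nth (X k l) i))\<^sup>2)"
      by (intro sum.cong refl sum.swap)
    also have "\<dots> \<le> (\<Sum>k<n. \<Sum>l<n. (norm (X k l))\<^sup>2)" by (intro sum_mono sum_ell2_nth_le J)
    finally show ?thesis by simp
  qed
  show ?thesis
    unfolding oh_matrix_norm_def by (rule Lim_finite_subsets_le_iff[OF mono bdd])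
qed

theorem oh_matrix_norm_le_iff:
  assumes "0 \<le> c"
  shows "oh_matrix_norm n X \<le> c \<longleftrightarrow> oh_test n X c"
proof -
  let ?x = "\<lambda>i. corner_op n (\<lambda>k l. ell2_nth (X k l) i)"
  have "conj_square_norm J ?x \<le> c \<longleftrightarrow> conj_square_test J ?x c" if "finite J" for J
    by (intro conj_square_norm_le_iff corner_op_bounded that assms)
  then show ?thesis unfolding oh_matrix_norm_le_iff_finite oh_test_iff_finite by simp
qed

lemma oh_matrix_norm_nonneg: "0 \<le> oh_matrix_norm n X"
proof -
  have "conj_square_norm {} (\<lambda>i. corner_op n (\<lambda>k l. ell2_nth (X k l) i)) \<le> oh_matrix_norm n X"
    using oh_matrix_norm_le_iff_finite[of n X "oh_matrix_norm n X"] by simp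
  moreover have "0 \<le> conj_square_norm {} (\<lambda>i. corner_op n (\<lambda>k l. ell2_nth (X k l) i))"
    by (rule conj_square_norm_nonneg) simp_all
  ultimately show ?thesis by linarith
qed

lemma oh_test_oh_matrix_norm: "oh_test n X (oh_matrix_norm n X)"
  using oh_matrix_norm_le_iff[OF oh_matrix_norm_nonneg] by blast

text \<open>In size one every test with constant \<open>norm x\<close> is an equality, because both
  Gram expressions are squares.\<close>

lemma oh_matrix_norm_one: "oh_matrix_norm 1 (\<lambda>i j. x) \<le> norm x"
proof -
  have "oh_test 1 (\<lambda>i j. x) (norm x)"
    unfolding oh_test_def
  proof (intro allI)
    fix m m' and g g' :: "nat \<Rightarrow> nat \<Rightarrow> complex"
    have gram: "coef_gram 1 m g = (\<Sum>l<m. (cmod (g l 0))\<^sup>2)\<^sup>2" for m and g :: "nat \<Rightarrow> nat \<Rightarrow> complex"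
    proof -
      have "(\<Sum>l<m. (cmod (g l 0))\<^sup>2)\<^sup>2 = (\<Sum>l<m. (cmod (g l 0))\<^sup>2) * (\<Sum>l<m. (cmod (g l 0))\<^sup>2)"
        by (rule power2_eq_square)
      also have "\<dots> = (\<Sum>l<m. \<Sum>l'<m. (cmod (g l 0))\<^sup>2 * (cmod (g l' 0))\<^sup>2)" by (rule sum_product)
      also have "\<dots> = coef_gram 1 m g"
        unfolding coef_gram_def by (intro sum.cong refl) (simp add: norm_mult power_mult_distrib)
      finally show ?thesis by simp
    qed
    have "(\<Sum>k<m'. \<Sum>l<m. (norm (compress 1 g g' (\<lambda>i j. x) k l))\<^sup>2)
        = (norm x)\<^sup>2 * ((\<Sum>k<m'. (cmod (g' k 0))\<^sup>2) * (\<Sum>l<m. (cmod (g l 0))\<^sup>2))"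
    proof -
      have "(\<Sum>k<m'. (cmod (g' k 0))\<^sup>2) * (\<Sum>l<m. (cmod (g l 0))\<^sup>2)
          = (\<Sum>k<m'. \<Sum>l<m. (cmod (g' k 0))\<^sup>2 * (cmod (g l 0))\<^sup>2)" by (rule sum_product)
      then show ?thesis
        by (simp add: sum_distrib_left compress_def norm_scaleC norm_mult power_mult_distrib mult_ac)
    qed
    also have "(\<Sum>k<m'. (cmod (g' k 0))\<^sup>2) * (\<Sum>l<m. (cmod (g l 0))\<^sup>2)
        = sqrt (coef_gram 1 m g * coef_gram 1 m' g')"
      unfolding gram real_sqrt_mult by (simp add: sum_nonneg)
    finally show "(\<Sum>k<m'. \<Sum>l<m. (norm (compress 1 g g' (\<lambda>i j. x) k l))\<^sup>2)
        \<le> (norm x)\<^sup>2 * sqrt (coef_gram 1 m g * coef_gram 1 m' g')" by simp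
  qed
  then show ?thesis by (simp add: oh_matrix_norm_le_iff)
qed

section \<open>Matrix norms of operators and complete boundedness\<close>

definition op_matrix_bound :: "nat \<Rightarrow> (nat \<Rightarrow> nat \<Rightarrow> 'h::chilbert_space \<Rightarrow>\<^sub>L 'h) \<Rightarrow> real \<Rightarrow> bool"
  where "op_matrix_bound n x c \<longleftrightarrow> 0 \<le> c \<and>
    (\<forall>h. L2_set (\<lambda>i. norm (\<Sum>j<n. x i j (h j))) {..<n} \<le> c * L2_set (\<lambda>j. norm (h j)) {..<n})"

lemma op_matrix_norm_eq_Inf: "op_matrix_norm n x = Inf {c. op_matrix_bound n x c}"
  unfolding op_matrix_norm_def op_matrix_bound_def ..

lemma op_matrix_norm_le: "op_matrix_bound n x c \<Longrightarrow> op_matrix_norm n x \<le> c"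
  unfolding op_matrix_norm_eq_Inf
  by (rule cInf_lower) (auto simp: op_matrix_bound_def intro!: bdd_belowI[of _ 0])

lemma Inf_mult_bound:
  fixes a b :: real
  assumes ne: "S \<noteq> {}" and b: "0 \<le> b" and le: "\<And>c. c \<in> S \<Longrightarrow> a \<le> c * b"
  shows "a \<le> Inf S * b"
proof (cases "b = 0")
  case True
  then show ?thesis using ne le by fastforce
next
  case False
  then have b: "0 < b" using b by simp
  have "a / b \<le> Inf S" by (rule cInf_greatest[OF ne]) (use le b in \<open>simp add: field_simps\<close>)
  then show ?thesis using b by (simp add: field_simps)
qed

lemma op_matrix_bound_exists: "\<exists>c. op_matrix_bound n x c"
proof -
  let ?N = "\<Sum>i<n. \<Sum>j<n. norm (x i j)"
  have "op_matrix_bound n x ?N"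
    unfolding op_matrix_bound_def
  proof (intro conjI allI)
    fix h
    have "L2_set (\<lambda>i. norm (\<Sum>j<n. x i j (h j))) {..<n} \<le> (\<Sum>i<n. norm (\<Sum>j<n. x i j (h j)))"
      by (rule L2_set_le_sum) simp
    also have "\<dots> \<le> (\<Sum>i<n. \<Sum>j<n. norm (x i j) * L2_set (\<lambda>j. norm (h j)) {..<n})"
    proof (intro sum_mono order.trans[OF norm_sum])
      fix i j assume "j \<in> {..<n}"
      then have "norm (h j) \<le> L2_set (\<lambda>j. norm (h j)) {..<n}" by (intro member_le_L2_set) auto
      then show "norm (x i j (h j)) \<le> norm (x i j) * L2_set (\<lambda>j. norm (h j)) {..<n}"
        by (meson mult_left_mono norm_blinfun norm_ge_zero order_trans)
    qed
    also have "\<dots> = ?N * L2_set (\<lambda>j. norm (h j)) {..<n}" by (simp add: sum_distrib_right)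
    finally show "L2_set (\<lambda>i. norm (\<Sum>j<n. x i j (h j))) {..<n} \<le> ?N * L2_set (\<lambda>j. norm (h j)) {..<n}" .
  qed (simp add: sum_nonneg)
  then show ?thesis ..
qed

lemma op_matrix_norm_nonneg: "0 \<le> op_matrix_norm n x"
  unfolding op_matrix_norm_eq_Inf using op_matrix_bound_exists[of n x]
  by (intro cInf_greatest) (auto simp: op_matrix_bound_def)

lemma op_matrix_norm_attained: "op_matrix_bound n x (op_matrix_norm n x)"
  unfolding op_matrix_bound_def
proof (intro conjI allI op_matrix_norm_nonneg)
  fix h
  show "L2_set (\<lambda>i. norm (\<Sum>j<n. x i j (h j))) {..<n} \<le> op_matrix_norm n x * L2_set (\<lambda>j. norm (h j)) {..<n}"
    unfolding op_matrix_norm_eq_Inf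
    by (rule Inf_mult_bound) (use op_matrix_bound_exists[of n x] in \<open>auto simp: op_matrix_bound_def\<close>)
qed

lemma op_matrix_norm_cinner_le:
  fixes x :: "nat \<Rightarrow> nat \<Rightarrow> 'h::chilbert_space \<Rightarrow>\<^sub>L 'h"
  shows "cmod (\<Sum>i<n. \<Sum>j<n. cinner (x i j (h j)) (h' i))
    \<le> op_matrix_norm n x * L2_set (\<lambda>j. norm (h j)) {..<n} * L2_set (\<lambda>i. norm (h' i)) {..<n}"
proof -
  have "cmod (\<Sum>i<n. \<Sum>j<n. cinner (x i j (h j)) (h' i)) \<le> (\<Sum>i<n. cmod (cinner (\<Sum>j<n. x i j (h j)) (h' i)))"
    unfolding cinner_sum_left by (rule norm_sum)
  also have "\<dots> \<le> (\<Sum>i<n. norm (\<Sum>j<n. x i j (h j)) * norm (h' i))"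
    by (intro sum_mono cinner_Cauchy_Schwarz)
  also have "\<dots> \<le> L2_set (\<lambda>i. norm (\<Sum>j<n. x i j (h j))) {..<n} * L2_set (\<lambda>i. norm (h' i)) {..<n}"
    using L2_set_mult_ineq[of "\<lambda>i. norm (\<Sum>j<n. x i j (h j))" "\<lambda>i. norm (h' i)" "{..<n}"] by simp
  also have "\<dots> \<le> op_matrix_norm n x * L2_set (\<lambda>j. norm (h j)) {..<n} * L2_set (\<lambda>i. norm (h' i)) {..<n}"
    using op_matrix_norm_attained[of n x] unfolding op_matrix_bound_def
    by (intro mult_right_mono) (auto simp: L2_set_nonneg)
  finally show ?thesis .
qed

lemma op_matrix_norm_leI:
  fixes x :: "nat \<Rightarrow> nat \<Rightarrow> 'h::chilbert_space \<Rightarrow>\<^sub>L 'h"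
  assumes c: "0 \<le> c"
    and le: "\<And>h h'. cmod (\<Sum>i<n. \<Sum>j<n. cinner (x i j (h j)) (h' i))
      \<le> c * L2_set (\<lambda>j. norm (h j)) {..<n} * L2_set (\<lambda>i. norm (h' i)) {..<n}"
  shows "op_matrix_norm n x \<le> c"
proof (rule op_matrix_norm_le)
  show "op_matrix_bound n x c"
    unfolding op_matrix_bound_def
  proof (intro conjI allI c)
    fix h
    \<comment> \<open>Pairing with the image vector itself turns the bilinear estimate into a norm
      estimate, after cancelling one factor \<open>?l\<close>.\<close>
    define h' where "h' i = (\<Sum>j<n. x i j (h j))" for i
    let ?l = "L2_set (\<lambda>i. norm (h' i)) {..<n}"
    have "?l * ?l = (\<Sum>i<n. (norm (h' i))\<^sup>2)"
      unfolding L2_set_def by (simp add: sum_nonneg)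
    also have "\<dots> = cmod (\<Sum>i<n. \<Sum>j<n. cinner (x i j (h j)) (h' i))"
    proof -
      have "(\<Sum>i<n. \<Sum>j<n. cinner (x i j (h j)) (h' i)) = of_real (\<Sum>i<n. (norm (h' i))\<^sup>2)"
        by (simp only: cinner_sum_left[symmetric] h'_def[symmetric] cinner_self of_real_sum)
      then show ?thesis by (simp only: norm_of_real) (simp add: sum_nonneg)
    qed
    also have "\<dots> \<le> c * L2_set (\<lambda>j. norm (h j)) {..<n} * ?l" by (rule le)
    finally have "?l * ?l \<le> c * L2_set (\<lambda>j. norm (h j)) {..<n} * ?l" .
    moreover have "0 \<le> ?l" "0 \<le> c * L2_set (\<lambda>j. norm (h j)) {..<n}" using c by (simp_all add: L2_set_nonneg)
    ultimately have "?l \<le> c * L2_set (\<lambda>j. norm (h j)) {..<n}"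
      by (cases "?l = 0") (auto simp: mult_le_cancel_right)
    then show "L2_set (\<lambda>i. norm (\<Sum>j<n. x i j (h j))) {..<n} \<le> c * L2_set (\<lambda>j. norm (h j)) {..<n}"
      unfolding h'_def .
  qed
qed

lemma op_matrix_norm_one: "op_matrix_norm 1 (\<lambda>i j. x) = norm x"
proof (rule antisym)
  show "op_matrix_norm 1 (\<lambda>i j. x) \<le> norm x"
    by (rule op_matrix_norm_le) (auto simp: op_matrix_bound_def L2_set_def norm_blinfun)
  show "norm x \<le> op_matrix_norm 1 (\<lambda>i j. x)"
  proof (rule norm_blinfun_bound)
    fix h
    show "norm (x h) \<le> op_matrix_norm 1 (\<lambda>i j. x) * norm h"
      using op_matrix_norm_attained[of 1 "\<lambda>i j. x", unfolded op_matrix_bound_def, THEN conjunct2,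
          rule_format, of "\<lambda>_. h"]
      by (simp add: L2_set_def)
  qed (rule op_matrix_norm_nonneg)
qed

section \<open>Completely bounded norms and summing norms are attained bounds\<close>

lemma opsp_simps [simp]: "carrier (opsp E) = E" "matrix_norm (opsp E) = op_matrix_norm"
  by (simp_all add: opsp_def)

lemma OH_simps [simp]: "carrier (OH I) = ell2_space I" "matrix_norm (OH I) = oh_matrix_norm"
  by (simp_all add: OH_def)

lemma cb_norm_le: "cb_bound E F u c \<Longrightarrow> cb_norm E F u \<le> c"
  unfolding cb_norm_def by (rule cInf_lower) (auto simp: cb_bound_def intro!: bdd_belowI[of _ 0])

lemma cb_bound_cb_norm:
  assumes "completely_bounded E F u" and nonneg: "\<And>n x. 0 \<le> matrix_norm E n x"
  shows "cb_bound E F u (cb_norm E F u)"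
proof -
  have ne: "{c. cb_bound E F u c} \<noteq> {}" using assms(1) unfolding completely_bounded_def by blast
  show ?thesis
    unfolding cb_bound_def
  proof (intro conjI allI impI)
    show "0 \<le> cb_norm E F u" unfolding cb_norm_def by (rule cInf_greatest[OF ne]) (simp add: cb_bound_def)
    fix n :: nat and x assume "\<forall>i<n. \<forall>j<n. x i j \<in> carrier E"
    then show "matrix_norm F n (\<lambda>i j. u (x i j)) \<le> cb_norm E F u * matrix_norm E n x"
      unfolding cb_norm_def by (intro Inf_mult_bound[OF ne nonneg]) (simp add: cb_bound_def)
  qed
qed

lemma cb_bound_cb_norm_opsp: "completely_bounded (opsp E) F u \<Longrightarrow> cb_bound (opsp E) F u (cb_norm (opsp E) F u)"
  by (rule cb_bound_cb_norm) (simp_all add: op_matrix_norm_nonneg)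

lemma cb_bound_cb_norm_OH: "completely_bounded (OH I) F u \<Longrightarrow> cb_bound (OH I) F u (cb_norm (OH I) F u)"
  by (rule cb_bound_cb_norm) (simp_all add: oh_matrix_norm_nonneg)

lemma two_oh_bound_pi_2oh:
  fixes E :: "('k::chilbert_space \<Rightarrow>\<^sub>L 'k) set"
  assumes E: "E \<subseteq> bounded_operators" and "two_oh_summing E w"
  shows "two_oh_bound E w (pi_2oh E w)"
proof -
  have ne: "{c. two_oh_bound E w c} \<noteq> {}" using assms(2) unfolding two_oh_summing_def by blast
  show ?thesis
    unfolding two_oh_bound_def
  proof (intro conjI allI impI)
    show "0 \<le> pi_2oh E w" unfolding pi_2oh_def by (rule cInf_greatest[OF ne]) (simp add: two_oh_bound_def)
    fix n :: nat and x :: "nat \<Rightarrow> 'k \<Rightarrow>\<^sub>L 'k" assume x: "\<forall>i<n. x i \<in> E"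
    then have "0 \<le> conj_square_norm {..<n} x" using E by (intro conj_square_norm_nonneg) auto
    then show "L2_set (\<lambda>i. norm (w (x i))) {..<n} \<le> pi_2oh E w * conj_square_norm {..<n} x"
      unfolding pi_2oh_def by (intro Inf_mult_bound[OF ne]) (use x in \<open>simp_all add: two_oh_bound_def\<close>)
  qed
qed

lemma pi_2oh_le: "two_oh_bound E w c \<Longrightarrow> pi_2oh E w \<le> c"
  unfolding pi_2oh_def by (rule cInf_lower) (auto simp: two_oh_bound_def intro!: bdd_belowI[of _ 0])

text \<open>The test with the scalar \<open>1\<close> on both sides recovers the norm of
  \<open>x\<close>.\<close>

lemma oh_matrix_norm_one_ge: "norm x \<le> oh_matrix_norm 1 (\<lambda>i j. x)"
proof -
  have "(\<Sum>k<1. \<Sum>l<1. (norm (compress 1 (\<lambda>l p. 1) (\<lambda>l p. 1) (\<lambda>i j. x) k l))\<^sup>2)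
      \<le> (oh_matrix_norm 1 (\<lambda>i j. x))\<^sup>2 * sqrt (coef_gram 1 1 (\<lambda>l p. 1) * coef_gram 1 1 (\<lambda>l p. 1))"
    using oh_test_oh_matrix_norm[of 1 "\<lambda>i j. x"] unfolding oh_test_def by blast
  then have "(norm x)\<^sup>2 \<le> (oh_matrix_norm 1 (\<lambda>i j. x))\<^sup>2" by (simp add: compress_def coef_gram_def)
  then show ?thesis by (rule power2_le_imp_le) (rule oh_matrix_norm_nonneg)
qed

section \<open>Linear maps on subspaces, compressions and basis expansions\<close>

lemma clinear_betweenD:
  assumes "clinear_between E F u"
  shows clinear_between_mem: "\<And>x. x \<in> E \<Longrightarrow> u x \<in> F"
    and clinear_between_add: "\<And>x y. x \<in> E \<Longrightarrow> y \<in> E \<Longrightarrow> u (x + y) = u x + u y"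
    and clinear_between_scale: "\<And>c x. x \<in> E \<Longrightarrow> u (c *\<^sub>C x) = c *\<^sub>C u x"
  using assms unfolding clinear_between_def by auto

lemma clinear_between_sum:
  assumes u: "clinear_between E F u" and E: "complex_vector.subspace E"
    and x: "\<And>i. i \<in> I \<Longrightarrow> x i \<in> E"
  shows "u (\<Sum>i\<in>I. c i *\<^sub>C x i) = (\<Sum>i\<in>I. c i *\<^sub>C u (x i))"
proof -
  have z: "u 0 = 0" using clinear_between_scale[OF u complex_vector.subspace_0[OF E], of 0] by simp
  show ?thesis using x
  proof (induction I rule: infinite_finite_induct)
    case (insert i I)
    have "(\<Sum>j\<in>I. c j *\<^sub>C x j) \<in> E" "c i *\<^sub>C x i \<in> E"
      using insert.prems by (auto intro!: complex_vector.subspace_sum[OF E] complex_vector.subspace_scale[OF E])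
    then show ?case
      using insert clinear_between_add[OF u] clinear_between_scale[OF u] by simp
  qed (simp_all add: z)
qed

lemma compress_eq_sum:
  "compress n g g' X k l = (\<Sum>(r, p)\<in>{..<n} \<times> {..<n}. (cnj (g' k r) * g l p) *\<^sub>C X r p)"
  unfolding compress_def by (simp only: sum.cartesian_product' case_prod_conv)

lemma compress_mem:
  assumes E: "complex_vector.subspace E" and X: "\<forall>i<n. \<forall>j<n. X i j \<in> E"
  shows "compress n g g' X k l \<in> E"
  unfolding compress_eq_sum
  by (rule complex_vector.subspace_sum[OF E]) (use X in \<open>auto intro!: complex_vector.subspace_scale[OF E]\<close>)

lemma clinear_between_compress:
  assumes u: "clinear_between E F u" and E: "complex_vector.subspace E" and X: "\<forall>i<n. \<forall>j<n. X i j \<in> E"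
  shows "u (compress n g g' X k l) = compress n g g' (\<lambda>i j. u (X i j)) k l"
proof -
  have "u (\<Sum>a\<in>{..<n} \<times> {..<n}. (cnj (g' k (fst a)) * g l (snd a)) *\<^sub>C X (fst a) (snd a))
      = (\<Sum>a\<in>{..<n} \<times> {..<n}. (cnj (g' k (fst a)) * g l (snd a)) *\<^sub>C u (X (fst a) (snd a)))"
    by (rule clinear_between_sum[OF u E]) (use X in auto)
  then show ?thesis unfolding compress_eq_sum case_prod_unfold .
qed

lemma subspace_ell2_space: "complex_vector.subspace (ell2_space I)"
  unfolding complex_vector.subspace_def ell2_space_def by auto

lemma closed_ell2_space: "closed (ell2_space I)"
proof -
  have "closed {f. i \<notin> I \<longrightarrow> ell2_nth f i = 0}" for i
    by (cases "i \<in> I") (auto intro!: closed_Collect_eq linear_continuous_on bounded_linear_ell2_nth)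
  then show ?thesis unfolding ell2_space_def by (rule closed_Collect_all)
qed

lemma ell2_basis_in_ell2_space: "i \<in> I \<Longrightarrow> ell2_basis i \<in> ell2_space I"
  by (auto simp: ell2_space_def ell2_nth_basis)

text \<open>By Pythagoras the squared distance to a partial sum is the tail of the series of squared
  coordinates.\<close>

lemma ell2_basis_expansion:
  "((\<lambda>J. \<Sum>i\<in>J. ell2_nth f i *\<^sub>C ell2_basis i) \<longlongrightarrow> f) (finite_subsets_at_top UNIV)"
proof -
  let ?S = "\<lambda>J. \<Sum>i\<in>J. ell2_nth f i *\<^sub>C ell2_basis i"
  have nth: "ell2_nth (?S J) i = (if i \<in> J then ell2_nth f i else 0)" if "finite J" for J i
    using that by (simp add: ell2_nth_sum ell2_nth_basis if_distrib cong: if_cong)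
  have eq: "(norm (f - ?S J))\<^sup>2 = (norm f)\<^sup>2 - (\<Sum>i\<in>J. (cmod (ell2_nth f i))\<^sup>2)" if J: "finite J" for J
  proof -
    have "cinner f (?S J) = of_real (\<Sum>i\<in>J. (cmod (ell2_nth f i))\<^sup>2)"
      unfolding cinner_sum_right cinner_scaleC_right cinner_ell2_basis of_real_sum complex_norm_square
      by (simp add: mult.commute)
    moreover have "(norm (?S J))\<^sup>2 = (\<Sum>i\<in>J. (cmod (ell2_nth f i))\<^sup>2)"
      using J by (subst norm_ell2_finite_support[OF J]) (simp_all add: nth)
    ultimately show ?thesis unfolding norm_diff_squared by simp
  qed
  have "((\<lambda>J. \<Sum>i\<in>J. (cmod (ell2_nth f i))\<^sup>2) \<longlongrightarrow> (norm f)\<^sup>2) (finite_subsets_at_top UNIV)"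
    using has_sum_infsum[OF ell2_nth_summable[of f]] unfolding has_sum_def norm_ell2_power2 .
  then have "((\<lambda>J. sqrt ((norm f)\<^sup>2 - (\<Sum>i\<in>J. (cmod (ell2_nth f i))\<^sup>2))) \<longlongrightarrow> sqrt ((norm f)\<^sup>2 - (norm f)\<^sup>2))
      (finite_subsets_at_top UNIV)"
    by (intro tendsto_intros)
  then have "((\<lambda>J. norm (f - ?S J)) \<longlongrightarrow> 0) (finite_subsets_at_top UNIV)"
  proof -
    assume lim: "((\<lambda>J. sqrt ((norm f)\<^sup>2 - (\<Sum>i\<in>J. (cmod (ell2_nth f i))\<^sup>2))) \<longlongrightarrow> sqrt ((norm f)\<^sup>2 - (norm f)\<^sup>2))
      (finite_subsets_at_top UNIV)"
    have "\<forall>\<^sub>F J in finite_subsets_at_top UNIV. sqrt ((norm f)\<^sup>2 - (\<Sum>i\<in>J. (cmod (ell2_nth f i))\<^sup>2)) = norm (f - ?S J)"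
      by (rule eventually_finite_subsets_at_top_weakI) (simp flip: eq)
    from Lim_transform_eventually[OF lim this] show ?thesis by simp
  qed
  then have "((\<lambda>J. f - ?S J) \<longlongrightarrow> 0) (finite_subsets_at_top UNIV)" by (rule tendsto_norm_zero_cancel)
  from tendsto_diff[OF tendsto_const[of f] this] show ?thesis by simp
qed

lemma norm_sum_orthogonal:
  fixes v :: "nat \<Rightarrow> 'a::chilbert_space"
  assumes "orthogonal_family n v"
  shows "(norm (\<Sum>p<n. v p))\<^sup>2 = (\<Sum>p<n. (norm (v p))\<^sup>2)"
proof -
  have "cinner (\<Sum>p<n. v p) (\<Sum>p<n. v p) = (\<Sum>p<n. \<Sum>q<n. cinner (v p) (v q))"
    unfolding cinner_sum_left unfolding cinner_sum_right ..
  also have "\<dots> = (\<Sum>p<n. \<Sum>q<n. if p = q then of_real ((norm (v p))\<^sup>2) else 0)"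
    by (intro sum.cong refl) (use assms in \<open>auto simp: orthogonal_family_def cinner_self\<close>)
  also have "\<dots> = of_real (\<Sum>p<n. (norm (v p))\<^sup>2)" by simp
  finally show ?thesis unfolding cinner_self of_real_eq_iff .
qed

text \<open>Sending the basis vectors to the orthogonal vectors \<open>e p\<close> of norm at most
  \<open>1\<close> is a contraction. The conjugated coefficients match the conjugated matrix to
  which the lemma is applied below.\<close>

lemma gram_square_combination_le:
  fixes e :: "nat \<Rightarrow> 'a::chilbert_space"
  assumes e: "orthogonal_family n e" and e1: "\<And>p. norm (e p) \<le> 1"
  shows "gram_square m (\<lambda>l. \<Sum>p<n. cnj (g l p) *\<^sub>C e p) \<le> coef_gram n m g"
proof -
  let ?T = "\<lambda>f. \<Sum>p<n. ell2_nth f p *\<^sub>C e p"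
  have "norm (?T f) \<le> norm f" for f
  proof (rule power2_le_imp_le)
    have "orthogonal_family n (\<lambda>p. ell2_nth f p *\<^sub>C e p)"
      using e by (simp add: orthogonal_family_def cinner_scaleC_left cinner_scaleC_right)
    then have "(norm (?T f))\<^sup>2 = (\<Sum>p<n. (norm (ell2_nth f p *\<^sub>C e p))\<^sup>2)" by (rule norm_sum_orthogonal)
    also have "\<dots> \<le> (\<Sum>p<n. (cmod (ell2_nth f p))\<^sup>2)"
      by (intro sum_mono power_mono) (auto simp: norm_scaleC intro: mult_left_le e1)
    also have "\<dots> \<le> (norm f)\<^sup>2" by (rule sum_ell2_nth_le) simp
    finally show "(norm (?T f))\<^sup>2 \<le> (norm f)\<^sup>2" .
  qed simp
  moreover have "?T (x + y) = ?T x + ?T y" for x y by (simp add: scaleC_add_left sum.distrib)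
  moreover have "?T (c *\<^sub>C x) = c *\<^sub>C ?T x" for c x
    by (simp add: complex_vector.scale_sum_right scaleC_scaleC)
  ultimately have "gram_square m (\<lambda>l. ?T (truncation n (\<lambda>p. cnj (g l p))))
      \<le> gram_square m (\<lambda>l. truncation n (\<lambda>p. cnj (g l p)))"
    by (intro gram_square_contract[where T="?T"])
  also have "\<dots> = coef_gram n m g" unfolding gram_square_truncation by (rule coef_gram_cnj)
  finally show ?thesis by (simp add: ell2_nth_truncation)
qed

text \<open>Testing a completely bounded map on the matrix of the conjugates of \<open>\<langle>y i e\<^sub>l, e'\<^sub>k\<rangle>\<close>, a compression of the
  conjugate of the family \<open>y\<close> itself, gives \<open>N\<^sup>2 \<le> c N\<close> for the norm \<open>N\<close> of \<open>y\<close>.\<close>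

theorem conj_square_norm_basis_image_le:
  fixes A :: "'i ell2 \<Rightarrow> 'k::chilbert_space \<Rightarrow>\<^sub>L 'k"
  assumes F: "F \<subseteq> bounded_operators" and A: "clinear_between (ell2_space I) F A"
    and cb: "cb_bound (OH I) (opsp F) A c" and J: "finite J" "J \<subseteq> I"
  shows "conj_square_norm J (\<lambda>i. A (ell2_basis i)) \<le> c"
proof -
  define y where "y i = A (ell2_basis i)" for i
  define N where "N = conj_square_norm J y"
  have c: "0 \<le> c" using cb by (simp add: cb_bound_def)
  have yb: "y i \<in> bounded_operators" if "i \<in> J" for i
  proof -
    have "ell2_basis i \<in> ell2_space I" using that J by (intro ell2_basis_in_ell2_space) blast
    then show ?thesis using clinear_between_mem[OF A] F unfolding y_def by blast
  qed
  have N0: "0 \<le> N" unfolding N_def by (rule conj_square_norm_nonneg[OF J(1) yb])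
  have Nt: "conj_square_test J y N" unfolding N_def by (rule conj_square_norm_test[OF J(1) yb])
  have "N \<le> sqrt (c * N)"
    unfolding N_def
  proof (rule conj_square_norm_leI[OF J(1) yb])
    show "0 \<le> sqrt (c * conj_square_norm J y)" using c N0 by (simp add: N_def)
    fix m m' :: nat and h h' :: "nat \<Rightarrow> 'k"
    assume oh: "orthogonal_family m h" and oh': "orthogonal_family m' h'"
    \<comment> \<open>Matrix norms concern square matrices, so both families are padded with zero
      vectors to a common length.\<close>
    define n where "n = max m m'"
    define e where "e l = (if l < m then complex_of_real (1 / norm (h l)) *\<^sub>C h l else 0)" for l
    define e' where "e' l = (if l < m' then complex_of_real (1 / norm (h' l)) *\<^sub>C h' l else 0)" for l
    \<comment> \<open>In terms of the unit vectors, \<open>w l\<close> carries the weight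
      \<open>(norm (h l))\<^sup>2\<close> that the squared coefficient of \<open>h l\<close>
      produces. Since \<open>h\<close> is orthogonal, the squared norms of the \<open>w l\<close>
      add up exactly to its Gram square.\<close>
    define w where "w l = (if l < m then complex_of_real (norm (h l)) *\<^sub>C h l else 0)" for l
    define w' where "w' l = (if l < m' then complex_of_real (norm (h' l)) *\<^sub>C h' l else 0)" for l
    have oe: "orthogonal_family n e" "orthogonal_family n e'"
      using oh oh' unfolding orthogonal_family_def e_def e'_def
      by (auto simp: cinner_scaleC_left cinner_scaleC_right)
    have ne: "norm (e l) \<le> 1" "norm (e' l) \<le> 1" for l
      unfolding e_def e'_def by (auto simp: norm_scaleC norm_inverse norm_divide)
    \<comment> \<open>The conjugate makes each \<open>a i k l * cinner (y i (w l)) (w' k)\<close> a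
      squared modulus.\<close>
    define a where "a i k l = cnj (cinner (y i (e l)) (e' k))" for i k l
    define X where "X k l = (\<Sum>i\<in>J. a i k l *\<^sub>C ell2_basis i)" for k l
    have XI: "\<forall>k<n. \<forall>l<n. X k l \<in> ell2_space I"
      unfolding X_def using J(2)
      by (intro allI impI complex_vector.subspace_sum[OF subspace_ell2_space]
          complex_vector.subspace_scale[OF subspace_ell2_space] ell2_basis_in_ell2_space) blast
    have AX: "A (X k l) = (\<Sum>i\<in>J. a i k l *\<^sub>C y i)" for k l
      unfolding X_def y_def
      by (rule clinear_between_sum[OF A subspace_ell2_space], rule ell2_basis_in_ell2_space) (use J(2) in blast)
    have ohX: "oh_matrix_norm n X \<le> N"
      unfolding oh_matrix_norm_le_iff[OF N0] oh_test_def
    proof (intro allI)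
      fix q q' and g g' :: "nat \<Rightarrow> nat \<Rightarrow> complex"
      define f where "f l = (\<Sum>p<n. cnj (g l p) *\<^sub>C e p)" for l
      define f' where "f' l = (\<Sum>p<n. cnj (g' l p) *\<^sub>C e' p)" for l
      have nth: "ell2_nth (compress n g g' X k l) i = (if i \<in> J then cnj (cinner (y i (f l)) (f' k)) else 0)" for i k l
      proof -
        have X: "ell2_nth (X r p) i = (if i \<in> J then a i r p else 0)" for r p
          unfolding X_def using J(1) by (simp add: ell2_nth_sum ell2_nth_basis if_distrib cong: if_cong)
        show ?thesis
        proof (cases "i \<in> J")
          case True
          have "cinner (y i (f l)) (f' k) = (\<Sum>p<n. \<Sum>r<n. cnj (g l p) * g' k r * cinner (y i (e p)) (e' r))"
            unfolding f_def f'_def blinfun.sum_right bounded_operatorsD[OF yb[OF True]] cinner_sum_left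
            unfolding cinner_sum_right by (simp add: cinner_scaleC_left cinner_scaleC_right mult_ac)
          also have "\<dots> = (\<Sum>r<n. \<Sum>p<n. cnj (g l p) * g' k r * cinner (y i (e p)) (e' r))" by (rule sum.swap)
          finally show ?thesis
            using True by (simp add: compress_def ell2_nth_sum X a_def mult_ac)
        next
          case False
          then show ?thesis by (simp add: compress_def ell2_nth_sum X)
        qed
      qed
      have "(\<Sum>k<q'. \<Sum>l<q. (norm (compress n g g' X k l))\<^sup>2) = (\<Sum>k<q'. \<Sum>l<q. \<Sum>i\<in>J. (cmod (cinner (y i (f l)) (f' k)))\<^sup>2)"
      proof (intro sum.cong refl)
        fix k l
        have "(norm (compress n g g' X k l))\<^sup>2 = (\<Sum>i\<in>J. (cmod (ell2_nth (compress n g g' X k l) i))\<^sup>2)"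
          by (rule norm_ell2_finite_support[OF J(1)]) (simp add: nth)
        also have "\<dots> = (\<Sum>i\<in>J. (cmod (cinner (y i (f l)) (f' k)))\<^sup>2)" by (simp add: nth)
        finally show "(norm (compress n g g' X k l))\<^sup>2 = (\<Sum>i\<in>J. (cmod (cinner (y i (f l)) (f' k)))\<^sup>2)" .
      qed
      also have "\<dots> = (\<Sum>k<q'. \<Sum>i\<in>J. \<Sum>l<q. (cmod (cinner (y i (f l)) (f' k)))\<^sup>2)"
        by (intro sum.cong refl sum.swap)
      also have "\<dots> = (\<Sum>i\<in>J. \<Sum>k<q'. \<Sum>l<q. (cmod (cinner (y i (f l)) (f' k)))\<^sup>2)" by (rule sum.swap)
      also have "\<dots> \<le> N\<^sup>2 * sqrt (gram_square q f * gram_square q' f')"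
        by (rule Nt[unfolded conj_square_test_def, THEN spec, THEN spec, THEN spec, THEN spec])
      also have "\<dots> \<le> N\<^sup>2 * sqrt (coef_gram n q g * coef_gram n q' g')"
        unfolding f_def f'_def
        by (intro mult_left_mono real_sqrt_le_mono mult_mono gram_square_combination_le oe ne
            coef_gram_nonneg gram_square_nonneg) simp
      finally show "(\<Sum>k<q'. \<Sum>l<q. (norm (compress n g g' X k l))\<^sup>2) \<le> N\<^sup>2 * sqrt (coef_gram n q g * coef_gram n q' g')" .
    qed
    have hw: "h l = complex_of_real (norm (h l)) *\<^sub>C e l" "w l = complex_of_real ((norm (h l))\<^sup>2) *\<^sub>C e l" if "l < m" for l
      using that by (auto simp: e_def w_def scaleC_scaleC power2_eq_square)
    have hw': "h' l = complex_of_real (norm (h' l)) *\<^sub>C e' l" "w' l = complex_of_real ((norm (h' l))\<^sup>2) *\<^sub>C e' l" if "l < m'" for l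
      using that by (auto simp: e'_def w'_def scaleC_scaleC power2_eq_square)
    have Lw: "L2_set (\<lambda>l. norm (w l)) {..<n} = sqrt (gram_square m h)"
    proof -
      have "(\<Sum>l<n. (norm (w l))\<^sup>2) = (\<Sum>l<m. norm (h l) ^ 4)"
        by (rule sum.mono_neutral_cong_right) (auto simp: n_def w_def norm_scaleC power_mult_distrib simp flip: power_add)
      then show ?thesis by (simp add: L2_set_def gram_square_orthogonal[OF oh])
    qed
    have Lw': "L2_set (\<lambda>l. norm (w' l)) {..<n} = sqrt (gram_square m' h')"
    proof -
      have "(\<Sum>l<n. (norm (w' l))\<^sup>2) = (\<Sum>l<m'. norm (h' l) ^ 4)"
        by (rule sum.mono_neutral_cong_right) (auto simp: n_def w'_def norm_scaleC power_mult_distrib simp flip: power_add)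
      then show ?thesis by (simp add: L2_set_def gram_square_orthogonal[OF oh'])
    qed
    have "complex_of_real (\<Sum>i\<in>J. \<Sum>k<m'. \<Sum>l<m. (cmod (cinner (y i (h l)) (h' k)))\<^sup>2)
        = (\<Sum>i\<in>J. \<Sum>k<m'. \<Sum>l<m. a i k l * cinner (y i (w l)) (w' k))"
      unfolding of_real_sum
    proof (intro sum.cong refl)
      fix i k l assume i: "i \<in> J" and kl: "k \<in> {..<m'}" "l \<in> {..<m}"
      have h: "cinner (y i (h l)) (h' k) = of_real (norm (h l) * norm (h' k)) * cinner (y i (e l)) (e' k)"
        using kl by (subst hw(1), simp, subst hw'(1), simp)
          (simp add: bounded_operatorsD[OF yb[OF i]] cinner_scaleC_left cinner_scaleC_right)
      have "cinner (y i (w l)) (w' k) = of_real ((norm (h l))\<^sup>2 * (norm (h' k))\<^sup>2) * cinner (y i (e l)) (e' k)"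
        using kl by (subst hw(2), simp, subst hw'(2), simp)
          (simp add: bounded_operatorsD[OF yb[OF i]] cinner_scaleC_left cinner_scaleC_right)
      then show "complex_of_real ((cmod (cinner (y i (h l)) (h' k)))\<^sup>2) = a i k l * cinner (y i (w l)) (w' k)"
        unfolding complex_norm_square h a_def by (simp add: power2_eq_square mult_ac)
    qed
    also have "\<dots> = (\<Sum>k<m'. \<Sum>i\<in>J. \<Sum>l<m. a i k l * cinner (y i (w l)) (w' k))" by (rule sum.swap)
    also have "\<dots> = (\<Sum>k<m'. \<Sum>l<m. \<Sum>i\<in>J. a i k l * cinner (y i (w l)) (w' k))"
      by (intro sum.cong refl sum.swap)
    also have "\<dots> = (\<Sum>k<m'. \<Sum>l<m. cinner (A (X k l) (w l)) (w' k))"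
      unfolding AX by (simp add: blinfun.sum_left scaleC_blinfun.rep_eq cinner_sum_left cinner_scaleC_left)
    also have "\<dots> = (\<Sum>k<m'. \<Sum>l<n. cinner (A (X k l) (w l)) (w' k))"
      by (rule sum.cong[OF refl], rule sum.mono_neutral_left) (auto simp: n_def w_def)
    also have "\<dots> = (\<Sum>k<n. \<Sum>l<n. cinner (A (X k l) (w l)) (w' k))"
      by (rule sum.mono_neutral_left) (auto simp: n_def w'_def)
    finally have S: "complex_of_real (\<Sum>i\<in>J. \<Sum>k<m'. \<Sum>l<m. (cmod (cinner (y i (h l)) (h' k)))\<^sup>2)
        = (\<Sum>k<n. \<Sum>l<n. cinner (A (X k l) (w l)) (w' k))" .
    have "(\<Sum>i\<in>J. \<Sum>k<m'. \<Sum>l<m. (cmod (cinner (y i (h l)) (h' k)))\<^sup>2)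
        = Re (\<Sum>k<n. \<Sum>l<n. cinner (A (X k l) (w l)) (w' k))"
      unfolding S[symmetric] Re_complex_of_real ..
    also have "\<dots> \<le> cmod (\<Sum>k<n. \<Sum>l<n. cinner (A (X k l) (w l)) (w' k))" by (rule complex_Re_le_cmod)
    also have "\<dots> \<le> op_matrix_norm n (\<lambda>k l. A (X k l)) * L2_set (\<lambda>j. norm (w j)) {..<n} * L2_set (\<lambda>i. norm (w' i)) {..<n}"
      by (rule op_matrix_norm_cinner_le)
    also have "\<dots> \<le> (c * N) * L2_set (\<lambda>j. norm (w j)) {..<n} * L2_set (\<lambda>i. norm (w' i)) {..<n}"
    proof (intro mult_right_mono L2_set_nonneg)
      have "op_matrix_norm n (\<lambda>k l. A (X k l)) \<le> c * oh_matrix_norm n X"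
        using cb XI by (simp add: cb_bound_def)
      also have "\<dots> \<le> c * N" by (intro mult_left_mono ohX c)
      finally show "op_matrix_norm n (\<lambda>k l. A (X k l)) \<le> c * N" .
    qed
    also have "\<dots> = (c * N) * sqrt (gram_square m h * gram_square m' h')"
      unfolding Lw Lw' by (simp add: real_sqrt_mult)
    also have "c * N = (sqrt (c * conj_square_norm J y))\<^sup>2" using c N0 by (simp add: N_def)
    finally show "(\<Sum>i\<in>J. \<Sum>k<m'. \<Sum>l<m. (cmod (cinner (y i (h l)) (h' k)))\<^sup>2)
        \<le> (sqrt (c * conj_square_norm J y))\<^sup>2 * sqrt (gram_square m h * gram_square m' h')" .
  qed
  then have "N\<^sup>2 \<le> (sqrt (c * N))\<^sup>2" using N0 by (rule power_mono)
  then have "N\<^sup>2 \<le> c * N" using N0 c by simp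
  then have "N \<le> c" using N0 c by (cases "N = 0") (auto simp: power2_eq_square)
  then show ?thesis unfolding N_def y_def .
qed

section \<open>Realizing positive forms in a Hilbert space of square summable families\<close>

text \<open>Zorn's lemma is applied to partial isometric realizations in which every vector only uses the
  coordinates named by the domain. A maximal one is linear, and it is total because a new vector is the
  sum of a vector in the closed span and a multiple of the fresh basis vector that it names.\<close>

definition partial_realization ::
    "'a::complex_vector set \<Rightarrow> ('a \<Rightarrow> 'a \<Rightarrow> complex) \<Rightarrow> ('a \<times> ('i + 'a) ell2) set \<Rightarrow> bool"
  where "partial_realization V s R \<longleftrightarrow>
    (\<forall>r\<in>R. fst r \<in> V \<and> snd r \<in> ell2_space (Inr ` fst ` R)) \<and>
    (\<forall>r\<in>R. \<forall>r'\<in>R. cinner (snd r) (snd r') = s (fst r) (fst r'))"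

lemma ell2_space_mono: "I \<subseteq> J \<Longrightarrow> f \<in> ell2_space I \<Longrightarrow> f \<in> ell2_space J"
  unfolding ell2_space_def by auto

lemma partial_realization_Union:
  assumes "subset.chain {R. partial_realization V s R} \<C>"
  shows "partial_realization V s (\<Union>\<C>)"
  unfolding partial_realization_def
proof (intro conjI ballI)
  have C: "\<And>R. R \<in> \<C> \<Longrightarrow> partial_realization V s R"
    and chain: "\<And>R R'. R \<in> \<C> \<Longrightarrow> R' \<in> \<C> \<Longrightarrow> R \<subseteq> R' \<or> R' \<subseteq> R"
    using assms unfolding subset.chain_def by auto
  fix r assume "r \<in> \<Union>\<C>"
  then obtain R where R: "R \<in> \<C>" "r \<in> R" by blast
  show "fst r \<in> V" using C[OF R(1)] R(2) unfolding partial_realization_def by blast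
  have "snd r \<in> ell2_space (Inr ` fst ` R)" using C[OF R(1)] R(2) unfolding partial_realization_def by blast
  then show "snd r \<in> ell2_space (Inr ` fst ` \<Union>\<C>)" by (rule ell2_space_mono[rotated]) (use R(1) in blast)
  fix r' assume "r' \<in> \<Union>\<C>"
  then obtain R' where R': "R' \<in> \<C>" "r' \<in> R'" by blast
  obtain R'' where R'': "R'' \<in> \<C>" "r \<in> R''" "r' \<in> R''"
    using chain[OF R(1) R'(1)] R R' by blast
  show "cinner (snd r) (snd r') = s (fst r) (fst r')"
    using C[OF R''(1)] R''(2,3) unfolding partial_realization_def by blast
qed

theorem psd_form_realization:
  fixes V :: "'a::complex_vector set"
  assumes s: "psd_form V s" and V: "complex_vector.subspace V"
  shows "\<exists>B :: 'a \<Rightarrow> ('i + 'a) ell2. \<forall>x\<in>V. \<forall>y\<in>V. cinner (B x) (B y) = s x y"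
proof -
  have "\<exists>M\<in>{R :: ('a \<times> ('i + 'a) ell2) set. partial_realization V s R}.
      \<forall>X\<in>{R. partial_realization V s R}. M \<subseteq> X \<longrightarrow> X = M"
    by (rule subset_Zorn') (simp add: partial_realization_Union)
  then obtain M :: "('a \<times> ('i + 'a) ell2) set" where M: "partial_realization V s M"
    and max: "\<And>X. partial_realization V s X \<Longrightarrow> M \<subseteq> X \<Longrightarrow> X = M" by auto
  define I where "I = (Inr ` fst ` M :: ('i + 'a) set)"
  have MV: "x \<in> V" and MI: "a \<in> ell2_space I" if "(x, a) \<in> M" for x a
    using M that unfolding partial_realization_def I_def by force+
  have Ms: "cinner a b = s x y" if "(x, a) \<in> M" "(y, b) \<in> M" for x a y b
    using M that unfolding partial_realization_def by force
  \<comment> \<open>Maximality in its usable form: a vector compatible with all of \<open>M\<close>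
    is already in \<open>M\<close>. Closure of \<open>M\<close> under the linear operations and its
    totality both come from here. Permission to use the coordinate named by \<open>x\<close> itself
    is what matters for totality.\<close>
  have ext: "(x, a) \<in> M" if x: "x \<in> V" and a: "a \<in> ell2_space (insert (Inr x) I)"
    and ab: "\<And>y b. (y, b) \<in> M \<Longrightarrow> cinner a b = s x y" and aa: "cinner a a = s x x" for x a
  proof -
    have ba: "cinner b a = s y x" if "(y, b) \<in> M" for y b
      using ab[OF that] psd_form_commute[OF s MV[OF that] x] cinner_commute[of b a] by simp
    have I: "Inr ` fst ` insert (x, a) M = insert (Inr x) I" by (simp add: I_def)
    have "partial_realization V s (insert (x, a) M)"
      unfolding partial_realization_def I
    proof (intro conjI ballI)
      fix r assume r: "r \<in> insert (x, a) M"
      show "fst r \<in> V" using r x MV[of "fst r" "snd r"] by auto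
      show "snd r \<in> ell2_space (insert (Inr x) I)"
        using r a ell2_space_mono[OF subset_insertI MI[of "fst r" "snd r"]] by auto
      fix r' assume r': "r' \<in> insert (x, a) M"
      show "cinner (snd r) (snd r') = s (fst r) (fst r')"
        using r r' ab[of "fst r'" "snd r'"] ba[of "fst r" "snd r"] aa
          Ms[of "fst r" "snd r" "fst r'" "snd r'"] by auto
    qed
    from max[OF this] show ?thesis by blast
  qed
  have zero: "(0, 0) \<in> M"
  proof (rule ext)
    have "s 0 y = 0" if "y \<in> V" for y
      using psd_form_scale[OF s that that, of 0] psd_form_scale[OF s complex_vector.subspace_0[OF V] that, of 0] by simp
    then show "cinner 0 b = s 0 y" if "(y, b) \<in> M" for y b using MV[OF that] by simp
    show "cinner (0::('i + 'a) ell2) 0 = s 0 0" using \<open>\<And>y. y \<in> V \<Longrightarrow> s 0 y = 0\<close> complex_vector.subspace_0[OF V] by simp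
    show "(0::('i + 'a) ell2) \<in> ell2_space (insert (Inr 0) I)" by (simp add: ell2_space_def)
  qed (rule complex_vector.subspace_0[OF V])
  have add: "(x + y, a + b) \<in> M" if xa: "(x, a) \<in> M" and yb: "(y, b) \<in> M" for x a y b
  proof (rule ext)
    show xy: "x + y \<in> V" using V MV[OF xa] MV[OF yb] by (rule complex_vector.subspace_add)
    show "a + b \<in> ell2_space (insert (Inr (x + y)) I)"
      by (rule ell2_space_mono[of I], blast, rule complex_vector.subspace_add[OF subspace_ell2_space MI[OF xa] MI[OF yb]])
    show "cinner (a + b) c = s (x + y) z" if "(z, c) \<in> M" for z c
      using Ms[OF xa that] Ms[OF yb that] psd_form_add[OF s MV[OF xa] MV[OF yb] MV[OF that]]
      by (simp add: cinner_add_left)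
    show "cinner (a + b) (a + b) = s (x + y) (x + y)"
      using Ms[OF xa xa] Ms[OF yb yb] Ms[OF xa yb] Ms[OF yb xa]
        psd_form_add[OF s MV[OF xa] MV[OF yb] xy] psd_form_right(1)[OF s V MV[OF xa] MV[OF yb] MV[OF xa]]
        psd_form_right(1)[OF s V MV[OF xa] MV[OF yb] MV[OF yb]]
      by (simp add: cinner_add_left cinner_add_right)
  qed
  have scale: "(c *\<^sub>C x, c *\<^sub>C a) \<in> M" if xa: "(x, a) \<in> M" for c x a
  proof (rule ext)
    show cx: "c *\<^sub>C x \<in> V" using V MV[OF xa] by (rule complex_vector.subspace_scale)
    show "c *\<^sub>C a \<in> ell2_space (insert (Inr (c *\<^sub>C x)) I)"
      by (rule ell2_space_mono[of I], blast, rule complex_vector.subspace_scale[OF subspace_ell2_space MI[OF xa]])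
    show "cinner (c *\<^sub>C a) b = s (c *\<^sub>C x) y" if "(y, b) \<in> M" for y b
      using Ms[OF xa that] psd_form_scale[OF s MV[OF xa] MV[OF that]] by (simp add: cinner_scaleC_left)
    show "cinner (c *\<^sub>C a) (c *\<^sub>C a) = s (c *\<^sub>C x) (c *\<^sub>C x)"
      using Ms[OF xa xa] psd_form_scale[OF s MV[OF xa] cx] psd_form_right(2)[OF s V MV[OF xa] MV[OF xa] MV[OF xa]]
      by (simp add: cinner_scaleC_left cinner_scaleC_right)
  qed
  define W where "W = snd ` M"
  have W: "complex_vector.subspace W"
    unfolding complex_vector.subspace_def W_def
    using zero add scale by (auto simp: image_iff) (metis snd_conv)+
  have total: "\<exists>a. (x, a) \<in> M" if x: "x \<in> V" for x
  proof (rule ccontr)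
    assume nx: "\<nexists>a. (x, a) \<in> M"
    define rep where "rep a = (SOME y. (y, a) \<in> M)" for a
    have rep: "(rep a, a) \<in> M" if "a \<in> W" for a
      using that unfolding W_def rep_def by (auto intro: someI)
    define K where "K = sqrt (Re (s x x))"
    \<comment> \<open>The difference \<open>y - z\<close> is realized by \<open>0\<close>, so it has
      seminorm \<open>0\<close> for \<open>s\<close>, and the Cauchy-Schwarz inequality makes it
      orthogonal to \<open>x\<close>. Hence the functional to be represented is well defined on
      \<open>W\<close>.\<close>
    have same: "s y x = s z x" if ya: "(y, a) \<in> M" and za: "(z, a) \<in> M" for y z a
    proof -
      have d: "(y + (- 1) *\<^sub>C z, 0) \<in> M" using add[OF ya scale[OF za, of "- 1"]] by simp
      have "(cmod (s (y + (- 1) *\<^sub>C z) x))\<^sup>2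
          \<le> Re (s (y + (- 1) *\<^sub>C z) (y + (- 1) *\<^sub>C z)) * Re (s x x)"
        by (rule psd_form_Cauchy_Schwarz[OF s V MV[OF d] x])
      also have "s (y + (- 1) *\<^sub>C z) (y + (- 1) *\<^sub>C z) = 0" using Ms[OF d d] by simp
      finally have "s (y + (- 1) *\<^sub>C z) x = 0" by simp
      moreover have "s (y + (- 1) *\<^sub>C z) x = s y x + (- 1) * s z x"
        using psd_form_add[OF s MV[OF ya] MV[OF scale[OF za, of "- 1"]] x] psd_form_scale[OF s MV[OF za] x, of "- 1"]
        by simp
      ultimately show ?thesis by simp
    qed
    have f: "s (rep a) x = s y x" if "(y, a) \<in> M" for y a
      using same[OF rep that] that unfolding W_def by force
    have "\<exists>p\<in>closure W. \<forall>a\<in>W. cinner a p = s (rep a) x"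
    proof (rule Riesz_subspace[OF W])
      fix a b assume ab: "a \<in> W" "b \<in> W"
      show "s (rep (a + b)) x = s (rep a) x + s (rep b) x"
        using f[OF add[OF rep[OF ab(1)] rep[OF ab(2)]]] psd_form_add[OF s MV[OF rep[OF ab(1)]] MV[OF rep[OF ab(2)]] x]
        by simp
    next
      fix c a assume a: "a \<in> W"
      show "s (rep (c *\<^sub>C a)) x = c * s (rep a) x"
        using f[OF scale[OF rep[OF a]]] psd_form_scale[OF s MV[OF rep[OF a]] x] by simp
      have "cmod (s (rep a) x) \<le> sqrt (Re (s (rep a) (rep a))) * K"
        unfolding K_def by (rule psd_form_Cauchy_Schwarz_sqrt[OF s V MV[OF rep[OF a]] x])
      also have "sqrt (Re (s (rep a) (rep a))) = norm a"
        using Ms[OF rep[OF a] rep[OF a]] by (simp add: norm_eq_sqrt_cinner)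
      finally show "cmod (s (rep a) x) \<le> K * norm a" by (simp add: mult.commute)
    qed
    then obtain p where pc: "p \<in> closure W" and p: "\<And>a. a \<in> W \<Longrightarrow> cinner a p = s (rep a) x" by blast
    have pM: "cinner b p = s y x" if "(y, b) \<in> M" for y b
      using p[of b] f[OF that] that unfolding W_def by force
    have "W \<subseteq> ell2_space I" using MI unfolding W_def by force
    then have pI: "p \<in> ell2_space I" using pc closure_minimal[OF _ closed_ell2_space] by blast
    \<comment> \<open>The projection is no longer than \<open>x\<close> in the seminorm of
      \<open>s\<close>, which makes the radicand of \<open>t\<close> nonnegative.\<close>
    have np: "norm p \<le> K"
    proof -
      obtain a where a: "\<And>n. a n \<in> W" "a \<longlonglongrightarrow> p" using pc unfolding closure_sequential by blast
      have "cmod (cinner (a n) p) \<le> norm (a n) * K" for n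
      proof -
        have "cmod (s (rep (a n)) x) \<le> sqrt (Re (s (rep (a n)) (rep (a n)))) * K"
          unfolding K_def by (rule psd_form_Cauchy_Schwarz_sqrt[OF s V MV[OF rep[OF a(1)]] x])
        also have "sqrt (Re (s (rep (a n)) (rep (a n)))) = norm (a n)"
          using Ms[OF rep[OF a(1)] rep[OF a(1)]] by (simp add: norm_eq_sqrt_cinner)
        finally show ?thesis using p[OF a(1)] by simp
      qed
      moreover have "(\<lambda>n. cmod (cinner (a n) p)) \<longlonglongrightarrow> cmod (cinner p p)"
        by (intro tendsto_norm tendsto_cinner_left a)
      moreover have "(\<lambda>n. norm (a n) * K) \<longlonglongrightarrow> norm p * K" by (intro tendsto_intros a)
      ultimately have "cmod (cinner p p) \<le> norm p * K" by (intro LIMSEQ_le) auto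
      then have "norm p * norm p \<le> norm p * K" by (simp add: cinner_self norm_power power2_eq_square norm_mult)
      moreover have "0 \<le> K" unfolding K_def using psd_form_nonneg[OF s x] by simp
      ultimately show ?thesis by (cases "norm p = 0") (auto simp: mult_le_cancel_left)
    qed
    have K2: "K\<^sup>2 = Re (s x x)" unfolding K_def using psd_form_nonneg[OF s x] by simp
    define t where "t = sqrt (K\<^sup>2 - (norm p)\<^sup>2)"
    have t: "t\<^sup>2 = K\<^sup>2 - (norm p)\<^sup>2" unfolding t_def using np by (simp add: power_mono)
    define e where "e = (ell2_basis (Inr x) :: ('i + 'a) ell2)"
    have xI: "Inr x \<notin> I" using nx unfolding I_def by force
    have eb: "cinner e b = 0" if "b \<in> ell2_space I" for b
    proof -
      have "cinner e b = cnj (cinner b e)" by (rule cinner_commute)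
      then show ?thesis using that xI unfolding e_def cinner_ell2_basis ell2_space_def by simp
    qed
    have pe: "cinner p e = 0" using eb[OF pI] cinner_commute[of p e] by simp
    have ee: "cinner e e = 1" unfolding e_def cinner_ell2_basis by (simp add: ell2_nth_basis)
    have "(x, p + of_real t *\<^sub>C e) \<in> M"
    proof (rule ext[OF x])
      have "e \<in> ell2_space (insert (Inr x) I)" unfolding e_def by (rule ell2_basis_in_ell2_space) simp
      moreover have "p \<in> ell2_space (insert (Inr x) I)" by (rule ell2_space_mono[OF subset_insertI pI])
      ultimately show "p + of_real t *\<^sub>C e \<in> ell2_space (insert (Inr x) I)"
        by (intro complex_vector.subspace_add complex_vector.subspace_scale subspace_ell2_space)
      show "cinner (p + of_real t *\<^sub>C e) b = s x y" if "(y, b) \<in> M" for y b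
        using pM[OF that] eb[OF MI[OF that]] cinner_commute[of p b] psd_form_commute[OF s x MV[OF that]]
        by (simp add: cinner_add_left cinner_scaleC_left)
      have "cinner (p + of_real t *\<^sub>C e) (p + of_real t *\<^sub>C e) = of_real ((norm p)\<^sup>2 + t\<^sup>2)"
        using eb[OF pI] pe ee
        by (simp add: cinner_add_left cinner_add_right cinner_scaleC_left cinner_scaleC_right
            cinner_self[of p] power2_eq_square)
      also have "\<dots> = s x x" using psd_form_real[OF s x] by (simp add: t K2)
      finally show "cinner (p + of_real t *\<^sub>C e) (p + of_real t *\<^sub>C e) = s x x" .
    qed
    then show False using nx by blast
  qed
  define B where "B x = (SOME a. (x, a) \<in> M)" for x
  have "(x, B x) \<in> M" if "x \<in> V" for x using total[OF that] unfolding B_def by (rule someI_ex)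
  then show ?thesis using Ms by (intro exI[of _ B]) blast
qed

section \<open>Forms on an operator space and factorization through \<open>OH\<close>\<close>

text \<open>These are the forms \<open>s x y = \<langle>B x, B y\<rangle>\<close> induced by the complete contractions \<open>B\<close> into some \<open>OH(I)\<close>.\<close>

definition oh_form :: "('h::chilbert_space \<Rightarrow>\<^sub>L 'h) set \<Rightarrow> (('h \<Rightarrow>\<^sub>L 'h) \<Rightarrow> ('h \<Rightarrow>\<^sub>L 'h) \<Rightarrow> complex) \<Rightarrow> bool"
  where "oh_form E s \<longleftrightarrow> (\<forall>x y. cmod (s x y) \<le> norm x * norm y) \<and> psd_form E s \<and>
    (\<forall>n X m m' g g'. (\<forall>i<n. \<forall>j<n. X i j \<in> E) \<longrightarrow>
      (\<Sum>k<m'. \<Sum>l<m. Re (s (compress n g g' X k l) (compress n g g' X k l)))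
        \<le> (op_matrix_norm n X)\<^sup>2 * sqrt (coef_gram n m g * coef_gram n m' g'))"

text \<open>This expresses that \<open>u\<close> is the composition of the map into the Hilbert space of \<open>s\<close> with a map of
  completely bounded norm at most \<open>c\<close>.\<close>

definition oh_dominated ::
    "('h::chilbert_space \<Rightarrow>\<^sub>L 'h) set \<Rightarrow> (('h \<Rightarrow>\<^sub>L 'h) \<Rightarrow> ('k::chilbert_space \<Rightarrow>\<^sub>L 'k)) \<Rightarrow> real \<Rightarrow>
      (('h \<Rightarrow>\<^sub>L 'h) \<Rightarrow> ('h \<Rightarrow>\<^sub>L 'h) \<Rightarrow> complex) \<Rightarrow> bool"
  where "oh_dominated E u c s \<longleftrightarrow> (\<forall>m m' h h' z. (\<forall>k<m'. \<forall>l<m. z k l \<in> E) \<longrightarrow>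
    (cmod (\<Sum>k<m'. \<Sum>l<m. cinner (u (z k l) (h l)) (h' k)))\<^sup>2
      \<le> c\<^sup>2 * sqrt (gram_square m h * gram_square m' h') * (\<Sum>k<m'. \<Sum>l<m. Re (s (z k l) (z k l))))"

lemma oh_dominatedD:
  assumes "oh_dominated E u c s" and "\<And>k l. k < m' \<Longrightarrow> l < m \<Longrightarrow> z k l \<in> E"
  shows "(cmod (\<Sum>k<m'. \<Sum>l<m. cinner (u (z k l) (h l)) (h' k)))\<^sup>2
    \<le> c\<^sup>2 * sqrt (gram_square m h * gram_square m' h') * (\<Sum>k<m'. \<Sum>l<m. Re (s (z k l) (z k l)))"
  using assms unfolding oh_dominated_def by simp

lemma operator_spaceD:
  assumes "operator_space E"
  shows operator_space_bounded: "E \<subseteq> bounded_operators"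
    and operator_space_subspace: "complex_vector.subspace E"
    and operator_space_closed: "closed E"
  using assms unfolding operator_space_def by auto

text \<open>Converts arbitrary columns of vectors into the pairs of families that occur in tests.
  The tensor formed by the basis vectors and the \<open>k l\<close> has squared norm equal to the
  sum of the squared norms of the \<open>k l\<close>, and its balanced decomposition hands this
  number to both families.\<close>

lemma column_decomposition:
  fixes k :: "nat \<Rightarrow> 'k::chilbert_space"
  obtains N :: nat and G H where "\<And>l. l < n \<Longrightarrow> k l = (\<Sum>p<N. G p l *\<^sub>C H p)"
    "coef_gram n N G \<le> (L2_set (\<lambda>l. norm (k l)) {..<n}) ^ 2"
    "gram_square N H = (L2_set (\<lambda>l. norm (k l)) {..<n}) ^ 2"
proof -
  let ?e = "ell2_basis :: nat \<Rightarrow> nat ell2"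
  obtain N g H where eq: "\<And>x y. (\<Sum>p<n. cinner (?e p) x * cinner (k p) y) = (\<Sum>p<N. cinner (g p) x * cinner (H p) y)"
    and gg: "gram_square N g = (tensor_norm {..<n} ?e k)\<^sup>2" "gram_square N H = (tensor_norm {..<n} ?e k)\<^sup>2"
    by (rule balanced_tensor_decomposition[OF finite_lessThan, where h="?e" and k=k]) (rule that)
  have ee: "cinner (?e p) (?e q) = (if p = q then 1 else 0)" for p q
    unfolding cinner_ell2_basis by (auto simp: ell2_nth_basis)
  have "tensor_inner {..<n} ?e k {..<n} ?e k = (\<Sum>p<n. \<Sum>q<n. if p = q then cinner (k p) (k p) else 0)"
    unfolding tensor_inner_def ee by (intro sum.cong refl) auto
  also have "\<dots> = of_real (\<Sum>p<n. (norm (k p))\<^sup>2)" by (simp add: cinner_self)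
  finally have t: "(tensor_norm {..<n} ?e k)\<^sup>2 = (\<Sum>p<n. (norm (k p))\<^sup>2)"
    unfolding tensor_norm_power2[OF finite_lessThan, symmetric] of_real_eq_iff .
  have L: "(L2_set (\<lambda>l. norm (k l)) {..<n})\<^sup>2 = (\<Sum>p<n. (norm (k p))\<^sup>2)"
    by (simp add: L2_set_def sum_nonneg)
  show thesis
  proof (rule that[of "\<lambda>p. ell2_nth (g p)" H N])
    fix l assume l: "l < n"
    have "cinner (k l - (\<Sum>p<N. ell2_nth (g p) l *\<^sub>C H p)) y = 0" for y
    proof -
      have "cinner (k l) y = (\<Sum>p<n. cinner (?e p) (?e l) * cinner (k p) y)"
      proof -
        have "(\<Sum>p<n. cinner (?e p) (?e l) * cinner (k p) y) = (\<Sum>p<n. if p = l then cinner (k p) y else 0)"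
          unfolding ee by (intro sum.cong refl) simp
        then show ?thesis using l by simp
      qed
      also have "\<dots> = (\<Sum>p<N. ell2_nth (g p) l * cinner (H p) y)" by (simp only: eq) (simp only: cinner_ell2_basis)
      finally show ?thesis by (simp add: cinner_diff_left cinner_sum_left cinner_scaleC_left)
    qed
    then show "k l = (\<Sum>p<N. ell2_nth (g p) l *\<^sub>C H p)"
      using cinner_eq_zero_iff_norm[of "k l - (\<Sum>p<N. ell2_nth (g p) l *\<^sub>C H p)"] by simp
  next
    show "coef_gram n N (\<lambda>p. ell2_nth (g p)) \<le> (L2_set (\<lambda>l. norm (k l)) {..<n})\<^sup>2"
      using coef_gram_le_gram_square[of n N g] by (simp add: gg t L)
    show "gram_square N H = (L2_set (\<lambda>l. norm (k l)) {..<n})\<^sup>2" by (simp add: gg t L)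
  qed
qed

lemma cinner_compress:
  fixes Y :: "nat \<Rightarrow> nat \<Rightarrow> 'k::chilbert_space \<Rightarrow>\<^sub>L 'k"
  assumes Y: "\<And>r l. r < n \<Longrightarrow> l < n \<Longrightarrow> Y r l \<in> bounded_operators"
    and k: "\<And>l. l < n \<Longrightarrow> k l = (\<Sum>p<N. G p l *\<^sub>C H p)"
    and k': "\<And>l. l < n \<Longrightarrow> k' l = (\<Sum>p<N'. G' p l *\<^sub>C H' p)"
  shows "(\<Sum>r<n. \<Sum>l<n. cinner (Y r l (k l)) (k' r))
    = (\<Sum>q<N'. \<Sum>p<N. cinner (compress n G G' Y q p (H p)) (H' q))"
proof -
  let ?t = "\<lambda>r l q p. cnj (G' q r) * G p l * cinner (Y r l (H p)) (H' q)"
  have "(\<Sum>r<n. \<Sum>l<n. cinner (Y r l (k l)) (k' r)) = (\<Sum>r<n. \<Sum>l<n. \<Sum>p<N. \<Sum>q<N'. ?t r l q p)"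
  proof (intro sum.cong refl)
    fix r l assume "r \<in> {..<n}" "l \<in> {..<n}"
    then show "cinner (Y r l (k l)) (k' r) = (\<Sum>p<N. \<Sum>q<N'. ?t r l q p)"
      by (simp add: k k' blinfun.sum_right bounded_operatorsD[OF Y] cinner_sum_left)
        (simp add: cinner_sum_right cinner_scaleC_left cinner_scaleC_right mult_ac sum_distrib_left)
  qed
  also have "\<dots> = (\<Sum>(r, l)\<in>{..<n} \<times> {..<n}. \<Sum>(q, p)\<in>{..<N'} \<times> {..<N}. ?t r l q p)"
    unfolding sum.cartesian_product' case_prod_conv by (intro sum.cong refl sum.swap)
  also have "\<dots> = (\<Sum>(q, p)\<in>{..<N'} \<times> {..<N}. \<Sum>(r, l)\<in>{..<n} \<times> {..<n}. ?t r l q p)"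
    unfolding case_prod_unfold by (rule sum.swap)
  also have "\<dots> = (\<Sum>q<N'. \<Sum>p<N. \<Sum>r<n. \<Sum>l<n. ?t r l q p)"
    unfolding sum.cartesian_product' case_prod_conv ..
  also have "\<dots> = (\<Sum>q<N'. \<Sum>p<N. cinner (compress n G G' Y q p (H p)) (H' q))"
    unfolding compress_def
    by (simp add: blinfun.sum_left scaleC_blinfun.rep_eq cinner_sum_left cinner_scaleC_left)
  finally show ?thesis .
qed

lemma gram_square_one: "gram_square 1 (\<lambda>_. h) = norm h ^ 4"
  by (simp add: gram_square_def cinner_self norm_power)

lemma sqrt_gram_square_one:
  "sqrt (gram_square 1 (\<lambda>_. a) * gram_square 1 (\<lambda>_. b)) = (norm a)\<^sup>2 * (norm b)\<^sup>2"
  unfolding gram_square_one by (rule real_sqrt_unique) (simp_all add: power_mult_distrib)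

text \<open>The map \<open>B x \<mapsto> u x\<close> is bounded on the range of \<open>B\<close> by
  domination. It extends to the closure of the range by limits and to everything by vanishing on the
  orthogonal complement.\<close>

theorem factorization_of_oh_form:
  fixes E :: "('h::chilbert_space \<Rightarrow>\<^sub>L 'h) set" and F :: "('k::chilbert_space \<Rightarrow>\<^sub>L 'k) set"
  assumes E: "operator_space E" and F: "operator_space F" and u: "clinear_between E F u"
    and s: "oh_form E s" and c: "0 \<le> c" and dom: "oh_dominated E u c s"
  obtains A and B :: "('h \<Rightarrow>\<^sub>L 'h) \<Rightarrow> ('i + ('h \<Rightarrow>\<^sub>L 'h)) ell2"
  where "oh_factorization E F u UNIV A B" "cb_bound (opsp E) (OH UNIV) B 1" "cb_bound (OH UNIV) (opsp F) A c"
proof -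
  note Es = operator_space_subspace[OF E]
  have psd: "psd_form E s" using s by (simp add: oh_form_def)
  obtain B :: "('h \<Rightarrow>\<^sub>L 'h) \<Rightarrow> ('i + ('h \<Rightarrow>\<^sub>L 'h)) ell2"
    where B: "\<And>x y. x \<in> E \<Longrightarrow> y \<in> E \<Longrightarrow> cinner (B x) (B y) = s x y"
    using psd_form_realization[OF psd Es] by blast
  have norm_B: "(norm (B x))\<^sup>2 = Re (s x x)" if "x \<in> E" for x
    using B[OF that that] by (simp add: power2_norm_eq_Re_cinner)
  have B_add: "B (x + y) = B x + B y" if x: "x \<in> E" and y: "y \<in> E" for x y
  proof -
    have xy: "x + y \<in> E" by (rule complex_vector.subspace_add[OF Es x y])
    have "cinner (B (x + y) - (B x + B y)) (B (x + y) - (B x + B y)) = 0"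
      unfolding cinner_diff_left cinner_diff_right cinner_add_left cinner_add_right
      using psd_form_add[OF psd x y] psd_form_right(1)[OF psd Es x y] x y xy by (simp add: B)
    then show ?thesis by (simp add: cinner_self)
  qed
  have B_scale: "B (a *\<^sub>C x) = a *\<^sub>C B x" if x: "x \<in> E" for a x
  proof -
    have ax: "a *\<^sub>C x \<in> E" by (rule complex_vector.subspace_scale[OF Es x])
    have "cinner (B (a *\<^sub>C x) - a *\<^sub>C B x) (B (a *\<^sub>C x) - a *\<^sub>C B x) = 0"
      unfolding cinner_diff_left cinner_diff_right cinner_scaleC_left cinner_scaleC_right
      using psd_form_scale[OF psd x] psd_form_right(2)[OF psd Es x x] x ax by (simp add: B)
    then show ?thesis by (simp add: cinner_self)
  qed
  have B_lin: "clinear_between E (ell2_space UNIV) B"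
    unfolding clinear_between_def by (auto simp: ell2_space_def B_add B_scale)
  have cbB: "cb_bound (opsp E) (OH UNIV) B 1"
    unfolding cb_bound_def
  proof (intro conjI allI impI)
    fix n :: nat and X assume X: "\<forall>i<n. \<forall>j<n. X i j \<in> carrier (opsp E)"
    have "oh_test n (\<lambda>i j. B (X i j)) (op_matrix_norm n X)"
      unfolding oh_test_def
    proof (intro allI)
      fix m m' g g'
      have "(norm (compress n g g' (\<lambda>i j. B (X i j)) k l))\<^sup>2 = Re (s (compress n g g' X k l) (compress n g g' X k l))" for k l
        using X clinear_between_compress[OF B_lin Es, of n X g g' k l] norm_B[OF compress_mem[OF Es, of n X g g' k l]]
        by simp
      then show "(\<Sum>k<m'. \<Sum>l<m. (norm (compress n g g' (\<lambda>i j. B (X i j)) k l))\<^sup>2)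
          \<le> (op_matrix_norm n X)\<^sup>2 * sqrt (coef_gram n m g * coef_gram n m' g')"
        using s X unfolding oh_form_def by simp
    qed
    then show "matrix_norm (OH UNIV) n (\<lambda>i j. B (X i j)) \<le> 1 * matrix_norm (opsp E) n X"
      by (simp add: oh_matrix_norm_le_iff op_matrix_norm_nonneg)
  qed simp
  \<comment> \<open>The smallest test, with the single vectors \<open>h\<close> and
    \<open>u z h\<close>.\<close>
  have u_le: "norm (u z) \<le> c * norm (B z)" if z: "z \<in> E" for z
  proof (rule norm_blinfun_bound)
    fix h
    have "(cmod (\<Sum>k<1::nat. \<Sum>l<1::nat. cinner (u z h) (u z h)))\<^sup>2
        \<le> c\<^sup>2 * sqrt (gram_square 1 (\<lambda>_. h) * gram_square 1 (\<lambda>_. u z h)) * (\<Sum>k<1::nat. \<Sum>l<1::nat. Re (s z z))"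
      by (rule oh_dominatedD[OF dom, where z="\<lambda>_ _. z" and h="\<lambda>_. h" and h'="\<lambda>_. u z h"]) (rule z)
    then have "norm (u z h) ^ 4 \<le> c\<^sup>2 * ((norm h)\<^sup>2 * (norm (u z h))\<^sup>2) * (norm (B z))\<^sup>2"
      unfolding sqrt_gram_square_one by (simp add: cinner_self norm_power norm_B[OF z] flip: power_mult)
    then have "(norm (u z h))\<^sup>2 * (norm (u z h))\<^sup>2 \<le> (c * norm (B z) * norm h)\<^sup>2 * (norm (u z h))\<^sup>2"
      by (simp add: power_mult_distrib mult_ac flip: power_add)
    then have "u z h = 0 \<or> (norm (u z h))\<^sup>2 \<le> (c * norm (B z) * norm h)\<^sup>2"
      using mult_right_le_imp_le[of "(norm (u z h))\<^sup>2" "(norm (u z h))\<^sup>2" "(c * norm (B z) * norm h)\<^sup>2"] by auto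
    then show "norm (u z h) \<le> c * norm (B z) * norm h"
      using c by (auto intro: power2_le_imp_le)
  qed (simp add: c)
  define W where "W = B ` E"
  have W: "complex_vector.subspace W"
    unfolding complex_vector.subspace_def W_def
  proof (intro conjI ballI allI)
    have "B 0 = 0" using B_scale[OF complex_vector.subspace_0[OF Es], of 0] by simp
    then show "0 \<in> B ` E" using complex_vector.subspace_0[OF Es] by (metis imageI)
  qed (auto simp flip: B_add B_scale intro!: imageI complex_vector.subspace_add[OF Es] complex_vector.subspace_scale[OF Es])
  \<comment> \<open>The graph of the future \<open>A\<close>: \<open>p\<close> is the projection of
    \<open>\<xi>\<close> onto the closed range of \<open>B\<close>, and \<open>y\<close> is the
    limit of \<open>u\<close> along preimages of a sequence tending to \<open>p\<close>. Since the
    relation is linear and single valued, \<open>A\<close> can be obtained by choice.\<close>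
  define lim where "lim \<xi> z p y \<longleftrightarrow> (\<forall>n::nat. z n \<in> E) \<and> (\<lambda>n. B (z n)) \<longlonglongrightarrow> p \<and>
    (\<forall>w\<in>W. cinner w p = cinner w \<xi>) \<and> (\<lambda>n. u (z n)) \<longlonglongrightarrow> y" for \<xi> z p y
  have ex: "\<exists>z p y. lim \<xi> z p y" for \<xi>
  proof -
    obtain p where p: "p \<in> closure W" "\<forall>w\<in>W. cinner w p = cinner w \<xi>" using orthogonal_decomposition[OF W] by blast
    obtain a where a: "\<And>n. a n \<in> W" "a \<longlonglongrightarrow> p" using p(1) unfolding closure_sequential by blast
    then have "\<forall>n. \<exists>z. z \<in> E \<and> a n = B z" unfolding W_def by blast
    then obtain z where z: "\<And>n. z n \<in> E" "\<And>n. a n = B (z n)" by metis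
    have diff: "norm (u (z i) - u (z j)) \<le> c * norm (a i - a j)" for i j
    proof -
      have mj: "(- 1) *\<^sub>C z j \<in> E" by (rule complex_vector.subspace_scale[OF Es z(1)])
      have zz: "z i + (- 1) *\<^sub>C z j \<in> E" by (rule complex_vector.subspace_add[OF Es z(1) mj])
      have "u (z i + (- 1) *\<^sub>C z j) = u (z i) - u (z j)"
        using clinear_between_add[OF u z(1) mj] clinear_between_scale[OF u z(1), of "- 1"] by simp
      moreover have "B (z i + (- 1) *\<^sub>C z j) = a i - a j"
        using B_add[OF z(1) mj] B_scale[OF z(1), of "- 1"] by (simp add: z(2))
      ultimately show ?thesis using u_le[OF zz] by simp
    qed
    have "Cauchy (\<lambda>n. u (z n))"
    proof (rule CauchyI)
      fix e :: real assume "0 < e"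
      then have "0 < e / (c + 1)" using c by simp
      then obtain N where N: "\<And>i j. i \<ge> N \<Longrightarrow> j \<ge> N \<Longrightarrow> norm (a i - a j) < e / (c + 1)"
        using CauchyD[OF LIMSEQ_imp_Cauchy[OF a(2)]] by blast
      have "norm (u (z i) - u (z j)) < e" if "i \<ge> N" "j \<ge> N" for i j
      proof -
        have "(c + 1) * norm (a i - a j) < e" using N[OF that] c by (simp add: field_simps)
        moreover have "c * norm (a i - a j) \<le> (c + 1) * norm (a i - a j)" by (simp add: mult_right_mono)
        ultimately show ?thesis using diff[of i j] by linarith
      qed
      then show "\<exists>N. \<forall>i\<ge>N. \<forall>j\<ge>N. norm (u (z i) - u (z j)) < e" by blast
    qed
    then obtain y where "(\<lambda>n. u (z n)) \<longlonglongrightarrow> y" using Cauchy_convergent_iff convergent_def by blast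
    moreover have "(\<lambda>n. B (z n)) \<longlonglongrightarrow> p" using a(2) unfolding z(2)[abs_def] .
    ultimately show ?thesis using z(1) p(2) unfolding lim_def by blast
  qed
  have lim_add: "lim (\<xi> + \<xi>') (\<lambda>n. z n + z' n) (p + p') (y + y')" if "lim \<xi> z p y" "lim \<xi>' z' p' y'" for \<xi> \<xi>' z z' p p' y y'
    using that unfolding lim_def
    by (auto simp: B_add clinear_between_add[OF u] cinner_add_right intro!: tendsto_add complex_vector.subspace_add[OF Es])
  have lim_scale: "lim (a *\<^sub>C \<xi>) (\<lambda>n. a *\<^sub>C z n) (a *\<^sub>C p) (a *\<^sub>C y)" if "lim \<xi> z p y" for a \<xi> z p y
    using that unfolding lim_def
    by (auto simp: B_scale clinear_between_scale[OF u] cinner_scaleC_right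
        intro!: bounded_linear.tendsto[OF bounded_linear_scaleC_right] complex_vector.subspace_scale[OF Es])
  have lim_norm: "norm p \<le> norm \<xi>" if "lim \<xi> z p y" for \<xi> z p y
  proof -
    have zE: "\<And>n. z n \<in> E" and zp: "(\<lambda>n. B (z n)) \<longlonglongrightarrow> p" and p: "\<And>w. w \<in> W \<Longrightarrow> cinner w p = cinner w \<xi>"
      using that by (auto simp: lim_def)
    have "(\<lambda>n. cinner (B (z n)) p) \<longlonglongrightarrow> cinner p p" by (rule tendsto_cinner_left[OF zp])
    moreover have "(\<lambda>n. cinner (B (z n)) p) \<longlonglongrightarrow> cinner p \<xi>"
      using tendsto_cinner_left[OF zp, of \<xi>] zE p by (simp add: W_def)
    ultimately have "cinner p p = cinner p \<xi>" by (rule LIMSEQ_unique)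
    then have "norm p * norm p = cmod (cinner p \<xi>)" by (simp add: cinner_self norm_power power2_eq_square norm_mult flip: \<open>cinner p p = cinner p \<xi>\<close>)
    also have "\<dots> \<le> norm p * norm \<xi>" by (rule cinner_Cauchy_Schwarz)
    finally show ?thesis by (cases "norm p = 0") (auto simp: mult_le_cancel_left)
  qed
  have lim_zero: "y = 0" if "lim 0 z p y" for z p y
  proof -
    have zE: "\<And>n. z n \<in> E" and zp: "(\<lambda>n. B (z n)) \<longlonglongrightarrow> p" and zy: "(\<lambda>n. u (z n)) \<longlonglongrightarrow> y"
      using that by (auto simp: lim_def)
    have "p = 0" using lim_norm[OF that] by simp
    then have "(\<lambda>n. c * norm (B (z n))) \<longlonglongrightarrow> c * norm (0 :: ('i + ('h \<Rightarrow>\<^sub>L 'h)) ell2)"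
      using zp by (intro tendsto_intros) simp
    moreover have "(\<lambda>n. norm (u (z n))) \<longlonglongrightarrow> norm y" by (intro tendsto_intros zy)
    ultimately have "norm y \<le> c * norm (0 :: ('i + ('h \<Rightarrow>\<^sub>L 'h)) ell2)"
      by (intro LIMSEQ_le[of "\<lambda>n. norm (u (z n))"]) (auto intro: u_le zE)
    then show ?thesis by simp
  qed
  have lim_unique: "y = y'" if "lim \<xi> z p y" "lim \<xi> z' p' y'" for \<xi> z z' p p' y y'
  proof -
    have "lim (\<xi> + (- 1) *\<^sub>C \<xi>) (\<lambda>n. z n + (- 1) *\<^sub>C z' n) (p + (- 1) *\<^sub>C p') (y + (- 1) *\<^sub>C y')"
      by (intro lim_add lim_scale that)
    then have "lim 0 (\<lambda>n. z n + (- 1) *\<^sub>C z' n) (p + (- 1) *\<^sub>C p') (y + (- 1) *\<^sub>C y')"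
      by simp
    from lim_zero[OF this] show ?thesis by simp
  qed
  from ex have "\<exists>Z P A. \<forall>\<xi>. lim \<xi> (Z \<xi>) (P \<xi>) (A \<xi>)" by metis
  then obtain Z P A where A: "\<And>\<xi>. lim \<xi> (Z \<xi>) (P \<xi>) (A \<xi>)" by blast
  have A_lin: "clinear_between (ell2_space UNIV) F A"
    unfolding clinear_between_def
  proof (intro conjI ballI allI image_subsetI)
    fix \<xi>
    show "A \<xi> \<in> F"
    proof (rule closed_sequentially[OF operator_space_closed[OF F]])
      show "(\<lambda>n. u (Z \<xi> n)) \<longlonglongrightarrow> A \<xi>" using A[of \<xi>] by (simp add: lim_def)
      show "u (Z \<xi> n) \<in> F" for n using A[of \<xi>] clinear_between_mem[OF u] by (simp add: lim_def)
    qed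
    fix \<xi>'
    show "A (\<xi> + \<xi>') = A \<xi> + A \<xi>'" by (rule lim_unique[OF A lim_add[OF A A]])
  next
    fix a \<xi>
    show "A (a *\<^sub>C \<xi>) = a *\<^sub>C A \<xi>" by (rule lim_unique[OF A lim_scale[OF A]])
  qed
  have AB: "u x = A (B x)" if x: "x \<in> E" for x
  proof (rule lim_unique)
    show "lim (B x) (\<lambda>n. x) (B x) (u x)" using x by (simp add: lim_def)
  qed (rule A)
  \<comment> \<open>Domination passes to the limit, and the projections \<open>P (\<xi> k l)\<close>
    are no longer than the vectors themselves.\<close>
  have test: "(cmod (\<Sum>k<m'. \<Sum>l<m. cinner (A (\<xi> k l) (h l)) (h' k)))\<^sup>2
      \<le> c\<^sup>2 * sqrt (gram_square m h * gram_square m' h') * (\<Sum>k<m'. \<Sum>l<m. (norm (\<xi> k l))\<^sup>2)" for m m' :: nat and h h' \<xi>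
  proof -
    let ?K = "c\<^sup>2 * sqrt (gram_square m h * gram_square m' h')"
    have K0: "0 \<le> ?K" by (simp add: gram_square_nonneg)
    have zE: "\<And>k l n. Z (\<xi> k l) n \<in> E" and zp: "\<And>k l. (\<lambda>n. B (Z (\<xi> k l) n)) \<longlonglongrightarrow> P (\<xi> k l)"
      and zy: "\<And>k l. (\<lambda>n. u (Z (\<xi> k l) n)) \<longlonglongrightarrow> A (\<xi> k l)"
      using A by (auto simp: lim_def)
    have "(\<lambda>n. (cmod (\<Sum>k<m'. \<Sum>l<m. cinner (u (Z (\<xi> k l) n) (h l)) (h' k)))\<^sup>2)
        \<longlonglongrightarrow> (cmod (\<Sum>k<m'. \<Sum>l<m. cinner (A (\<xi> k l) (h l)) (h' k)))\<^sup>2"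
      by (intro tendsto_intros tendsto_cinner_left zy)
    moreover have "(\<lambda>n. ?K * (\<Sum>k<m'. \<Sum>l<m. (norm (B (Z (\<xi> k l) n)))\<^sup>2)) \<longlonglongrightarrow> ?K * (\<Sum>k<m'. \<Sum>l<m. (norm (P (\<xi> k l)))\<^sup>2)"
      by (intro tendsto_intros zp)
    moreover have "(cmod (\<Sum>k<m'. \<Sum>l<m. cinner (u (Z (\<xi> k l) n) (h l)) (h' k)))\<^sup>2
        \<le> ?K * (\<Sum>k<m'. \<Sum>l<m. (norm (B (Z (\<xi> k l) n)))\<^sup>2)" for n
      unfolding norm_B[OF zE]
      by (rule oh_dominatedD[OF dom, where z="\<lambda>k l. Z (\<xi> k l) n"]) (rule zE)
    ultimately have "(cmod (\<Sum>k<m'. \<Sum>l<m. cinner (A (\<xi> k l) (h l)) (h' k)))\<^sup>2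
        \<le> ?K * (\<Sum>k<m'. \<Sum>l<m. (norm (P (\<xi> k l)))\<^sup>2)"
      by (intro LIMSEQ_le) auto
    also have "\<dots> \<le> ?K * (\<Sum>k<m'. \<Sum>l<m. (norm (\<xi> k l))\<^sup>2)"
      by (intro mult_left_mono sum_mono power_mono lim_norm[OF A] K0) simp
    finally show ?thesis .
  qed
  have cbA: "cb_bound (OH UNIV) (opsp F) A c"
    unfolding cb_bound_def
  proof (intro conjI allI impI c)
    fix n :: nat and X :: "nat \<Rightarrow> nat \<Rightarrow> ('i + ('h \<Rightarrow>\<^sub>L 'h)) ell2"
    let ?o = "oh_matrix_norm n X"
    have o0: "0 \<le> ?o" by (rule oh_matrix_norm_nonneg)
    have "op_matrix_norm n (\<lambda>i j. A (X i j)) \<le> c * ?o"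
    proof (rule op_matrix_norm_leI)
      show "0 \<le> c * ?o" using c o0 by simp
      fix k k' :: "nat \<Rightarrow> 'k"
      let ?L = "L2_set (\<lambda>l. norm (k l)) {..<n}" and ?L' = "L2_set (\<lambda>l. norm (k' l)) {..<n}"
      obtain N G H where k: "\<And>l. l < n \<Longrightarrow> k l = (\<Sum>p<N. G p l *\<^sub>C H p)"
        and G: "coef_gram n N G \<le> ?L ^ 2" and H: "gram_square N H = ?L ^ 2"
        by (rule column_decomposition[of n k]) (rule that)
      obtain N' G' H' where k': "\<And>l. l < n \<Longrightarrow> k' l = (\<Sum>p<N'. G' p l *\<^sub>C H' p)"
        and G': "coef_gram n N' G' \<le> ?L' ^ 2" and H': "gram_square N' H' = ?L' ^ 2"
        by (rule column_decomposition[of n k']) (rule that)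
      have L0: "0 \<le> ?L" "0 \<le> ?L'" by (simp_all add: L2_set_nonneg)
      have AF: "A \<xi> \<in> bounded_operators" for \<xi>
        using clinear_between_mem[OF A_lin] operator_space_bounded[OF F] by (auto simp: ell2_space_def)
      have X: "\<forall>i<n. \<forall>j<n. X i j \<in> ell2_space UNIV" by (simp add: ell2_space_def)
      have "(cmod (\<Sum>i<n. \<Sum>j<n. cinner (A (X i j) (k j)) (k' i)))\<^sup>2
          = (cmod (\<Sum>q<N'. \<Sum>p<N. cinner (A (compress n G G' X q p) (H p)) (H' q)))\<^sup>2"
      proof -
        have "(\<Sum>i<n. \<Sum>j<n. cinner (A (X i j) (k j)) (k' i))
            = (\<Sum>q<N'. \<Sum>p<N. cinner (compress n G G' (\<lambda>i j. A (X i j)) q p (H p)) (H' q))"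
          by (rule cinner_compress[where Y="\<lambda>i j. A (X i j)"]) (rule AF k k', assumption?)+
        then show ?thesis by (simp only: clinear_between_compress[OF A_lin subspace_ell2_space X])
      qed
      also have "\<dots> \<le> c\<^sup>2 * sqrt (gram_square N H * gram_square N' H') * (\<Sum>q<N'. \<Sum>p<N. (norm (compress n G G' X q p))\<^sup>2)"
        by (rule test)
      \<comment> \<open>One product \<open>?L * ?L'\<close> stems from the vectors in the domination
        test, the other from the coefficients in the test of the \<open>OH\<close> norm. Together
        they form the square of the desired bound.\<close>
      also have "\<dots> \<le> c\<^sup>2 * (?L * ?L') * (?o\<^sup>2 * (?L * ?L'))"
      proof (rule mult_mono)
        show "c\<^sup>2 * sqrt (gram_square N H * gram_square N' H') \<le> c\<^sup>2 * (?L * ?L')"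
          unfolding H H' using L0 by (simp add: real_sqrt_mult)
        have "(\<Sum>q<N'. \<Sum>p<N. (norm (compress n G G' X q p))\<^sup>2) \<le> ?o\<^sup>2 * sqrt (coef_gram n N G * coef_gram n N' G')"
          using oh_test_oh_matrix_norm[of n X] unfolding oh_test_def by blast
        also have "\<dots> \<le> ?o\<^sup>2 * sqrt (?L\<^sup>2 * ?L'\<^sup>2)"
          by (intro mult_left_mono real_sqrt_le_mono mult_mono G G' coef_gram_nonneg) auto
        also have "\<dots> = ?o\<^sup>2 * (?L * ?L')" using L0 by (simp add: real_sqrt_mult)
        finally show "(\<Sum>q<N'. \<Sum>p<N. (norm (compress n G G' X q p))\<^sup>2) \<le> ?o\<^sup>2 * (?L * ?L')" .
      qed (auto intro!: sum_nonneg mult_nonneg_nonneg L0)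
      also have "\<dots> = (c * ?o * ?L * ?L')\<^sup>2" by (simp add: power2_eq_square)
      finally show "cmod (\<Sum>i<n. \<Sum>j<n. cinner (A (X i j) (k j)) (k' i)) \<le> c * ?o * ?L * ?L'"
        by (rule power2_le_imp_le) (intro mult_nonneg_nonneg c o0 L0)
    qed
    then show "matrix_norm (opsp F) n (\<lambda>i j. A (X i j)) \<le> c * matrix_norm (OH UNIV) n X" by simp
  qed
  show thesis
  proof (rule that[of A B])
    show "oh_factorization E F u UNIV A B"
      unfolding oh_factorization_def completely_bounded_def using A_lin B_lin cbA cbB AB by auto
  qed (rule cbB cbA)+
qed

text \<open>The Cauchy-Schwarz inequality between a family of vectors and a Hilbert-Schmidt family
  of functionals: first on finite sections, then by density. The bounds on the individual
  functionals serve the limit and do not enter the constant.\<close>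

lemma bounded_functional_family_le:
  fixes \<phi> :: "'d \<Rightarrow> 'i ell2 \<Rightarrow> complex"
  assumes D: "finite D"
    and add: "\<And>d x y. d \<in> D \<Longrightarrow> x \<in> ell2_space I \<Longrightarrow> y \<in> ell2_space I \<Longrightarrow> \<phi> d (x + y) = \<phi> d x + \<phi> d y"
    and scale: "\<And>d a x. d \<in> D \<Longrightarrow> x \<in> ell2_space I \<Longrightarrow> \<phi> d (a *\<^sub>C x) = a * \<phi> d x"
    and bdd: "\<And>d. d \<in> D \<Longrightarrow> \<exists>b. \<forall>x\<in>ell2_space I. cmod (\<phi> d x) \<le> b * norm x"
    and K: "0 \<le> K" "\<And>J. finite J \<Longrightarrow> J \<subseteq> I \<Longrightarrow> (\<Sum>i\<in>J. \<Sum>d\<in>D. (cmod (\<phi> d (ell2_basis i)))\<^sup>2) \<le> K\<^sup>2"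
    and \<xi>: "\<And>d. d \<in> D \<Longrightarrow> \<xi> d \<in> ell2_space I"
  shows "cmod (\<Sum>d\<in>D. \<phi> d (\<xi> d)) \<le> K * sqrt (\<Sum>d\<in>D. (norm (\<xi> d))\<^sup>2)"
proof -
  define P where "P d J = (\<Sum>i\<in>J. ell2_nth (\<xi> d) i *\<^sub>C ell2_basis i)" for d J
  have P_eq: "P d J = (\<Sum>i\<in>J \<inter> I. ell2_nth (\<xi> d) i *\<^sub>C ell2_basis i)" if "d \<in> D" "finite J" for d J
    unfolding P_def using \<xi>[OF that(1)] that(2)
    by (intro sum.mono_neutral_right) (auto simp: ell2_space_def)
  have PI: "P d J \<in> ell2_space I" if "d \<in> D" "finite J" for d J
    unfolding P_eq[OF that]
    by (intro complex_vector.subspace_sum[OF subspace_ell2_space]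
        complex_vector.subspace_scale[OF subspace_ell2_space] ell2_basis_in_ell2_space) blast
  have zero: "\<phi> d 0 = 0" if "d \<in> D" for d
    using scale[OF that complex_vector.subspace_0[OF subspace_ell2_space], of 0] by simp
  have \<phi>_sum: "\<phi> d (\<Sum>i\<in>J. c i *\<^sub>C ell2_basis i) = (\<Sum>i\<in>J. c i * \<phi> d (ell2_basis i))"
    if "d \<in> D" "J \<subseteq> I" for d J c
    using that(2)
  proof (induction J rule: infinite_finite_induct)
    case (insert i J)
    have "ell2_basis i \<in> ell2_space I" using insert.prems by (intro ell2_basis_in_ell2_space) blast
    moreover have "(\<Sum>i\<in>J. c i *\<^sub>C ell2_basis i) \<in> ell2_space I"
      using insert.prems by (intro complex_vector.subspace_sum[OF subspace_ell2_space]
        complex_vector.subspace_scale[OF subspace_ell2_space] ell2_basis_in_ell2_space) blast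
    moreover have "c i *\<^sub>C ell2_basis i \<in> ell2_space I"
      by (rule complex_vector.subspace_scale[OF subspace_ell2_space \<open>ell2_basis i \<in> ell2_space I\<close>])
    ultimately show ?case using insert add[OF that(1)] scale[OF that(1)] by simp
  qed (simp_all add: zero[OF that(1)])
  have \<phi>P: "((\<lambda>J. \<phi> d (P d J)) \<longlongrightarrow> \<phi> d (\<xi> d)) (finite_subsets_at_top UNIV)" if d: "d \<in> D" for d
  proof -
    obtain b where b: "\<And>x. x \<in> ell2_space I \<Longrightarrow> cmod (\<phi> d x) \<le> b * norm x" using bdd[OF d] by blast
    have "((\<lambda>J. \<phi> d (P d J) - \<phi> d (\<xi> d)) \<longlongrightarrow> 0) (finite_subsets_at_top UNIV)"
    proof (rule Lim_null_comparison)
      show "\<forall>\<^sub>F J in finite_subsets_at_top UNIV. norm (\<phi> d (P d J) - \<phi> d (\<xi> d)) \<le> b * norm (P d J - \<xi> d)"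
      proof (rule eventually_finite_subsets_at_top_weakI)
        fix J :: "'i set" assume J: "finite J"
        have m: "(- 1) *\<^sub>C \<xi> d \<in> ell2_space I" by (rule complex_vector.subspace_scale[OF subspace_ell2_space \<xi>[OF d]])
        have pm: "P d J + (- 1) *\<^sub>C \<xi> d \<in> ell2_space I"
          by (rule complex_vector.subspace_add[OF subspace_ell2_space PI[OF d J] m])
        have "\<phi> d (P d J + (- 1) *\<^sub>C \<xi> d) = \<phi> d (P d J) - \<phi> d (\<xi> d)"
          using add[OF d PI[OF d J] m] scale[OF d \<xi>[OF d], of "- 1"] by simp
        moreover have "cmod (\<phi> d (P d J + (- 1) *\<^sub>C \<xi> d)) \<le> b * norm (P d J + (- 1) *\<^sub>C \<xi> d)" by (rule b[OF pm])
        moreover have "P d J + (- 1) *\<^sub>C \<xi> d = P d J - \<xi> d" by simp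
        ultimately show "norm (\<phi> d (P d J) - \<phi> d (\<xi> d)) \<le> b * norm (P d J - \<xi> d)" by simp
      qed
      have "((\<lambda>J. b * norm (P d J - \<xi> d)) \<longlongrightarrow> b * norm (\<xi> d - \<xi> d)) (finite_subsets_at_top UNIV)"
        unfolding P_def by (intro tendsto_intros ell2_basis_expansion)
      then show "((\<lambda>J. b * norm (P d J - \<xi> d)) \<longlongrightarrow> 0) (finite_subsets_at_top UNIV)" by simp
    qed
    then show ?thesis by (rule LIM_zero_cancel)
  qed
  have fin: "cmod (\<Sum>d\<in>D. \<phi> d (P d J)) \<le> K * sqrt (\<Sum>d\<in>D. (norm (\<xi> d))\<^sup>2)" if J: "finite J" for J
  proof -
    let ?J = "J \<inter> I"
    have "(\<Sum>d\<in>D. \<phi> d (P d J)) = (\<Sum>d\<in>D. \<Sum>i\<in>?J. ell2_nth (\<xi> d) i * \<phi> d (ell2_basis i))"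
      using J by (intro sum.cong refl) (simp add: P_eq \<phi>_sum)
    also have "\<dots> = (\<Sum>a\<in>D \<times> ?J. ell2_nth (\<xi> (fst a)) (snd a) * \<phi> (fst a) (ell2_basis (snd a)))"
      by (simp only: sum.cartesian_product' fst_conv snd_conv)
    finally have "cmod (\<Sum>d\<in>D. \<phi> d (P d J))
        \<le> (\<Sum>a\<in>D \<times> ?J. cmod (ell2_nth (\<xi> (fst a)) (snd a)) * cmod (\<phi> (fst a) (ell2_basis (snd a))))"
      by (simp only: norm_mult[symmetric] norm_sum)
    also have "\<dots> \<le> sqrt (\<Sum>a\<in>D \<times> ?J. (cmod (ell2_nth (\<xi> (fst a)) (snd a)))\<^sup>2)
        * sqrt (\<Sum>a\<in>D \<times> ?J. (cmod (\<phi> (fst a) (ell2_basis (snd a))))\<^sup>2)"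
      by (rule sum_cmod_mult_le)
    also have "\<dots> \<le> sqrt (\<Sum>d\<in>D. (norm (\<xi> d))\<^sup>2) * K"
    proof (rule mult_mono)
      have "(\<Sum>a\<in>D \<times> ?J. (cmod (ell2_nth (\<xi> (fst a)) (snd a)))\<^sup>2) = (\<Sum>d\<in>D. \<Sum>i\<in>?J. (cmod (ell2_nth (\<xi> d) i))\<^sup>2)"
        by (simp only: sum.cartesian_product' fst_conv snd_conv)
      also have "\<dots> \<le> (\<Sum>d\<in>D. (norm (\<xi> d))\<^sup>2)" using J by (intro sum_mono sum_ell2_nth_le) simp
      finally show "sqrt (\<Sum>a\<in>D \<times> ?J. (cmod (ell2_nth (\<xi> (fst a)) (snd a)))\<^sup>2) \<le> sqrt (\<Sum>d\<in>D. (norm (\<xi> d))\<^sup>2)"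
        by (rule real_sqrt_le_mono)
      have "(\<Sum>a\<in>D \<times> ?J. (cmod (\<phi> (fst a) (ell2_basis (snd a))))\<^sup>2) = (\<Sum>d\<in>D. \<Sum>i\<in>?J. (cmod (\<phi> d (ell2_basis i)))\<^sup>2)"
        by (simp only: sum.cartesian_product' fst_conv snd_conv)
      also have "\<dots> = (\<Sum>i\<in>?J. \<Sum>d\<in>D. (cmod (\<phi> d (ell2_basis i)))\<^sup>2)" by (rule sum.swap)
      also have "\<dots> \<le> K\<^sup>2" using J by (intro K(2)) auto
      finally show "sqrt (\<Sum>a\<in>D \<times> ?J. (cmod (\<phi> (fst a) (ell2_basis (snd a))))\<^sup>2) \<le> K"
        using K(1) by (simp add: real_le_lsqrt)
    qed (auto intro!: sum_nonneg)
    finally show ?thesis by (simp add: mult.commute)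
  qed
  show ?thesis
  proof (rule tendsto_upperbound)
    show "((\<lambda>J. cmod (\<Sum>d\<in>D. \<phi> d (P d J))) \<longlongrightarrow> cmod (\<Sum>d\<in>D. \<phi> d (\<xi> d))) (finite_subsets_at_top UNIV)"
      by (intro tendsto_norm tendsto_sum \<phi>P)
    show "\<forall>\<^sub>F J in finite_subsets_at_top UNIV. cmod (\<Sum>d\<in>D. \<phi> d (P d J)) \<le> K * sqrt (\<Sum>d\<in>D. (norm (\<xi> d))\<^sup>2)"
      by (rule eventually_finite_subsets_at_top_weakI) (rule fin)
  qed simp
qed

lemma cb_bound_OH_norm_le:
  assumes cb: "cb_bound (OH I) (opsp F) A c" and \<xi>: "\<xi> \<in> ell2_space I"
  shows "norm (A \<xi>) \<le> c * norm \<xi>"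
proof -
  have "norm (A \<xi>) = matrix_norm (opsp F) 1 (\<lambda>i j. A \<xi>)" by (simp add: op_matrix_norm_one[simplified])
  also have "\<dots> \<le> c * matrix_norm (OH I) 1 (\<lambda>i j. \<xi>)"
    using cb \<xi> unfolding cb_bound_def by simp
  also have "\<dots> \<le> c * norm \<xi>"
    using cb oh_matrix_norm_one[of \<xi>] unfolding cb_bound_def by (simp add: mult_left_mono)
  finally show ?thesis .
qed

lemma cb_bound_opsp_norm_le:
  assumes cb: "cb_bound (opsp E) (OH I) B b" and x: "x \<in> E"
  shows "norm (B x) \<le> b * norm x"
proof -
  have "norm (B x) \<le> matrix_norm (OH I) 1 (\<lambda>i j. B x)" using oh_matrix_norm_one_ge[of "B x"] by simp
  also have "\<dots> \<le> b * matrix_norm (opsp E) 1 (\<lambda>i j. x)"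
    using cb x unfolding cb_bound_def by simp
  also have "\<dots> = b * norm x" by (simp add: op_matrix_norm_one[simplified])
  finally show ?thesis .
qed

text \<open>The converse of the construction of \<open>A\<close> above. The family of images of the
  basis passes all positive tests with constant \<open>c\<close>, which says that the functionals
  given by the vectors \<open>h l\<close> and \<open>h' k\<close> form a Hilbert-Schmidt
  family.\<close>

lemma cb_bound_OH_test:
  fixes A :: "'i ell2 \<Rightarrow> 'k::chilbert_space \<Rightarrow>\<^sub>L 'k"
  assumes F: "F \<subseteq> bounded_operators" and A: "clinear_between (ell2_space I) F A"
    and cb: "cb_bound (OH I) (opsp F) A c" and \<xi>: "\<And>k l. k < m' \<Longrightarrow> l < m \<Longrightarrow> \<xi> k l \<in> ell2_space I"
  shows "(cmod (\<Sum>k<m'. \<Sum>l<m. cinner (A (\<xi> k l) (h l)) (h' k)))\<^sup>2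
    \<le> c\<^sup>2 * sqrt (gram_square m h * gram_square m' h') * (\<Sum>k<m'. \<Sum>l<m. (norm (\<xi> k l))\<^sup>2)"
proof -
  let ?D = "{..<m'} \<times> {..<m}"
  let ?\<phi> = "\<lambda>d \<eta>. cinner (A \<eta> (h (snd d))) (h' (fst d))"
  have c: "0 \<le> c" using cb by (simp add: cb_bound_def)
  let ?r = "sqrt (gram_square m h * gram_square m' h')"
  have r0: "0 \<le> ?r" by (simp add: gram_square_nonneg)
  have "cmod (\<Sum>d\<in>?D. ?\<phi> d (\<xi> (fst d) (snd d))) \<le> (c * sqrt ?r) * sqrt (\<Sum>d\<in>?D. (norm (\<xi> (fst d) (snd d)))\<^sup>2)"
  proof (rule bounded_functional_family_le[where I=I])
    show "?\<phi> d (x + y) = ?\<phi> d x + ?\<phi> d y" if "x \<in> ell2_space I" "y \<in> ell2_space I" for d x y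
      using that by (simp add: clinear_between_add[OF A] blinfun.add_left cinner_add_left)
    show "?\<phi> d (a *\<^sub>C x) = a * ?\<phi> d x" if "x \<in> ell2_space I" for d a x
      using that by (simp add: clinear_between_scale[OF A] scaleC_blinfun.rep_eq cinner_scaleC_left)
    show "\<exists>b. \<forall>x\<in>ell2_space I. cmod (?\<phi> d x) \<le> b * norm x" for d
    proof (intro exI ballI)
      fix x assume x: "x \<in> ell2_space I"
      have "cmod (?\<phi> d x) \<le> norm (A x (h (snd d))) * norm (h' (fst d))" by (rule cinner_Cauchy_Schwarz)
      also have "\<dots> \<le> (c * norm x * norm (h (snd d))) * norm (h' (fst d))"
        by (intro mult_right_mono order.trans[OF norm_blinfun] cb_bound_OH_norm_le[OF cb x]) auto
      finally show "cmod (?\<phi> d x) \<le> (c * norm (h (snd d)) * norm (h' (fst d))) * norm x" by (simp add: mult_ac)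
    qed
    show "0 \<le> c * sqrt ?r" using c r0 by simp
    show "(\<Sum>i\<in>J. \<Sum>d\<in>?D. (cmod (?\<phi> d (ell2_basis i)))\<^sup>2) \<le> (c * sqrt ?r)\<^sup>2" if J: "finite J" "J \<subseteq> I" for J
    proof -
      have mem: "A (ell2_basis i) \<in> bounded_operators" if "i \<in> J" for i
        using clinear_between_mem[OF A ell2_basis_in_ell2_space, of i] F J(2) that by blast
      have "conj_square_test J (\<lambda>i. A (ell2_basis i)) c"
        using conj_square_norm_basis_image_le[OF F A cb J] conj_square_norm_le_iff[OF J(1) mem c] by simp
      then have "(\<Sum>i\<in>J. \<Sum>k<m'. \<Sum>l<m. (cmod (cinner (A (ell2_basis i) (h l)) (h' k)))\<^sup>2) \<le> c\<^sup>2 * ?r"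
        unfolding conj_square_test_def by simp
      then show ?thesis using r0 by (simp add: power_mult_distrib sum.cartesian_product')
    qed
    show "\<xi> (fst d) (snd d) \<in> ell2_space I" if "d \<in> ?D" for d using that by (auto intro: \<xi>)
  qed simp
  then have "cmod (\<Sum>k<m'. \<Sum>l<m. cinner (A (\<xi> k l) (h l)) (h' k))
      \<le> (c * sqrt ?r) * sqrt (\<Sum>k<m'. \<Sum>l<m. (norm (\<xi> k l))\<^sup>2)"
    by (simp only: sum.cartesian_product' fst_conv snd_conv)
  then have "(cmod (\<Sum>k<m'. \<Sum>l<m. cinner (A (\<xi> k l) (h l)) (h' k)))\<^sup>2
      \<le> ((c * sqrt ?r) * sqrt (\<Sum>k<m'. \<Sum>l<m. (norm (\<xi> k l))\<^sup>2))\<^sup>2"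
    by (rule power_mono) simp
  also have "\<dots> = c\<^sup>2 * ?r * (\<Sum>k<m'. \<Sum>l<m. (norm (\<xi> k l))\<^sup>2)"
    using r0 by (simp add: power_mult_distrib sum_nonneg)
  finally show ?thesis .
qed

text \<open>For \<open>b = 0\<close> the division yields \<open>0\<close>, which is correct since then \<open>B\<close> vanishes on \<open>E\<close>.\<close>

definition induced_form ::
    "('h::chilbert_space \<Rightarrow>\<^sub>L 'h) set \<Rightarrow> (('h \<Rightarrow>\<^sub>L 'h) \<Rightarrow> 'i ell2) \<Rightarrow> real \<Rightarrow> ('h \<Rightarrow>\<^sub>L 'h) \<Rightarrow> ('h \<Rightarrow>\<^sub>L 'h) \<Rightarrow> complex"
  where "induced_form E B b x y = (if x \<in> E \<and> y \<in> E then cinner (B x) (B y) / of_real (b\<^sup>2) else 0)"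

lemma induced_form_self:
  assumes cb: "cb_bound (opsp E) (OH I) B b" and x: "x \<in> E"
  shows "(norm (B x))\<^sup>2 = b\<^sup>2 * Re (induced_form E B b x x)"
    and "Re (induced_form E B b x x) = (norm (B x))\<^sup>2 / b\<^sup>2"
proof -
  have "induced_form E B b x x = of_real ((norm (B x))\<^sup>2 / b\<^sup>2)"
    using x by (simp add: induced_form_def cinner_self)
  then show 2: "Re (induced_form E B b x x) = (norm (B x))\<^sup>2 / b\<^sup>2" by (simp only: Re_complex_of_real)
  show "(norm (B x))\<^sup>2 = b\<^sup>2 * Re (induced_form E B b x x)"
    unfolding 2 using cb_bound_opsp_norm_le[OF cb x] by (cases "b = 0") auto
qed

lemma oh_form_induced_form:
  fixes E :: "('h::chilbert_space \<Rightarrow>\<^sub>L 'h) set"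
  assumes E: "operator_space E" and B: "clinear_between E (ell2_space I) B"
    and cb: "cb_bound (opsp E) (OH I) B b"
  shows "oh_form E (induced_form E B b)"
  unfolding oh_form_def
proof (intro conjI allI impI)
  have b: "0 \<le> b" using cb by (simp add: cb_bound_def)
  fix x y :: "'h \<Rightarrow>\<^sub>L 'h"
  show "cmod (induced_form E B b x y) \<le> norm x * norm y"
  proof (cases "x \<in> E \<and> y \<in> E \<and> b \<noteq> 0")
    case True
    have "cmod (cinner (B x) (B y)) \<le> norm (B x) * norm (B y)" by (rule cinner_Cauchy_Schwarz)
    also have "\<dots> \<le> (b * norm x) * (b * norm y)"
      using True b by (intro mult_mono cb_bound_opsp_norm_le[OF cb]) auto
    finally have "cmod (cinner (B x) (B y)) \<le> (norm x * norm y) * b\<^sup>2" by (simp add: power2_eq_square mult_ac)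
    then have "cmod (cinner (B x) (B y)) / b\<^sup>2 \<le> norm x * norm y" using True by (simp add: pos_divide_le_eq)
    then show ?thesis using True by (simp add: induced_form_def norm_divide norm_power)
  qed (auto simp: induced_form_def)
next
  note Es = operator_space_subspace[OF E]
  have Re0: "0 \<le> Re (induced_form E B b x x)" if "x \<in> E" for x
    unfolding induced_form_self(2)[OF cb that] by simp
  show "psd_form E (induced_form E B b)"
    unfolding psd_form_def
  proof (intro conjI ballI allI Re0)
    fix x y z assume x: "x \<in> E" and y: "y \<in> E" and z: "z \<in> E"
    show "induced_form E B b (x + y) z = induced_form E B b x z + induced_form E B b y z"
      using x y z complex_vector.subspace_add[OF Es x y]
      by (simp add: induced_form_def clinear_between_add[OF B x y] cinner_add_left add_divide_distrib)
  next
    fix c x z assume x: "x \<in> E" and z: "z \<in> E"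
    show "induced_form E B b (c *\<^sub>C x) z = c * induced_form E B b x z"
      using x z complex_vector.subspace_scale[OF Es x, of c]
      by (simp add: induced_form_def clinear_between_scale[OF B x] cinner_scaleC_left)
  next
    fix x z assume x: "x \<in> E" and z: "z \<in> E"
    show "induced_form E B b x z = cnj (induced_form E B b z x)"
      using x z cinner_commute[of "B x" "B z"] by (simp add: induced_form_def)
  qed
next
  note Es = operator_space_subspace[OF E]
  fix n m m' :: nat and X g g' assume X: "\<forall>i<n. \<forall>j<n. X i j \<in> E"
  let ?S = "sqrt (coef_gram n m g * coef_gram n m' g')"
  have S0: "0 \<le> ?S" by (simp add: coef_gram_nonneg)
  have "Re (induced_form E B b (compress n g g' X k l) (compress n g g' X k l))
      = (norm (compress n g g' (\<lambda>i j. B (X i j)) k l))\<^sup>2 / b\<^sup>2" for k l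
    unfolding induced_form_self(2)[OF cb compress_mem[OF Es X]] clinear_between_compress[OF B Es X] ..
  then have "(\<Sum>k<m'. \<Sum>l<m. Re (induced_form E B b (compress n g g' X k l) (compress n g g' X k l)))
      = (\<Sum>k<m'. \<Sum>l<m. (norm (compress n g g' (\<lambda>i j. B (X i j)) k l))\<^sup>2) / b\<^sup>2"
    by (simp add: sum_divide_distrib)
  also have "\<dots> \<le> ((b * op_matrix_norm n X)\<^sup>2 * ?S) / b\<^sup>2"
  proof (rule divide_right_mono)
    let ?o = "oh_matrix_norm n (\<lambda>i j. B (X i j))"
    have "(\<Sum>k<m'. \<Sum>l<m. (norm (compress n g g' (\<lambda>i j. B (X i j)) k l))\<^sup>2) \<le> ?o\<^sup>2 * ?S"
      using oh_test_oh_matrix_norm[of n "\<lambda>i j. B (X i j)"] unfolding oh_test_def by simp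
    also have "?o \<le> b * op_matrix_norm n X" using cb X by (simp add: cb_bound_def)
    then have "?o\<^sup>2 * ?S \<le> (b * op_matrix_norm n X)\<^sup>2 * ?S"
      by (intro mult_right_mono power_mono S0 oh_matrix_norm_nonneg)
    finally show "(\<Sum>k<m'. \<Sum>l<m. (norm (compress n g g' (\<lambda>i j. B (X i j)) k l))\<^sup>2) \<le> (b * op_matrix_norm n X)\<^sup>2 * ?S" .
  qed simp
  also have "\<dots> \<le> (op_matrix_norm n X)\<^sup>2 * ?S"
    using S0 by (cases "b = 0") (auto simp: power_mult_distrib)
  finally show "(\<Sum>k<m'. \<Sum>l<m. Re (induced_form E B b (compress n g g' X k l) (compress n g g' X k l)))
      \<le> (op_matrix_norm n X)\<^sup>2 * ?S" .
qed

text \<open>Normalizing the form by \<open>b\<^sup>2\<close> moves the norm of \<open>B\<close> into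
  the constant of domination.\<close>

lemma oh_dominated_factorization:
  assumes F: "operator_space F" and A: "clinear_between (ell2_space I) F A" and B: "clinear_between E (ell2_space I) B"
    and cbA: "cb_bound (OH I) (opsp F) A a" and cbB: "cb_bound (opsp E) (OH I) B b"
    and u: "\<And>x. x \<in> E \<Longrightarrow> u x = A (B x)"
  shows "oh_dominated E u (a * b) (induced_form E B b)"
  unfolding oh_dominated_def
proof (intro allI impI)
  fix m m' :: nat and h h' z assume z: "\<forall>k<m'. \<forall>l<m. z k l \<in> E"
  have "(\<Sum>k<m'. \<Sum>l<m. cinner (u (z k l) (h l)) (h' k)) = (\<Sum>k<m'. \<Sum>l<m. cinner (A (B (z k l)) (h l)) (h' k))"
    using z by (intro sum.cong refl) (simp add: u)
  then have "(cmod (\<Sum>k<m'. \<Sum>l<m. cinner (u (z k l) (h l)) (h' k)))\<^sup>2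
      \<le> a\<^sup>2 * sqrt (gram_square m h * gram_square m' h') * (\<Sum>k<m'. \<Sum>l<m. (norm (B (z k l)))\<^sup>2)"
    using cb_bound_OH_test[OF operator_space_bounded[OF F] A cbA, of m' m "\<lambda>k l. B (z k l)" h h'] z
      clinear_between_mem[OF B] by simp
  also have "(\<Sum>k<m'. \<Sum>l<m. (norm (B (z k l)))\<^sup>2) = (\<Sum>k<m'. \<Sum>l<m. b\<^sup>2 * Re (induced_form E B b (z k l) (z k l)))"
    using z by (intro sum.cong refl induced_form_self(1)[OF cbB]) simp
  also have "a\<^sup>2 * sqrt (gram_square m h * gram_square m' h') * \<dots>
      = (a * b)\<^sup>2 * sqrt (gram_square m h * gram_square m' h') * (\<Sum>k<m'. \<Sum>l<m. Re (induced_form E B b (z k l) (z k l)))"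
    by (simp add: sum_distrib_left[symmetric] power_mult_distrib)
  finally show "(cmod (\<Sum>k<m'. \<Sum>l<m. cinner (u (z k l) (h l)) (h' k)))\<^sup>2
      \<le> (a * b)\<^sup>2 * sqrt (gram_square m h * gram_square m' h') * (\<Sum>k<m'. \<Sum>l<m. Re (induced_form E B b (z k l) (z k l)))" .
qed

section \<open>Compactness and a minimax argument\<close>

text \<open>The bound on \<open>s x y\<close> is imposed for all operators and not only on
  \<open>E\<close>, so the forms lie in a product of discs; \<open>induced_form\<close> is
  \<open>0\<close> off \<open>E\<close> to comply. The other conditions are closed, since each
  involves finitely many values of the form.\<close>

lemma compact_oh_forms:
  fixes E :: "('h::chilbert_space \<Rightarrow>\<^sub>L 'h) set"
  shows "compact {w. oh_form E (\<lambda>x y. w (x, y))}"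
proof -
  let ?M = "{w. \<forall>p::('h \<Rightarrow>\<^sub>L 'h) \<times> ('h \<Rightarrow>\<^sub>L 'h). cmod (w p) \<le> norm (fst p) * norm (snd p)}"
  let ?P = "{w. psd_form E (\<lambda>x y. w (x, y))}"
  let ?T = "{w. \<forall>n X m m' g g'. (\<forall>i<n. \<forall>j<n. X i j \<in> E) \<longrightarrow>
      (\<Sum>k<m'. \<Sum>l<m. Re (w (compress n g g' X k l, compress n g g' X k l)))
        \<le> (op_matrix_norm n X)\<^sup>2 * sqrt (coef_gram n m g * coef_gram n m' g')}"
  have eq: "{w. oh_form E (\<lambda>x y. w (x, y))} = ?P \<inter> ?T \<inter> ?M"
    unfolding oh_form_def by auto
  have "closed ?P"
    unfolding psd_form_def Ball_def
    by (intro closed_Collect_conj closed_Collect_all closed_Collect_imp closed_Collect_eq closed_Collect_le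
        continuous_intros continuous_on_product_coordinates) auto
  moreover have "closed ?T"
    by (intro closed_Collect_all closed_Collect_imp closed_Collect_le
        continuous_intros continuous_on_product_coordinates) auto
  moreover have "compact ?M"
    by (rule compact_bounded_functions[of "\<lambda>p. norm (fst p) * norm (snd p)"])
  ultimately show ?thesis unfolding eq by (intro closed_Int_compact closed_Int)
qed

text \<open>The finite intersection property for the closed sets indexed by a test and a slack. Thus
  it is enough to satisfy finitely many tests approximately.\<close>

lemma oh_form_compactness:
  fixes f :: "'w \<Rightarrow> (('h::chilbert_space \<Rightarrow>\<^sub>L 'h) \<Rightarrow> ('h \<Rightarrow>\<^sub>L 'h) \<Rightarrow> complex) \<Rightarrow> real"
  assumes cont: "\<And>\<omega>. continuous_on UNIV (\<lambda>w. f \<omega> (\<lambda>x y. w (x, y)))"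
    and ex: "\<And>\<Omega>' e. finite \<Omega>' \<Longrightarrow> \<Omega>' \<subseteq> \<Omega> \<Longrightarrow> 0 < e \<Longrightarrow> \<exists>s. oh_form E s \<and> (\<forall>\<omega>\<in>\<Omega>'. f \<omega> s \<le> c + e)"
  shows "\<exists>s. oh_form E s \<and> (\<forall>\<omega>\<in>\<Omega>. f \<omega> s \<le> c)"
proof -
  let ?S = "{w. oh_form E (\<lambda>x y. w (x, y))}"
  let ?C = "\<lambda>i. {w. f (fst i) (\<lambda>x y. w (x, y)) \<le> c + snd i}"
  have "?S \<inter> (\<Inter>i\<in>\<Omega> \<times> {0::real<..}. ?C i) \<noteq> {}"
  proof (rule compact_imp_fip_image[OF compact_oh_forms])
    fix i show "closed (?C i)" by (intro closed_Collect_le cont continuous_on_const)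
  next
    fix I' assume I': "finite I'" "I' \<subseteq> \<Omega> \<times> {0::real<..}"
    \<comment> \<open>The smallest slack that occurs; the \<open>1\<close> covers an empty
      subfamily.\<close>
    define e where "e = Min (insert 1 (snd ` I'))"
    have e: "0 < e" "\<And>i. i \<in> I' \<Longrightarrow> e \<le> snd i" unfolding e_def using I' by (auto simp: subset_iff)
    have "\<exists>s. oh_form E s \<and> (\<forall>\<omega>\<in>fst ` I'. f \<omega> s \<le> c + e)"
      by (rule ex[OF _ _ e(1)]) (use I' in auto)
    then obtain s where s: "oh_form E s" "\<And>i. i \<in> I' \<Longrightarrow> f (fst i) s \<le> c + e" by blast
    have "case_prod s \<in> ?S \<inter> (\<Inter>i\<in>I'. ?C i)"
      using s(1) s(2)[THEN order.trans] e(2) by auto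
    then show "?S \<inter> (\<Inter>i\<in>I'. ?C i) \<noteq> {}" by blast
  qed
  then obtain w where w: "oh_form E (\<lambda>x y. w (x, y))"
    and fw: "\<And>\<omega> e. \<omega> \<in> \<Omega> \<Longrightarrow> 0 < e \<Longrightarrow> f \<omega> (\<lambda>x y. w (x, y)) \<le> c + e" by force
  have "f \<omega> (\<lambda>x y. w (x, y)) \<le> c" if "\<omega> \<in> \<Omega>" for \<omega>
    by (rule field_le_epsilon) (rule fw[OF that])
  then show ?thesis using w by blast
qed

text \<open>If no point of \<open>K\<close> made both functions at most \<open>c + e\<close>, a line
  would separate that corner from the set of values, and its normalized coefficients would be
  weights that contradict \<open>ex\<close>. The hypothesis \<open>mix\<close> stands for convexity,
  so \<open>K\<close> needs no linear structure.\<close>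

lemma minimax_two:
  fixes f g :: "'s \<Rightarrow> real"
  assumes mix: "\<And>x y t. x \<in> K \<Longrightarrow> y \<in> K \<Longrightarrow> 0 \<le> t \<Longrightarrow> t \<le> 1 \<Longrightarrow>
      \<exists>z\<in>K. f z \<le> (1 - t) * f x + t * f y \<and> g z \<le> (1 - t) * g x + t * g y"
    and ex: "\<And>t. 0 \<le> t \<Longrightarrow> t \<le> 1 \<Longrightarrow> \<exists>x\<in>K. (1 - t) * f x + t * g x \<le> c"
    and e: "0 < e"
  shows "\<exists>x\<in>K. f x \<le> c + e \<and> g x \<le> c + e"
proof (rule ccontr)
  assume none: "\<not> (\<exists>x\<in>K. f x \<le> c + e \<and> g x \<le> c + e)"
  \<comment> \<open>Passing to all larger pairs makes the set of values convex and forces the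
    coefficients of the separating functional to be nonnegative.\<close>
  define W where "W = {(a, b). \<exists>x\<in>K. f x \<le> a \<and> g x \<le> b}"
  have "convex W"
    unfolding convex_alt
  proof (intro ballI allI impI)
    fix p q :: "real \<times> real" and t :: real assume "p \<in> W" "q \<in> W" and t: "0 \<le> t \<and> t \<le> 1"
    then obtain x y where x: "x \<in> K" "f x \<le> fst p" "g x \<le> snd p" and y: "y \<in> K" "f y \<le> fst q" "g y \<le> snd q"
      by (auto simp: W_def)
    obtain z where z: "z \<in> K" "f z \<le> (1 - t) * f x + t * f y" "g z \<le> (1 - t) * g x + t * g y"
      using mix[OF x(1) y(1)] t by blast
    have "(1 - t) * f x + t * f y \<le> (1 - t) * fst p + t * fst q"
      "(1 - t) * g x + t * g y \<le> (1 - t) * snd p + t * snd q"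
      using x y t by (auto intro!: add_mono mult_left_mono)
    then show "(1 - t) *\<^sub>R p + t *\<^sub>R q \<in> W"
      unfolding W_def using z by (auto simp: case_prod_unfold intro!: bexI[of _ z])
  qed
  moreover obtain x0 where "x0 \<in> K" using ex[of 0] by auto
  then have "(f x0, g x0) \<in> W" unfolding W_def by auto
  then have "W \<noteq> {}" by blast
  moreover have "{(c + e, c + e)} \<inter> W = {}" using none by (auto simp: W_def)
  ultimately obtain a :: "real \<times> real" and b where a: "a \<noteq> 0" "a \<bullet> (c + e, c + e) \<le> b" "\<And>p. p \<in> W \<Longrightarrow> b \<le> a \<bullet> p"
  proof -
    assume W: "convex W" "W \<noteq> {}" "{(c + e, c + e)} \<inter> W = {}"
      and th: "\<And>a b. a \<noteq> 0 \<Longrightarrow> a \<bullet> (c + e, c + e) \<le> b \<Longrightarrow> (\<And>p. p \<in> W \<Longrightarrow> b \<le> a \<bullet> p) \<Longrightarrow> thesis"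
    from separating_hyperplane_sets[OF convex_singleton W(1) insert_not_empty W(2,3)]
    obtain a b where "a \<noteq> 0" "\<forall>x\<in>{(c + e, c + e)}. a \<bullet> x \<le> b" "\<forall>x\<in>W. b \<le> a \<bullet> x" by blast
    then show thesis by (intro th[of a b]) simp_all
  qed
  obtain a1 a2 where a12: "a = (a1, a2)" by (cases a)
  have sep: "a1 * (c + e) + a2 * (c + e) \<le> a1 * r + a2 * r'" if "(r, r') \<in> W" for r r'
    using a(2) a(3)[OF that] by (simp add: a12)
  have up: "(f x0 + r, g x0 + r') \<in> W" if "0 \<le> r" "0 \<le> r'" for r r'
    unfolding W_def using \<open>x0 \<in> K\<close> that by (auto intro!: bexI[of _ x0])
  define d where "d = a1 * (c + e) + a2 * (c + e) - a1 * f x0 - a2 * g x0"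
  have d: "d \<le> a1 * r + a2 * r'" if "0 \<le> r" "0 \<le> r'" for r r'
    using sep[OF up[OF that]] by (simp add: d_def algebra_simps)
  have pos: "0 \<le> y" if "\<And>r. 0 \<le> r \<Longrightarrow> d \<le> y * r" for y
  proof (rule ccontr)
    assume "\<not> 0 \<le> y"
    then have "y < 0" by simp
    have "d \<le> y * ((\<bar>d\<bar> + 1) / - y)" using \<open>y < 0\<close> by (intro that) (simp add: divide_nonneg_neg)
    also have "\<dots> = - (\<bar>d\<bar> + 1)" using \<open>y < 0\<close> by simp
    finally show False by simp
  qed
  have a1: "0 \<le> a1" by (rule pos) (use d[of _ 0] in simp)
  have a2: "0 \<le> a2" by (rule pos) (use d[of 0] in simp)
  have sum: "0 < a1 + a2" using a(1) a1 a2 by (auto simp: a12 zero_prod_def)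
  \<comment> \<open>The second coefficient of the separating functional, scaled to total weight
    \<open>1\<close>, is the parameter to try.\<close>
  obtain x where x: "x \<in> K" "(1 - a2 / (a1 + a2)) * f x + a2 / (a1 + a2) * g x \<le> c"
    using ex[of "a2 / (a1 + a2)"] a1 a2 sum by auto
  have "1 - a2 / (a1 + a2) = a1 / (a1 + a2)" using sum by (simp add: field_simps)
  then have "(a1 * f x + a2 * g x) / (a1 + a2) \<le> c" using x(2) by (simp add: add_divide_distrib)
  then have "a1 * f x + a2 * g x \<le> c * (a1 + a2)" using sum by (simp add: pos_divide_le_eq)
  moreover have "a1 * (c + e) + a2 * (c + e) \<le> a1 * f x + a2 * g x"
    using x(1) by (intro sep) (auto simp: W_def)
  moreover have "0 < e * (a1 + a2)" using e sum by simp
  ultimately show False by (simp add: algebra_simps)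
qed

text \<open>By induction, the new function is turned into a constraint on the domain. The hypothesis
  about averages on the smaller domain is the case of two functions: the new one and an average of
  the old ones.\<close>

lemma minimax_finite:
  fixes f :: "'w \<Rightarrow> 's \<Rightarrow> real"
  assumes "finite \<Omega>" "\<Omega> \<noteq> {}"
    and "\<And>x y t. x \<in> K \<Longrightarrow> y \<in> K \<Longrightarrow> 0 \<le> t \<Longrightarrow> t \<le> 1 \<Longrightarrow>
      \<exists>z\<in>K. \<forall>\<omega>\<in>\<Omega>. f \<omega> z \<le> (1 - t) * f \<omega> x + t * f \<omega> y"
    and "\<And>\<mu>. (\<forall>\<omega>\<in>\<Omega>. 0 \<le> \<mu> \<omega>) \<Longrightarrow> (\<Sum>\<omega>\<in>\<Omega>. \<mu> \<omega>) = 1 \<Longrightarrow> \<exists>x\<in>K. (\<Sum>\<omega>\<in>\<Omega>. \<mu> \<omega> * f \<omega> x) \<le> c"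
    and "0 < e"
  shows "\<exists>x\<in>K. \<forall>\<omega>\<in>\<Omega>. f \<omega> x \<le> c + e"
  using assms
proof (induction \<Omega> arbitrary: K c e rule: finite_ne_induct)
  case (singleton \<omega>)
  have "\<exists>x\<in>K. (\<Sum>\<nu>\<in>{\<omega>}. 1 * f \<nu> x) \<le> c" by (rule singleton(2)) simp_all
  then obtain x where "x \<in> K" "f \<omega> x \<le> c" by auto
  then show ?case using singleton(3) by (intro bexI[of _ x]) auto
next
  case (insert \<omega> \<Omega>)
  note mix = insert.prems(1) and ex = insert.prems(2) and e = insert.prems(3)
  have e2: "0 < e / 2" using e by simp
  \<comment> \<open>Half of the slack is spent on the new function, the other half is left for the
    induction hypothesis.\<close>
  define K' where "K' = {x \<in> K. f \<omega> x \<le> c + e / 2}"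
  have "\<exists>x\<in>K'. \<forall>\<omega>\<in>\<Omega>. f \<omega> x \<le> (c + e / 2) + e / 2"
  proof (rule insert.IH[OF _ _ e2])
    fix x y and t :: real assume x: "x \<in> K'" and y: "y \<in> K'" and t: "0 \<le> t" "t \<le> 1"
    then obtain z where z: "z \<in> K" "\<And>\<nu>. \<nu> \<in> insert \<omega> \<Omega> \<Longrightarrow> f \<nu> z \<le> (1 - t) * f \<nu> x + t * f \<nu> y"
      using mix[of x y t] by (auto simp: K'_def)
    have "f \<omega> z \<le> (1 - t) * f \<omega> x + t * f \<omega> y" using z(2) by simp
    also have "\<dots> \<le> (1 - t) * (c + e / 2) + t * (c + e / 2)"
      using x y t by (intro add_mono mult_left_mono) (auto simp: K'_def)
    also have "\<dots> = c + e / 2" by (simp only: left_diff_distrib) simp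
    finally have "z \<in> K'" using z(1) by (simp add: K'_def)
    then show "\<exists>z\<in>K'. \<forall>\<omega>\<in>\<Omega>. f \<omega> z \<le> (1 - t) * f \<omega> x + t * f \<omega> y" using z(2) by blast
  next
    fix \<mu> :: "'w \<Rightarrow> real" assume \<mu>: "\<forall>\<omega>\<in>\<Omega>. 0 \<le> \<mu> \<omega>" "(\<Sum>\<omega>\<in>\<Omega>. \<mu> \<omega>) = 1"
    have "\<exists>x\<in>K. (\<Sum>\<omega>\<in>\<Omega>. \<mu> \<omega> * f \<omega> x) \<le> c + e / 2 \<and> f \<omega> x \<le> c + e / 2"
    proof (rule minimax_two[OF _ _ e2])
      fix x y and t :: real assume "x \<in> K" "y \<in> K" and t: "0 \<le> t" "t \<le> 1"
      then obtain z where z: "z \<in> K" "\<And>\<nu>. \<nu> \<in> insert \<omega> \<Omega> \<Longrightarrow> f \<nu> z \<le> (1 - t) * f \<nu> x + t * f \<nu> y"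
        using mix[of x y t] by blast
      have "(\<Sum>\<nu>\<in>\<Omega>. \<mu> \<nu> * f \<nu> z) \<le> (\<Sum>\<nu>\<in>\<Omega>. \<mu> \<nu> * ((1 - t) * f \<nu> x + t * f \<nu> y))"
        using \<mu>(1) z(2) by (intro sum_mono mult_left_mono) auto
      also have "\<dots> = (1 - t) * (\<Sum>\<nu>\<in>\<Omega>. \<mu> \<nu> * f \<nu> x) + t * (\<Sum>\<nu>\<in>\<Omega>. \<mu> \<nu> * f \<nu> y)"
        unfolding sum_distrib_left sum.distrib[symmetric] by (intro sum.cong refl) (simp add: algebra_simps)
      finally show "\<exists>z\<in>K. (\<Sum>\<nu>\<in>\<Omega>. \<mu> \<nu> * f \<nu> z) \<le> (1 - t) * (\<Sum>\<nu>\<in>\<Omega>. \<mu> \<nu> * f \<nu> x) + t * (\<Sum>\<nu>\<in>\<Omega>. \<mu> \<nu> * f \<nu> y)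
          \<and> f \<omega> z \<le> (1 - t) * f \<omega> x + t * f \<omega> y"
        using z by (intro bexI[of _ z]) auto
    next
      fix t :: real assume t: "0 \<le> t" "t \<le> 1"
      define \<mu>' where "\<mu>' \<nu> = (if \<nu> = \<omega> then t else (1 - t) * \<mu> \<nu>)" for \<nu>
      have ne: "\<And>\<nu>. \<nu> \<in> \<Omega> \<Longrightarrow> \<nu> \<noteq> \<omega>" using insert.hyps(3) by blast
      have s: "(\<Sum>\<nu>\<in>insert \<omega> \<Omega>. \<mu>' \<nu> * q \<nu>) = t * q \<omega> + (1 - t) * (\<Sum>\<nu>\<in>\<Omega>. \<mu> \<nu> * q \<nu>)" for q
      proof -
        have "(\<Sum>\<nu>\<in>\<Omega>. \<mu>' \<nu> * q \<nu>) = (\<Sum>\<nu>\<in>\<Omega>. (1 - t) * (\<mu> \<nu> * q \<nu>))"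
          by (intro sum.cong refl) (simp add: \<mu>'_def ne)
        then show ?thesis using insert.hyps by (simp add: \<mu>'_def sum_distrib_left)
      qed
      have "\<forall>\<nu>\<in>insert \<omega> \<Omega>. 0 \<le> \<mu>' \<nu>" using \<mu>(1) t by (simp add: \<mu>'_def)
      moreover have "(\<Sum>\<nu>\<in>insert \<omega> \<Omega>. \<mu>' \<nu>) = 1" using s[of "\<lambda>_. 1"] \<mu>(2) by simp
      ultimately obtain x where "x \<in> K" "(\<Sum>\<nu>\<in>insert \<omega> \<Omega>. \<mu>' \<nu> * f \<nu> x) \<le> c" using ex by blast
      then show "\<exists>x\<in>K. (1 - t) * (\<Sum>\<nu>\<in>\<Omega>. \<mu> \<nu> * f \<nu> x) + t * f \<omega> x \<le> c"
        unfolding s by (intro bexI[of _ x]) (simp_all add: add.commute)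
    qed
    then show "\<exists>x\<in>K'. (\<Sum>\<omega>\<in>\<Omega>. \<mu> \<omega> * f \<omega> x) \<le> c + e / 2" unfolding K'_def by blast
  qed
  then obtain x where "x \<in> K'" and x: "\<forall>\<omega>\<in>\<Omega>. f \<omega> x \<le> (c + e / 2) + e / 2" by blast
  then have "x \<in> K" "f \<omega> x \<le> c + e / 2" unfolding K'_def by simp_all
  then show ?case using x e2 by (intro bexI[of _ x]) auto
qed

text \<open>Affine in the form \<open>s\<close>, these functionals detect domination: optimising over multiples of \<open>z\<close> turns the
  bound \<open>c\<^sup>2\<close> on the excess into the quadratic inequality that defines domination.\<close>

type_synonym ('h, 'k) excess_test =
  "nat \<times> nat \<times> (nat \<Rightarrow> 'k) \<times> (nat \<Rightarrow> 'k) \<times> (nat \<Rightarrow> nat \<Rightarrow> 'h \<Rightarrow>\<^sub>L 'h)"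

definition excess :: "(('h::chilbert_space \<Rightarrow>\<^sub>L 'h) \<Rightarrow> ('k::chilbert_space \<Rightarrow>\<^sub>L 'k)) \<Rightarrow> ('h, 'k) excess_test \<Rightarrow>
    (('h \<Rightarrow>\<^sub>L 'h) \<Rightarrow> ('h \<Rightarrow>\<^sub>L 'h) \<Rightarrow> complex) \<Rightarrow> real"
  where "excess u = (\<lambda>(m, m', h, h', z) s.
    2 * Re (\<Sum>k<m'. \<Sum>l<m. cinner (u (z k l) (h l)) (h' k)) - (\<Sum>k<m'. \<Sum>l<m. Re (s (z k l) (z k l))))"

definition excess_tests :: "('h::chilbert_space \<Rightarrow>\<^sub>L 'h) set \<Rightarrow> ('h, 'k::chilbert_space) excess_test set"
  where "excess_tests E = {(m, m', h, h', z). (\<forall>k<m'. \<forall>l<m. z k l \<in> E) \<and>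
    gram_square m h \<le> 1 \<and> gram_square m' h' \<le> 1}"

lemma continuous_on_excess: "continuous_on UNIV (\<lambda>w. excess u \<omega> (\<lambda>x y. w (x, y)))"
  unfolding excess_def case_prod_unfold
  by (intro continuous_intros continuous_on_product_coordinates)

text \<open>Domination bounds the pairing by \<open>c * sqrt ?Q\<close>, and
  \<open>2 * (c * sqrt ?Q)\<close> is at most \<open>c\<^sup>2 + ?Q\<close>.\<close>

lemma excess_le_of_oh_dominated:
  assumes dom: "oh_dominated E u c s" and c: "0 \<le> c" and s: "oh_form E s" and \<omega>: "\<omega> \<in> excess_tests E"
  shows "excess u \<omega> s \<le> c\<^sup>2"
proof -
  obtain m m' h h' z where w: "\<omega> = (m, m', h, h', z)" by (cases \<omega>) auto
  have z: "\<And>k l. k < m' \<Longrightarrow> l < m \<Longrightarrow> z k l \<in> E" and g: "gram_square m h \<le> 1" "gram_square m' h' \<le> 1"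
    using \<omega> by (auto simp: excess_tests_def w)
  let ?S = "\<Sum>k<m'. \<Sum>l<m. cinner (u (z k l) (h l)) (h' k)" and ?Q = "\<Sum>k<m'. \<Sum>l<m. Re (s (z k l) (z k l))"
  have Q0: "0 \<le> ?Q" using s z     by (intro sum_nonneg psd_form_nonneg[of E]) (simp_all add: oh_form_def)
  have "(cmod ?S)\<^sup>2 \<le> c\<^sup>2 * sqrt (gram_square m h * gram_square m' h') * ?Q" by (rule oh_dominatedD[OF dom z])
  also have "\<dots> \<le> c\<^sup>2 * 1 * ?Q"
  proof (intro mult_right_mono mult_left_mono Q0)
    have "gram_square m h * gram_square m' h' \<le> 1 * 1" by (intro mult_mono g gram_square_nonneg) simp
    then show "sqrt (gram_square m h * gram_square m' h') \<le> 1" by simp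
  qed simp
  finally have "(cmod ?S)\<^sup>2 \<le> (c * sqrt ?Q)\<^sup>2" using Q0 by (simp add: power_mult_distrib)
  then have "cmod ?S \<le> c * sqrt ?Q" by (rule power2_le_imp_le) (simp add: c Q0)
  moreover have "Re ?S \<le> cmod ?S" by (rule complex_Re_le_cmod)
  moreover have "0 \<le> (c - sqrt ?Q)\<^sup>2" by simp
  then have "2 * (c * sqrt ?Q) \<le> c\<^sup>2 + ?Q" using Q0 by (simp add: power2_diff)
  ultimately show ?thesis unfolding w excess_def by simp
qed

lemma gram_square_scale: "gram_square m (\<lambda>l. of_real r *\<^sub>C h l) = r ^ 4 * gram_square m h"
  unfolding gram_square_def sum_distrib_left
  by (simp add: cinner_scaleC_left cinner_scaleC_right norm_mult power_mult_distrib flip: power_add mult.assoc)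

text \<open>The left side of \<open>le\<close> is largest at \<open>r = 1 / q\<close>; for
  \<open>q = 0\<close> it is unbounded unless \<open>a = 0\<close>.\<close>

lemma quadratic_bound:
  fixes a q C :: real
  assumes le: "\<And>r. 2 * r * a - r\<^sup>2 * a * q \<le> C" and "0 \<le> a" "0 \<le> q"
  shows "a \<le> C * q"
proof (cases "q = 0")
  case True
  have C: "0 \<le> C" using le[of 0] by simp
  have "a = 0"
  proof (rule ccontr)
    assume "a \<noteq> 0"
    then have "2 * ((C + 1) / a) * a - ((C + 1) / a)\<^sup>2 * a * q = 2 * (C + 1)" using True by simp
    then have "2 * (C + 1) \<le> C" using le[of "(C + 1) / a"] by (simp only:)
    then show False using C by simp
  qed
  then show ?thesis using True by simp
next
  case False
  then have "0 < q" using assms by simp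
  then have "2 * (1 / q) * a - (1 / q)\<^sup>2 * a * q = a / q" by (simp add: power2_eq_square)
  then have "a / q \<le> C" using le[of "1 / q"] by simp
  then show ?thesis using \<open>0 < q\<close> by (simp add: pos_divide_le_eq)
qed

lemma oh_dominated_of_excess_le:
  fixes E :: "('h::chilbert_space \<Rightarrow>\<^sub>L 'h) set" and F :: "('k::chilbert_space \<Rightarrow>\<^sub>L 'k) set"
  assumes E: "operator_space E" and F: "operator_space F" and u: "clinear_between E F u"
    and s: "oh_form E s" and le: "\<And>\<omega>. \<omega> \<in> excess_tests E \<Longrightarrow> excess u \<omega> s \<le> c\<^sup>2"
  shows "oh_dominated E u c s"
  unfolding oh_dominated_def
proof (intro allI impI)
  note Es = operator_space_subspace[OF E]
  have psd: "psd_form E s" using s by (simp add: oh_form_def)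
  fix m m' :: nat and h h' :: "nat \<Rightarrow> 'k" and z assume zE: "\<forall>k<m'. \<forall>l<m. z k l \<in> E"
  let ?S = "\<lambda>h h'. \<Sum>k<m'. \<Sum>l<m. cinner (u (z k l) (h l)) (h' k)" and ?Q = "\<Sum>k<m'. \<Sum>l<m. Re (s (z k l) (z k l))"
  have Q0: "0 \<le> ?Q" using zE by (intro sum_nonneg psd_form_nonneg[OF psd]) simp
  have norm1: "(cmod (?S h h'))\<^sup>2 \<le> c\<^sup>2 * ?Q" if g: "gram_square m h \<le> 1" "gram_square m' h' \<le> 1" for h h'
  proof -
    let ?s = "?S h h'"
    have main: "2 * r * (cmod ?s)\<^sup>2 - r\<^sup>2 * (cmod ?s)\<^sup>2 * ?Q \<le> c\<^sup>2" for r :: real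
    proof -
      \<comment> \<open>The factor \<open>cnj ?s\<close> makes the pairing real and nonnegative up
        to the sign of \<open>r\<close>, so that varying \<open>r\<close> yields the hypothesis of
        \<open>quadratic_bound\<close> for \<open>a = (cmod ?s)\<^sup>2\<close>.\<close>
      define w where "w = of_real r * cnj ?s"
      have mem: "(m, m', h, h', \<lambda>k l. w *\<^sub>C z k l) \<in> excess_tests E"
        unfolding excess_tests_def using zE g by (auto intro: complex_vector.subspace_scale[OF Es])
      have 1: "(\<Sum>k<m'. \<Sum>l<m. cinner (u (w *\<^sub>C z k l) (h l)) (h' k)) = w * ?s"
        unfolding sum_distrib_left using zE
        by (intro sum.cong refl) (simp add: clinear_between_scale[OF u] scaleC_blinfun.rep_eq cinner_scaleC_left)
      have 2: "(\<Sum>k<m'. \<Sum>l<m. Re (s (w *\<^sub>C z k l) (w *\<^sub>C z k l))) = (cmod w)\<^sup>2 * ?Q"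
        unfolding sum_distrib_left
      proof (intro sum.cong refl)
        fix k l assume "k \<in> {..<m'}" "l \<in> {..<m}"
        then have zk: "z k l \<in> E" using zE by simp
        have "s (w *\<^sub>C z k l) (w *\<^sub>C z k l) = w * cnj w * s (z k l) (z k l)"
          using psd_form_scale[OF psd zk complex_vector.subspace_scale[OF Es zk], of w w]
            psd_form_right(2)[OF psd Es zk zk zk, of w] by simp
        also have "w * cnj w = of_real ((cmod w)\<^sup>2)" by (simp only: complex_norm_square)
        finally show "Re (s (w *\<^sub>C z k l) (w *\<^sub>C z k l)) = (cmod w)\<^sup>2 * Re (s (z k l) (z k l))" by simp
      qed
      have ws: "w * ?s = of_real (r * (cmod ?s)\<^sup>2)"
      proof -
        have "?s * cnj ?s = of_real ((cmod ?s)\<^sup>2)" by (simp only: complex_norm_square)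
        then show ?thesis by (simp add: w_def mult.commute)
      qed
      have "2 * Re (w * ?s) - (cmod w)\<^sup>2 * ?Q \<le> c\<^sup>2"
        using le[OF mem] unfolding excess_def prod.case 1 2 .
      moreover have "(cmod w)\<^sup>2 = r\<^sup>2 * (cmod ?s)\<^sup>2"         unfolding w_def norm_mult complex_mod_cnj by (simp add: power_mult_distrib)
      ultimately show ?thesis unfolding ws Re_complex_of_real by simp
    qed
    show ?thesis by (rule quadratic_bound[OF main _ Q0]) simp
  qed
  \<comment> \<open>A family with Gram square \<open>0\<close> cannot be normalized, but it
    vanishes.\<close>
  have zero: "h l = 0" if "gram_square m h = 0" "l < m" for m l and h :: "nat \<Rightarrow> 'k"
  proof -
    have "(\<Sum>l'<m. (cmod (cinner (h l) (h l')))\<^sup>2) = 0"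
      using that unfolding gram_square_def by (subst (asm) sum_nonneg_eq_0_iff) (auto intro!: sum_nonneg)
    then have "(cmod (cinner (h l) (h l)))\<^sup>2 = 0"
      using that(2) by (subst (asm) sum_nonneg_eq_0_iff) auto
    then show ?thesis by (simp add: cinner_self)
  qed
  show "(cmod (?S h h'))\<^sup>2 \<le> c\<^sup>2 * sqrt (gram_square m h * gram_square m' h') * ?Q"
  proof (cases "gram_square m h = 0 \<or> gram_square m' h' = 0")
    case True
    then have "?S h h' = 0"
      by (intro sum.neutral ballI) (auto simp: zero blinfun.zero_right)
    then show ?thesis using Q0 by (simp add: gram_square_nonneg)
  next
    case False
    define G G' where "G = gram_square m h" and "G' = gram_square m' h'"
    have G: "0 < G" "0 < G'" using False gram_square_nonneg[of m h] gram_square_nonneg[of m' h'] by (auto simp: G_def G'_def)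
    \<comment> \<open>The Gram square is homogeneous of degree four, hence the fourth roots.\<close>
    define r r' where "r = 1 / sqrt (sqrt G)" and "r' = 1 / sqrt (sqrt G')"
    have p4: "(1 / sqrt (sqrt x)) ^ 4 * x = 1" "(1 / sqrt (sqrt x))\<^sup>2 = 1 / sqrt x" if "0 < x" for x
    proof -
      show 2: "(1 / sqrt (sqrt x))\<^sup>2 = 1 / sqrt x" using that by (simp add: power_divide)
      have "(1 / sqrt (sqrt x)) ^ 4 = ((1 / sqrt (sqrt x))\<^sup>2)\<^sup>2" by simp
      also have "\<dots> = 1 / x" unfolding 2 using that by (simp add: power_divide)
      finally show "(1 / sqrt (sqrt x)) ^ 4 * x = 1" using that by simp
    qed
    have "gram_square m (\<lambda>l. of_real r *\<^sub>C h l) \<le> 1" "gram_square m' (\<lambda>l. of_real r' *\<^sub>C h' l) \<le> 1"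
      unfolding gram_square_scale r_def r'_def G_def[symmetric] G'_def[symmetric] by (simp_all only: p4(1)[OF G(1)] p4(1)[OF G(2)] order.refl)
    then have "(cmod (?S (\<lambda>l. of_real r *\<^sub>C h l) (\<lambda>l. of_real r' *\<^sub>C h' l)))\<^sup>2 \<le> c\<^sup>2 * ?Q" by (rule norm1)
    also have "?S (\<lambda>l. of_real r *\<^sub>C h l) (\<lambda>l. of_real r' *\<^sub>C h' l) = of_real (r * r') * ?S h h'"
      unfolding sum_distrib_left
    proof (intro sum.cong refl)
      fix k l assume "k \<in> {..<m'}" "l \<in> {..<m}"
      then have "u (z k l) \<in> bounded_operators"
        using zE clinear_between_mem[OF u] operator_space_bounded[OF F] by auto
      then show "cinner (u (z k l) (of_real r *\<^sub>C h l)) (of_real r' *\<^sub>C h' k) = of_real (r * r') * cinner (u (z k l) (h l)) (h' k)"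
        by (simp add: bounded_operatorsD cinner_scaleC_left cinner_scaleC_right)
    qed
    also have "(cmod \<dots>)\<^sup>2 = (r\<^sup>2 * r'\<^sup>2) * (cmod (?S h h'))\<^sup>2"
      by (simp add: norm_mult power_mult_distrib)
    also have "r\<^sup>2 * r'\<^sup>2 = 1 / sqrt (G * G')" unfolding r_def r'_def by (simp add: p4 G real_sqrt_mult)
    finally have "(cmod (?S h h'))\<^sup>2 / sqrt (G * G') \<le> c\<^sup>2 * ?Q" by simp
    moreover have "0 < sqrt (G * G')" using G by simp
    ultimately have "(cmod (?S h h'))\<^sup>2 \<le> c\<^sup>2 * ?Q * sqrt (G * G')" by (simp add: pos_divide_le_eq)
    then show ?thesis by (simp add: G_def G'_def mult_ac)
  qed
qed

section \<open>Hilbert--Schmidt maps on square summable sequences\<close>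

lemma hilbert_schmidt_sum_le:
  assumes "hilbert_schmidt A" "finite J"
  shows "(\<Sum>i\<in>J. (norm (A (ell2_basis i)))\<^sup>2) \<le> (hs_norm A)\<^sup>2"
proof -
  have s: "(\<lambda>i. (norm (A (ell2_basis i)))\<^sup>2) summable_on UNIV" using assms(1) by (simp add: hilbert_schmidt_def)
  have "(hs_norm A)\<^sup>2 = (\<Sum>\<^sub>\<infinity>i. (norm (A (ell2_basis i)))\<^sup>2)" unfolding hs_norm_def by (simp add: infsum_nonneg)
  then show ?thesis using finite_sum_le_infsum[OF s assms(2)] by simp
qed

lemma hs_norm_nonneg: "0 \<le> hs_norm A"
  unfolding hs_norm_def by (simp add: infsum_nonneg)

lemma hilbert_schmidtI:
  assumes A: "bounded_clinear_between UNIV UNIV A" and c: "0 \<le> c"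
    and le: "\<And>J. finite J \<Longrightarrow> (\<Sum>i\<in>J. (norm (A (ell2_basis i)))\<^sup>2) \<le> c\<^sup>2"
  shows "hilbert_schmidt A" and "hs_norm A \<le> c"
proof -
  have s: "(\<lambda>i. (norm (A (ell2_basis i)))\<^sup>2) summable_on UNIV"
    using le by (intro nonneg_bdd_above_summable_on bdd_aboveI2) auto
  then show "hilbert_schmidt A" using A by (simp add: hilbert_schmidt_def)
  have "(\<Sum>\<^sub>\<infinity>i. (norm (A (ell2_basis i)))\<^sup>2) \<le> c\<^sup>2" by (intro infsum_le_finite_sums s le)
  then show "hs_norm A \<le> c" unfolding hs_norm_def using c by (simp add: real_le_lsqrt)
qed

lemma bounded_clinear_betweenD:
  assumes "bounded_clinear_between E F u"
  shows "clinear_between E F u" "\<exists>K. \<forall>x\<in>E. norm (u x) \<le> K * norm x"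
  using assms unfolding bounded_clinear_between_def by auto

text \<open>Trace duality. The functional with index \<open>d\<close> reads off the coordinate
  \<open>\<beta> d\<close> of the image; as these coordinates are distinct, their squares sum to at
  most the squared norm of the image.\<close>

lemma hilbert_schmidt_test:
  fixes A :: "'i ell2 \<Rightarrow> 'j ell2"
  assumes A: "hilbert_schmidt A" and D: "finite D" and \<beta>: "inj_on \<beta> D"
  shows "cmod (\<Sum>d\<in>D. ell2_nth (A (\<eta> d)) (\<beta> d)) \<le> hs_norm A * sqrt (\<Sum>d\<in>D. (norm (\<eta> d))\<^sup>2)"
proof (rule bounded_functional_family_le[where I=UNIV and \<phi>="\<lambda>d x. ell2_nth (A x) (\<beta> d)", OF D])
  have lin: "clinear_between UNIV UNIV A" and "\<exists>K. \<forall>x\<in>UNIV. norm (A x) \<le> K * norm x"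
    using A bounded_clinear_betweenD[of UNIV UNIV A] by (simp_all add: hilbert_schmidt_def)
  then obtain K where K: "\<And>x. norm (A x) \<le> K * norm x" by blast
  show "ell2_nth (A (x + y)) (\<beta> d) = ell2_nth (A x) (\<beta> d) + ell2_nth (A y) (\<beta> d)" for d x y
    by (simp add: clinear_between_add[OF lin])
  show "ell2_nth (A (a *\<^sub>C x)) (\<beta> d) = a * ell2_nth (A x) (\<beta> d)" for d a x
    by (simp add: clinear_between_scale[OF lin])
  show "\<exists>b. \<forall>x\<in>ell2_space UNIV. cmod (ell2_nth (A x) (\<beta> d)) \<le> b * norm x" for d
  proof (intro exI ballI)
    fix x show "cmod (ell2_nth (A x) (\<beta> d)) \<le> K * norm x"
      using cmod_ell2_nth_le[of "A x" "\<beta> d"] K[of x] by linarith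
  qed
  show "(\<Sum>i\<in>J. \<Sum>d\<in>D. (cmod (ell2_nth (A (ell2_basis i)) (\<beta> d)))\<^sup>2) \<le> (hs_norm A)\<^sup>2" if J: "finite J" for J
  proof -
    have "(\<Sum>d\<in>D. (cmod (ell2_nth (A (ell2_basis i)) (\<beta> d)))\<^sup>2) \<le> (norm (A (ell2_basis i)))\<^sup>2" for i
    proof -
      have "(\<Sum>d\<in>D. (cmod (ell2_nth (A (ell2_basis i)) (\<beta> d)))\<^sup>2) = (\<Sum>j\<in>\<beta> ` D. (cmod (ell2_nth (A (ell2_basis i)) j))\<^sup>2)"
        using \<beta> by (simp add: sum.reindex)
      also have "\<dots> \<le> (norm (A (ell2_basis i)))\<^sup>2" by (rule sum_ell2_nth_le) (simp add: D)
      finally show ?thesis .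
    qed
    then have "(\<Sum>i\<in>J. \<Sum>d\<in>D. (cmod (ell2_nth (A (ell2_basis i)) (\<beta> d)))\<^sup>2) \<le> (\<Sum>i\<in>J. (norm (A (ell2_basis i)))\<^sup>2)"
      by (rule sum_mono)
    also have "\<dots> \<le> (hs_norm A)\<^sup>2" by (rule hilbert_schmidt_sum_le[OF A J])
    finally show ?thesis .
  qed
qed (simp_all add: hs_norm_nonneg ell2_space_def)

text \<open>A partial relabelling can omit coordinates of the source and leave coordinates of the
  target zero. Injectivity where it is defined makes it a contraction.\<close>

lemma ell2_relabelling:
  fixes \<tau> :: "'b \<Rightarrow> 'a option"
  assumes inj: "\<And>i i' j. \<tau> i = Some j \<Longrightarrow> \<tau> i' = Some j \<Longrightarrow> i = i'"
  obtains T :: "'a ell2 \<Rightarrow> 'b ell2"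
  where "\<And>f i. ell2_nth (T f) i = (case \<tau> i of None \<Rightarrow> 0 | Some j \<Rightarrow> ell2_nth f j)"
    "clinear_between UNIV UNIV T" "\<And>f. norm (T f) \<le> norm f"
proof -
  let ?t = "\<lambda>f i. case \<tau> i of None \<Rightarrow> 0 | Some j \<Rightarrow> ell2_nth f j"
  have le: "(\<Sum>i\<in>J. (cmod (?t f i))\<^sup>2) \<le> (norm f)\<^sup>2" if J: "finite J" for J f
  proof -
    let ?J = "{i\<in>J. \<tau> i \<noteq> None}"
    have "(\<Sum>i\<in>J. (cmod (?t f i))\<^sup>2) = (\<Sum>i\<in>?J. (cmod (?t f i))\<^sup>2)"
      using J by (intro sum.mono_neutral_right) (auto split: option.splits)
    also have "\<dots> = (\<Sum>i\<in>?J. (cmod (ell2_nth f (the (\<tau> i))))\<^sup>2)"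
      by (intro sum.cong refl) auto
    also have "\<dots> = (\<Sum>j\<in>(\<lambda>i. the (\<tau> i)) ` ?J. (cmod (ell2_nth f j))\<^sup>2)"
    proof -
      have "inj_on (\<lambda>i. the (\<tau> i)) ?J" using inj by (intro inj_onI) auto
      then show ?thesis by (simp add: sum.reindex)
    qed
    also have "\<dots> \<le> (norm f)\<^sup>2" using J by (intro sum_ell2_nth_le) simp
    finally show ?thesis .
  qed
  define T where "T f = Abs_ell2 (?t f)" for f
  have nth: "ell2_nth (T f) i = ?t f i" for f i
  proof -
    have "(\<lambda>i. (cmod (?t f i))\<^sup>2) summable_on UNIV"
      using le by (intro nonneg_bdd_above_summable_on bdd_aboveI2) auto
    then have "ell2_nth (T f) = ?t f" unfolding T_def by (intro Abs_ell2_inverse) simp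
    then show ?thesis by simp
  qed
  have "clinear_between UNIV UNIV T"
    unfolding clinear_between_def by (auto intro!: ell2_eqI simp: nth split: option.splits)
  moreover have "norm (T f) \<le> norm f" for f
  proof (rule norm_ell2_le)
    fix J :: "'b set" assume "finite J"
    from le[OF this] show "L2_set (\<lambda>i. cmod (ell2_nth (T f) i)) J \<le> norm f"
      unfolding L2_set_def nth by (intro real_le_lsqrt) (auto intro: sum_nonneg)
  qed
  ultimately show thesis using nth that by blast
qed

text \<open>Only countably many basis vectors have a nonzero image, so the index set can be replaced by the
  natural numbers.\<close>

lemma separable_reduction:
  fixes A :: "'i ell2 \<Rightarrow> nat ell2" and B :: "('h::chilbert_space \<Rightarrow>\<^sub>L 'h) \<Rightarrow> 'i ell2"
  assumes E: "operator_space E" and A: "bounded_clinear_between UNIV UNIV A" and c: "0 \<le> c"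
    and le: "\<And>J. finite J \<Longrightarrow> (\<Sum>i\<in>J. (norm (A (ell2_basis i)))\<^sup>2) \<le> c\<^sup>2"
    and B: "clinear_between E (ell2_space UNIV) B" and cb: "cb_bound (opsp E) (OH UNIV) B b"
  obtains B' :: "('h \<Rightarrow>\<^sub>L 'h) \<Rightarrow> nat ell2" and A' :: "nat ell2 \<Rightarrow> nat ell2"
  where "clinear_between E (ell2_space UNIV) B'" "cb_bound (opsp E) (OH UNIV) B' b"
    "hilbert_schmidt A'" "hs_norm A' \<le> c" "\<And>x. A' (B' x) = A (B x)"
proof -
  note Es = operator_space_subspace[OF E]
  have lin: "clinear_between UNIV UNIV A" using A by (rule bounded_clinear_betweenD)
  obtain K where K: "\<And>x. norm (A x) \<le> K * norm x" using bounded_clinear_betweenD(2)[OF A] by blast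
  define J0 where "J0 = {i. A (ell2_basis i) \<noteq> 0}"
  have "(\<lambda>i. (norm (A (ell2_basis i)))\<^sup>2) summable_on UNIV"
    using le by (intro nonneg_bdd_above_summable_on bdd_aboveI2) auto
  from summable_countable_real[OF this] have J0: "countable J0" by (simp add: J0_def)
  let ?n = "to_nat_on J0"
  have n_inj: "i = i'" if "i \<in> J0" "i' \<in> J0" "?n i = ?n i'" for i i'
    using inj_on_to_nat_on[OF J0] that unfolding inj_on_def by blast
  \<comment> \<open>\<open>W\<close> reads the coordinates in \<open>J0\<close> into a sequence and
    \<open>V\<close> puts them back. Their composition is the projection onto the coordinates in
    \<open>J0\<close>, the only ones that \<open>A\<close> sees.\<close>
  define \<tau> where "\<tau> i = (if i \<in> J0 then Some (?n i) else None)" for i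
  define \<sigma> where "\<sigma> n = (if n \<in> ?n ` J0 then Some (inv_into J0 ?n n) else None)" for n
  have \<tau>_inj: "\<tau> i = Some j \<Longrightarrow> \<tau> i' = Some j \<Longrightarrow> i = i'" for i i' j
    using n_inj unfolding \<tau>_def by (auto split: if_splits)
  have \<sigma>_inj: "\<sigma> i = Some j \<Longrightarrow> \<sigma> i' = Some j \<Longrightarrow> i = i'" for i i' j
    unfolding \<sigma>_def by (auto split: if_splits dest: inv_into_injective)
  obtain V :: "nat ell2 \<Rightarrow> 'i ell2" where V: "\<And>f i. ell2_nth (V f) i = (case \<tau> i of None \<Rightarrow> 0 | Some j \<Rightarrow> ell2_nth f j)"
    "clinear_between UNIV UNIV V" "\<And>f. norm (V f) \<le> norm f"
    by (rule ell2_relabelling[of \<tau>, OF \<tau>_inj]) (auto intro: that)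
  obtain W :: "'i ell2 \<Rightarrow> nat ell2" where W: "\<And>f i. ell2_nth (W f) i = (case \<sigma> i of None \<Rightarrow> 0 | Some j \<Rightarrow> ell2_nth f j)"
    "clinear_between UNIV UNIV W" "\<And>f. norm (W f) \<le> norm f"
    by (rule ell2_relabelling[of \<sigma>, OF \<sigma>_inj]) (auto intro: that)
  have \<sigma>\<tau>: "\<sigma> (?n i) = Some i" if "i \<in> J0" for i
    using that inv_into_f_f[OF inj_on_to_nat_on[OF J0] that] by (simp add: \<sigma>_def)
  have VW: "ell2_nth (V (W f)) i = (if i \<in> J0 then ell2_nth f i else 0)" for f i
    by (simp add: V(1) W(1) \<tau>_def \<sigma>\<tau>)
  have vanish: "A f = 0" if f: "\<And>i. i \<in> J0 \<Longrightarrow> ell2_nth f i = 0" for f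
  proof -
    let ?S = "\<lambda>J. \<Sum>i\<in>J. ell2_nth f i *\<^sub>C ell2_basis i"
    have z: "A (?S J) = 0" for J
    proof -
      have "A (?S J) = (\<Sum>i\<in>J. ell2_nth f i *\<^sub>C A (ell2_basis i))"
        by (rule clinear_between_sum[OF lin]) (simp_all add: complex_vector.subspace_UNIV)
      also have "\<dots> = 0"
      proof (rule sum.neutral, rule ballI)
        fix i
        show "ell2_nth f i *\<^sub>C A (ell2_basis i) = 0" using f[of i] by (cases "i \<in> J0") (simp_all add: J0_def)
      qed
      finally show ?thesis .
    qed
    have "norm (A f) \<le> K * norm (f - ?S J)" for J
    proof -
      have "A f = A (f - ?S J) + A (?S J)" using clinear_between_add[OF lin, of "f - ?S J" "?S J"] by simp
      then show ?thesis using K[of "f - ?S J"] by (simp add: z)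
    qed
    moreover have "((\<lambda>J. K * norm (f - ?S J)) \<longlongrightarrow> K * norm (f - f)) (finite_subsets_at_top UNIV)"
      by (intro tendsto_intros ell2_basis_expansion)
    ultimately have "norm (A f) \<le> K * norm (f - f)"
      by (intro tendsto_lowerbound[where f="\<lambda>J. K * norm (f - ?S J)" and F="finite_subsets_at_top UNIV"]) auto
    then show ?thesis by simp
  qed
  have AVW: "A (V (W f)) = A f" for f
  proof -
    have "A (f - V (W f)) = 0" by (rule vanish) (simp add: VW)
    moreover have "A f = A (f - V (W f)) + A (V (W f))"
      using clinear_between_add[OF lin, of "f - V (W f)" "V (W f)"] by simp
    ultimately show ?thesis by simp
  qed
  define A' where "A' f = A (V f)" for f
  define B' where "B' x = W (B x)" for x
  have A'_lin: "clinear_between UNIV UNIV A'"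
    unfolding clinear_between_def A'_def
    by (simp add: clinear_between_add[OF lin] clinear_between_scale[OF lin]
        clinear_between_add[OF V(2)] clinear_between_scale[OF V(2)])
  have "norm (A' f) \<le> \<bar>K\<bar> * norm f" for f
  proof -
    have "norm (A' f) \<le> K * norm (V f)" unfolding A'_def by (rule K)
    also have "\<dots> \<le> \<bar>K\<bar> * norm (V f)" by (intro mult_right_mono) auto
    also have "\<dots> \<le> \<bar>K\<bar> * norm f" by (intro mult_left_mono V(3)) simp
    finally show ?thesis .
  qed
  then have A'_bdd: "bounded_clinear_between UNIV UNIV A'"
    unfolding bounded_clinear_between_def using A'_lin by blast
  have V_basis: "V (ell2_basis n) = (case \<sigma> n of None \<Rightarrow> 0 | Some i \<Rightarrow> ell2_basis i)" for n
  proof (rule ell2_eqI)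
    fix i
    show "ell2_nth (V (ell2_basis n)) i = ell2_nth (case \<sigma> n of None \<Rightarrow> 0 | Some i \<Rightarrow> ell2_basis i) i"
    proof (cases "n \<in> ?n ` J0")
      case True
      then obtain j where j: "j \<in> J0" "n = ?n j" by blast
      then show ?thesis using n_inj[OF j(1), of i] by (auto simp: V(1) \<tau>_def \<sigma>\<tau> ell2_nth_basis)
    next
      case False
      then show ?thesis by (auto simp: V(1) \<tau>_def \<sigma>_def ell2_nth_basis)
    qed
  qed
  have A0: "A 0 = 0" using clinear_between_scale[OF lin, of 0 0] by simp
  have sum: "(\<Sum>n\<in>M. (norm (A' (ell2_basis n)))\<^sup>2) \<le> c\<^sup>2" if M: "finite M" for M
  proof -
    let ?M = "{n\<in>M. \<sigma> n \<noteq> None}"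
    have "(\<Sum>n\<in>M. (norm (A' (ell2_basis n)))\<^sup>2) = (\<Sum>n\<in>?M. (norm (A' (ell2_basis n)))\<^sup>2)"
      using M by (intro sum.mono_neutral_right) (auto simp: A'_def V_basis A0)
    also have "\<dots> = (\<Sum>n\<in>?M. (norm (A (ell2_basis (the (\<sigma> n)))))\<^sup>2)"
      by (intro sum.cong refl) (auto simp: A'_def V_basis)
    also have "\<dots> = (\<Sum>i\<in>(\<lambda>n. the (\<sigma> n)) ` ?M. (norm (A (ell2_basis i)))\<^sup>2)"
    proof -
      have "inj_on (\<lambda>n. the (\<sigma> n)) ?M" using \<sigma>_inj by (intro inj_onI) auto
      then show ?thesis by (simp add: sum.reindex)
    qed
    also have "\<dots> \<le> c\<^sup>2" using M by (intro le) simp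
    finally show ?thesis .
  qed
  have B'_lin: "clinear_between E (ell2_space UNIV) B'"
    unfolding clinear_between_def B'_def
    by (auto simp: clinear_between_add[OF B] clinear_between_scale[OF B]
        clinear_between_add[OF W(2)] clinear_between_scale[OF W(2)] ell2_space_def)
  have b: "0 \<le> b" using cb by (simp add: cb_bound_def)
  have cbB': "cb_bound (opsp E) (OH UNIV) B' b"
    unfolding cb_bound_def
  proof (intro conjI allI impI b)
    fix n :: nat and X assume X: "\<forall>i<n. \<forall>j<n. X i j \<in> carrier (opsp E)"
    let ?o = "oh_matrix_norm n (\<lambda>i j. B (X i j))"
    have "oh_test n (\<lambda>i j. B' (X i j)) ?o"
      unfolding oh_test_def
    proof (intro allI)
      fix m m' :: nat and g g'
      have "norm (compress n g g' (\<lambda>i j. B' (X i j)) k l) \<le> norm (compress n g g' (\<lambda>i j. B (X i j)) k l)" for k l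
        unfolding B'_def clinear_between_compress[OF W(2) complex_vector.subspace_UNIV, of n "\<lambda>i j. B (X i j)", simplified, symmetric]
        by (rule W(3))
      then have "(\<Sum>k<m'. \<Sum>l<m. (norm (compress n g g' (\<lambda>i j. B' (X i j)) k l))\<^sup>2)
          \<le> (\<Sum>k<m'. \<Sum>l<m. (norm (compress n g g' (\<lambda>i j. B (X i j)) k l))\<^sup>2)"
        by (intro sum_mono power_mono) auto
      also have "\<dots> \<le> ?o\<^sup>2 * sqrt (coef_gram n m g * coef_gram n m' g')"
        using oh_test_oh_matrix_norm[of n "\<lambda>i j. B (X i j)"] unfolding oh_test_def by simp
      finally show "(\<Sum>k<m'. \<Sum>l<m. (norm (compress n g g' (\<lambda>i j. B' (X i j)) k l))\<^sup>2)
          \<le> ?o\<^sup>2 * sqrt (coef_gram n m g * coef_gram n m' g')" .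
    qed
    then have "oh_matrix_norm n (\<lambda>i j. B' (X i j)) \<le> ?o" by (simp add: oh_matrix_norm_le_iff oh_matrix_norm_nonneg)
    also have "?o \<le> b * op_matrix_norm n X" using cb X by (simp add: cb_bound_def)
    finally show "matrix_norm (OH UNIV) n (\<lambda>i j. B' (X i j)) \<le> b * matrix_norm (opsp E) n X" by simp
  qed
  show thesis
    by (rule that[of B' A']) (simp_all add: B'_lin cbB' hilbert_schmidtI[OF A'_bdd c sum] A'_def B'_def AVW)
qed

section \<open>The equivalence\<close>

lemma oh_form_zero: "oh_form E (\<lambda>_ _. 0)"
  unfolding oh_form_def psd_form_def by (simp add: coef_gram_nonneg)

lemma oh_form_mix:
  assumes s: "oh_form E s" and s': "oh_form E s'" and t: "0 \<le> t" "t \<le> 1"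
  shows "oh_form E (\<lambda>x y. of_real (1 - t) * s x y + of_real t * s' x y)"
  unfolding oh_form_def
proof (intro conjI allI impI)
  fix x y
  have "cmod (of_real (1 - t) * s x y + of_real t * s' x y) \<le> (1 - t) * cmod (s x y) + t * cmod (s' x y)"
    using t by (intro order.trans[OF norm_triangle_ineq]) (simp add: norm_mult del: of_real_diff)
  also have "\<dots> \<le> (1 - t) * (norm x * norm y) + t * (norm x * norm y)"
    using s s' t unfolding oh_form_def by (intro add_mono mult_left_mono) auto
  also have "\<dots> = norm x * norm y" by (simp add: algebra_simps)
  finally show "cmod (of_real (1 - t) * s x y + of_real t * s' x y) \<le> norm x * norm y" .
next
  have p: "psd_form E s" "psd_form E s'" using s s' by (simp_all add: oh_form_def)
  show "psd_form E (\<lambda>x y. of_real (1 - t) * s x y + of_real t * s' x y)"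
    unfolding psd_form_def
  proof (intro conjI ballI allI)
    fix x y z assume "x \<in> E" "y \<in> E" "z \<in> E"
    then show "of_real (1 - t) * s (x + y) z + of_real t * s' (x + y) z
        = of_real (1 - t) * s x z + of_real t * s' x z + (of_real (1 - t) * s y z + of_real t * s' y z)"
      by (simp add: psd_form_add[OF p(1)] psd_form_add[OF p(2)] distrib_left)
  next
    fix c x z assume "x \<in> E" "z \<in> E"
    then have "s (c *\<^sub>C x) z = c * s x z" "s' (c *\<^sub>C x) z = c * s' x z"
      by (rule psd_form_scale[OF p(1)], rule psd_form_scale[OF p(2)])
    moreover have "a * (c * w) + b * (c * w') = c * (a * w + b * w')" for a b w w' :: complex
      by (simp add: algebra_simps)
    ultimately show "of_real (1 - t) * s (c *\<^sub>C x) z + of_real t * s' (c *\<^sub>C x) z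
        = c * (of_real (1 - t) * s x z + of_real t * s' x z)" by (simp only:)
  next
    fix x z assume "x \<in> E" "z \<in> E"
    then have "s x z = cnj (s z x)" "s' x z = cnj (s' z x)"
      by (rule psd_form_commute[OF p(1)], rule psd_form_commute[OF p(2)])
    then show "of_real (1 - t) * s x z + of_real t * s' x z = cnj (of_real (1 - t) * s z x + of_real t * s' z x)"
      by (simp only: complex_cnj_add complex_cnj_mult complex_cnj_complex_of_real)
  next
    fix x assume "x \<in> E"
    then show "0 \<le> Re (of_real (1 - t) * s x x + of_real t * s' x x)"
      using psd_form_nonneg[OF p(1)] psd_form_nonneg[OF p(2)] t by simp
  qed
next
  fix n m m' :: nat and X g g' assume X: "\<forall>i<n. \<forall>j<n. X i j \<in> E"
  let ?R = "(op_matrix_norm n X)\<^sup>2 * sqrt (coef_gram n m g * coef_gram n m' g')"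
  let ?S = "\<lambda>s. \<Sum>k<m'. \<Sum>l<m. Re (s (compress n g g' X k l) (compress n g g' X k l))"
  have "?S (\<lambda>x y. of_real (1 - t) * s x y + of_real t * s' x y) = (1 - t) * ?S s + t * ?S s'"
    by (simp add: sum.distrib sum_distrib_left)
  also have "\<dots> \<le> (1 - t) * ?R + t * ?R"
    using s s' t X unfolding oh_form_def by (intro add_mono mult_left_mono) auto
  also have "\<dots> = ?R" by (simp add: algebra_simps)
  finally show "?S (\<lambda>x y. of_real (1 - t) * s x y + of_real t * s' x y) \<le> ?R" .
qed

lemma excess_mix:
  "excess u \<omega> (\<lambda>x y. of_real (1 - t) * s x y + of_real t * s' x y) = (1 - t) * excess u \<omega> s + t * excess u \<omega> s'"
proof -
  obtain m m' h h' z where w: "\<omega> = (m, m', h, h', z)" by (cases \<omega>) auto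
  have "(\<Sum>k<m'. \<Sum>l<m. Re (of_real (1 - t) * s (z k l) (z k l) + of_real t * s' (z k l) (z k l)))
      = (1 - t) * (\<Sum>k<m'. \<Sum>l<m. Re (s (z k l) (z k l))) + t * (\<Sum>k<m'. \<Sum>l<m. Re (s' (z k l) (z k l)))"
    by (simp add: sum.distrib sum_distrib_left)
  then show ?thesis unfolding w excess_def prod.case by (simp only:) (simp add: algebra_simps)
qed

text \<open>The weighted coefficients \<open>\<langle>y h\<^sub>l, h'\<^sub>k\<rangle>\<close> of finitely many tests form a finite rank \<open>(2,oh)\<close>-summing map
  to \<open>\<ell>\<^sub>2\<close>. Factoring it through a Hilbert--Schmidt map yields a form that passes the average of the tests.\<close>

lemma form_for_weighted_tests:
  fixes E :: "('h::chilbert_space \<Rightarrow>\<^sub>L 'h) set" and F :: "('k::chilbert_space \<Rightarrow>\<^sub>L 'k) set"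
    and u :: "('h \<Rightarrow>\<^sub>L 'h) \<Rightarrow> ('k \<Rightarrow>\<^sub>L 'k)"
  assumes E: "operator_space E" and F: "operator_space F" and u: "clinear_between E F u"
    and fact: "\<And>v :: ('k \<Rightarrow>\<^sub>L 'k) \<Rightarrow> nat ell2. bounded_clinear_between F UNIV v \<Longrightarrow> two_oh_bound F v 1 \<Longrightarrow>
      \<exists>(B :: ('h \<Rightarrow>\<^sub>L 'h) \<Rightarrow> nat ell2) (A :: nat ell2 \<Rightarrow> nat ell2).
        completely_bounded (opsp E) (OH UNIV) B \<and> hilbert_schmidt A \<and>
        (\<forall>x\<in>E. v (u x) = A (B x)) \<and> hs_norm A * cb_norm (opsp E) (OH UNIV) B \<le> C"
    and \<Omega>: "finite \<Omega>" "\<Omega> \<subseteq> excess_tests E" and \<mu>: "\<forall>\<omega>\<in>\<Omega>. 0 \<le> \<mu> \<omega>" "(\<Sum>\<omega>\<in>\<Omega>. \<mu> \<omega>) = 1"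
  shows "\<exists>s. oh_form E s \<and> (\<Sum>\<omega>\<in>\<Omega>. \<mu> \<omega> * excess u \<omega> s) \<le> C\<^sup>2"
proof -
  define m m' where "m \<omega> = fst \<omega>" and "m' \<omega> = fst (snd \<omega>)" for \<omega> :: "('h, 'k) excess_test"
  define h h' where "h \<omega> = fst (snd (snd \<omega>))" and "h' \<omega> = fst (snd (snd (snd \<omega>)))" for \<omega> :: "('h, 'k) excess_test"
  define z where "z \<omega> = snd (snd (snd (snd \<omega>)))" for \<omega> :: "('h, 'k) excess_test"
  have zE: "z \<omega> k l \<in> E" if "\<omega> \<in> \<Omega>" "k < m' \<omega>" "l < m \<omega>" for \<omega> k l
    using that \<Omega>(2) by (auto simp: excess_tests_def m_def m'_def z_def)
  have G1: "gram_square (m \<omega>) (h \<omega>) \<le> 1" "gram_square (m' \<omega>) (h' \<omega>) \<le> 1" if "\<omega> \<in> \<Omega>" for \<omega>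
    using that \<Omega>(2) by (auto simp: excess_tests_def m_def m'_def h_def h'_def)
  have excess: "excess u \<omega> s = 2 * Re (\<Sum>k<m' \<omega>. \<Sum>l<m \<omega>. cinner (u (z \<omega> k l) (h \<omega> l)) (h' \<omega> k))
      - (\<Sum>k<m' \<omega>. \<Sum>l<m \<omega>. Re (s (z \<omega> k l) (z \<omega> k l)))" for \<omega> s
    unfolding excess_def case_prod_unfold m_def m'_def h_def h'_def z_def ..
  define D where "D = Sigma \<Omega> (\<lambda>\<omega>. {..<m' \<omega>} \<times> {..<m \<omega>})"
  have D: "finite D" unfolding D_def using \<Omega>(1) by auto
  have sumD: "(\<Sum>d\<in>D. g d) = (\<Sum>\<omega>\<in>\<Omega>. \<Sum>k<m' \<omega>. \<Sum>l<m \<omega>. g (\<omega>, k, l))" for g :: "_ \<Rightarrow> 'x::comm_monoid_add"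
  proof -
    have "(\<Sum>\<omega>\<in>\<Omega>. \<Sum>p\<in>{..<m' \<omega>} \<times> {..<m \<omega>}. g (\<omega>, p)) = (\<Sum>(\<omega>, p)\<in>D. g (\<omega>, p))"
      unfolding D_def by (rule sum.Sigma) (use \<Omega>(1) in auto)
    then show ?thesis by (simp only: sum.cartesian_product' case_prod_unfold prod.collapse)
  qed
  define Z where "Z d = z (fst d) (fst (snd d)) (snd (snd d))" for d
  have ZE: "Z d \<in> E" if "d \<in> D" for d using that zE by (auto simp: D_def Z_def)
  define \<psi> where "\<psi> d y = cinner (blinfun_apply y (h (fst d) (snd (snd d)))) (h' (fst d) (fst (snd d)))" for d y
  \<comment> \<open>Square roots, because the squared norm of \<open>v y\<close> is to be the
    weighted average of the forms.\<close>
  define r where "r d = sqrt (\<mu> (fst d))" for d :: "('h, 'k) excess_test \<times> nat \<times> nat"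
  have r: "0 \<le> r d" "(r d)\<^sup>2 = \<mu> (fst d)" if "d \<in> D" for d using that \<mu>(1) by (auto simp: D_def r_def)
  obtain \<beta> where "bij_betw \<beta> D {0..<card D}" using ex_bij_betw_finite_nat[OF D] by blast
  then have \<beta>: "inj_on \<beta> D" by (simp add: bij_betw_def)
  define v where "v y = (\<Sum>d\<in>D. (of_real (r d) * \<psi> d y) *\<^sub>C ell2_basis (\<beta> d))" for y :: "'k \<Rightarrow>\<^sub>L 'k"
  have v_nth: "ell2_nth (v y) (\<beta> d) = of_real (r d) * \<psi> d y" if d: "d \<in> D" for d y
  proof -
    have "ell2_nth (v y) (\<beta> d) = (\<Sum>d'\<in>D. if d' = d then of_real (r d) * \<psi> d y else 0)"
      unfolding v_def ell2_nth_sum using \<beta> d by (intro sum.cong refl) (auto simp: ell2_nth_basis inj_on_def)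
    then show ?thesis using d D by simp
  qed
  have v_norm: "(norm (v y))\<^sup>2 = (\<Sum>d\<in>D. \<mu> (fst d) * (cmod (\<psi> d y))\<^sup>2)" for y
  proof -
    have "(norm (v y))\<^sup>2 = (\<Sum>j\<in>\<beta> ` D. (cmod (ell2_nth (v y) j))\<^sup>2)"
    proof (rule norm_ell2_finite_support)
      fix j assume "j \<notin> \<beta> ` D"
      then show "ell2_nth (v y) j = 0" unfolding v_def ell2_nth_sum by (intro sum.neutral) (auto simp: ell2_nth_basis)
    qed (simp add: D)
    also have "\<dots> = (\<Sum>d\<in>D. (cmod (ell2_nth (v y) (\<beta> d)))\<^sup>2)" using \<beta> by (simp add: sum.reindex)
    also have "\<dots> = (\<Sum>d\<in>D. \<mu> (fst d) * (cmod (\<psi> d y))\<^sup>2)"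
      by (intro sum.cong refl) (simp add: v_nth norm_mult power_mult_distrib r)
    finally show ?thesis .
  qed
  have "clinear_between F UNIV v"
    unfolding clinear_between_def v_def \<psi>_def
    by (auto simp: blinfun.add_left cinner_add_left distrib_left scaleC_add_left sum.distrib
        scaleC_blinfun.rep_eq cinner_scaleC_left complex_vector.scale_sum_right scaleC_scaleC mult_ac)
  moreover have "\<exists>K. \<forall>y\<in>F. norm (v y) \<le> K * norm y"
  proof (intro exI ballI)
    fix y :: "'k \<Rightarrow>\<^sub>L 'k"
    have "norm (v y) \<le> (\<Sum>d\<in>D. norm (h (fst d) (snd (snd d))) * norm (h' (fst d) (fst (snd d))) * norm y * r d)"
      unfolding v_def
    proof (rule sum_norm_le)
      fix d assume d: "d \<in> D"
      have "cmod (\<psi> d y) \<le> norm (blinfun_apply y (h (fst d) (snd (snd d)))) * norm (h' (fst d) (fst (snd d)))"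
        unfolding \<psi>_def by (rule cinner_Cauchy_Schwarz)
      also have "\<dots> \<le> norm y * norm (h (fst d) (snd (snd d))) * norm (h' (fst d) (fst (snd d)))"
        by (intro mult_right_mono norm_blinfun) simp
      finally have "r d * cmod (\<psi> d y) \<le> r d * (norm y * norm (h (fst d) (snd (snd d))) * norm (h' (fst d) (fst (snd d))))"
        using r(1)[OF d] by (rule mult_left_mono)
      moreover have "norm (ell2_basis (\<beta> d)) = 1"
        by (simp add: norm_eq_sqrt_cinner cinner_ell2_basis ell2_nth_basis)
      ultimately show "norm ((of_real (r d) * \<psi> d y) *\<^sub>C ell2_basis (\<beta> d))
          \<le> norm (h (fst d) (snd (snd d))) * norm (h' (fst d) (fst (snd d))) * norm y * r d"
        using r(1)[OF d] by (simp add: norm_scaleC norm_mult mult_ac)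
    qed
    also have "\<dots> = (\<Sum>d\<in>D. norm (h (fst d) (snd (snd d))) * norm (h' (fst d) (fst (snd d))) * r d) * norm y"
      unfolding sum_distrib_right by (intro sum.cong refl) (simp add: mult_ac)
    finally show "norm (v y) \<le> (\<Sum>d\<in>D. norm (h (fst d) (snd (snd d))) * norm (h' (fst d) (fst (snd d))) * r d) * norm y" .
  qed
  ultimately have v: "bounded_clinear_between F UNIV v" unfolding bounded_clinear_between_def by blast
  have "two_oh_bound F v 1"
    unfolding two_oh_bound_def
  proof (intro conjI allI impI)
    fix n :: nat and x assume "\<forall>i<n. x i \<in> F"
    then have x: "x i \<in> bounded_operators" if "i \<in> {..<n}" for i using that operator_space_bounded[OF F] by auto
    let ?N = "conj_square_norm {..<n} x"
    have N0: "0 \<le> ?N" by (rule conj_square_norm_nonneg[OF finite_lessThan x])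
    have N: "conj_square_test {..<n} x ?N" by (rule conj_square_norm_test[OF finite_lessThan x])
    have "(\<Sum>i<n. (norm (v (x i)))\<^sup>2) = (\<Sum>d\<in>D. \<Sum>i<n. \<mu> (fst d) * (cmod (\<psi> d (x i)))\<^sup>2)"
      unfolding v_norm by (rule sum.swap)
    also have "\<dots> = (\<Sum>\<omega>\<in>\<Omega>. \<mu> \<omega> * (\<Sum>k<m' \<omega>. \<Sum>l<m \<omega>. \<Sum>i<n. (cmod (cinner (x i (h \<omega> l)) (h' \<omega> k)))\<^sup>2))"
      unfolding sumD by (simp add: \<psi>_def sum_distrib_left)
    \<comment> \<open>Every test has Gram squares at most \<open>1\<close> and so contributes at
      most \<open>?N\<^sup>2\<close>; the weights sum to \<open>1\<close>.\<close>
    also have "\<dots> \<le> (\<Sum>\<omega>\<in>\<Omega>. \<mu> \<omega> * ?N\<^sup>2)"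
    proof (rule sum_mono, rule mult_left_mono)
      fix \<omega> assume w: "\<omega> \<in> \<Omega>"
      have "(\<Sum>k<m' \<omega>. \<Sum>l<m \<omega>. \<Sum>i<n. (cmod (cinner (x i (h \<omega> l)) (h' \<omega> k)))\<^sup>2)
          = (\<Sum>k<m' \<omega>. \<Sum>i<n. \<Sum>l<m \<omega>. (cmod (cinner (x i (h \<omega> l)) (h' \<omega> k)))\<^sup>2)"
        by (intro sum.cong refl sum.swap)
      also have "\<dots> = (\<Sum>i<n. \<Sum>k<m' \<omega>. \<Sum>l<m \<omega>. (cmod (cinner (x i (h \<omega> l)) (h' \<omega> k)))\<^sup>2)" by (rule sum.swap)
      also have "\<dots> \<le> ?N\<^sup>2 * sqrt (gram_square (m \<omega>) (h \<omega>) * gram_square (m' \<omega>) (h' \<omega>))"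
        using N unfolding conj_square_test_def by simp
      also have "\<dots> \<le> ?N\<^sup>2 * 1"
      proof (rule mult_left_mono)
        have "gram_square (m \<omega>) (h \<omega>) * gram_square (m' \<omega>) (h' \<omega>) \<le> 1 * 1"
          by (intro mult_mono G1[OF w] gram_square_nonneg) simp
        then show "sqrt (gram_square (m \<omega>) (h \<omega>) * gram_square (m' \<omega>) (h' \<omega>)) \<le> 1" by simp
      qed simp
      finally show "(\<Sum>k<m' \<omega>. \<Sum>l<m \<omega>. \<Sum>i<n. (cmod (cinner (x i (h \<omega> l)) (h' \<omega> k)))\<^sup>2) \<le> ?N\<^sup>2" by simp
    qed (use \<mu>(1) in simp)
    also have "\<dots> = ?N\<^sup>2" using \<mu>(2) by (simp flip: sum_distrib_right)
    finally show "L2_set (\<lambda>i. norm (v (x i))) {..<n} \<le> 1 * ?N"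
      unfolding L2_set_def using N0 by (simp add: real_le_lsqrt)
  qed simp
  from fact[OF v this] obtain B :: "('h \<Rightarrow>\<^sub>L 'h) \<Rightarrow> nat ell2" and A :: "nat ell2 \<Rightarrow> nat ell2"
    where B: "completely_bounded (opsp E) (OH UNIV) B" and A: "hilbert_schmidt A"
      and vAB: "\<And>x. x \<in> E \<Longrightarrow> v (u x) = A (B x)" and C: "hs_norm A * cb_norm (opsp E) (OH UNIV) B \<le> C" by blast
  define b where "b = cb_norm (opsp E) (OH UNIV) B"
  have B_lin: "clinear_between E (ell2_space UNIV) B" using B by (simp add: completely_bounded_def)
  have cb: "cb_bound (opsp E) (OH UNIV) B b" unfolding b_def by (rule cb_bound_cb_norm_opsp[OF B])
  have b: "0 \<le> b" using cb by (simp add: cb_bound_def)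
  let ?s = "induced_form E B b"
  have s: "oh_form E ?s" by (rule oh_form_induced_form[OF E B_lin cb])
  have A_lin: "clinear_between UNIV UNIV A"
    using A bounded_clinear_betweenD(1)[of UNIV UNIV A] by (simp add: hilbert_schmidt_def)
  define R where "R = (\<Sum>d\<in>D. \<mu> (fst d) * Re (?s (Z d) (Z d)))"
  have R0: "0 \<le> R"
    unfolding R_def
  proof (intro sum_nonneg mult_nonneg_nonneg)
    fix d assume d: "d \<in> D"
    then show "0 \<le> \<mu> (fst d)" using \<mu>(1) by (auto simp: D_def)
    show "0 \<le> Re (?s (Z d) (Z d))" using s psd_form_nonneg[of E ?s "Z d"] ZE[OF d] by (simp add: oh_form_def)
  qed
  let ?T = "\<Sum>d\<in>D. of_real (\<mu> (fst d)) * \<psi> d (u (Z d))"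
  have "cmod ?T \<le> C * sqrt R"
  proof -
    \<comment> \<open>One square root of the weight sits in the coordinates of \<open>v\<close>. The
      other is moved into the argument of \<open>A\<close>, where its square restores the weight in
      \<open>R\<close>.\<close>
    have "?T = (\<Sum>d\<in>D. ell2_nth (A (of_real (r d) *\<^sub>C B (Z d))) (\<beta> d))"
    proof (intro sum.cong refl)
      fix d assume d: "d \<in> D"
      have "of_real (\<mu> (fst d)) = complex_of_real (r d) * of_real (r d)"
        using r(2)[OF d] by (simp add: power2_eq_square flip: of_real_mult)
      then have "of_real (\<mu> (fst d)) * \<psi> d (u (Z d)) = of_real (r d) * ell2_nth (v (u (Z d))) (\<beta> d)"
        by (simp add: v_nth[OF d])
      also have "\<dots> = ell2_nth (A (of_real (r d) *\<^sub>C B (Z d))) (\<beta> d)"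
        by (simp add: vAB[OF ZE[OF d]] clinear_between_scale[OF A_lin])
      finally show "of_real (\<mu> (fst d)) * \<psi> d (u (Z d)) = ell2_nth (A (of_real (r d) *\<^sub>C B (Z d))) (\<beta> d)" .
    qed
    then have "cmod ?T \<le> hs_norm A * sqrt (\<Sum>d\<in>D. (norm (of_real (r d) *\<^sub>C B (Z d)))\<^sup>2)"
      using hilbert_schmidt_test[OF A D \<beta>] by simp
    also have "(\<Sum>d\<in>D. (norm (of_real (r d) *\<^sub>C B (Z d)))\<^sup>2) = b\<^sup>2 * R"
      unfolding R_def sum_distrib_left
      by (intro sum.cong refl) (simp add: norm_scaleC power_mult_distrib r induced_form_self(1)[OF cb ZE] mult_ac)
    also have "sqrt (b\<^sup>2 * R) = b * sqrt R" using b by (simp add: real_sqrt_mult)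
    also have "hs_norm A * (b * sqrt R) \<le> C * sqrt R"
      using mult_right_mono[OF C, of "sqrt R"] R0 by (simp add: b_def mult.assoc)
    finally show ?thesis .
  qed
  moreover have "(\<Sum>\<omega>\<in>\<Omega>. \<mu> \<omega> * excess u \<omega> ?s) = 2 * Re ?T - R"
    unfolding excess R_def sumD
    by (simp add: right_diff_distrib sum_subtractf sum_distrib_left \<psi>_def Z_def mult_ac)
  moreover have "Re ?T \<le> cmod ?T" by (rule complex_Re_le_cmod)
  moreover have "0 \<le> (C - sqrt R)\<^sup>2" by simp
  then have "2 * (C * sqrt R) \<le> C\<^sup>2 + R" using R0 by (simp add: power2_diff)
  ultimately have "(\<Sum>\<omega>\<in>\<Omega>. \<mu> \<omega> * excess u \<omega> ?s) \<le> C\<^sup>2" by linarith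
  then show ?thesis using s by blast
qed

text \<open>The image of the basis has \<open>conj_square_norm\<close> at most \<open>c\<close>, to
  which the summing inequality applies once \<open>J\<close> is enumerated by an initial
  segment.\<close>

lemma two_oh_summing_basis_image:
  assumes F: "operator_space F" and A: "clinear_between (ell2_space UNIV) F A"
    and cb: "cb_bound (OH UNIV) (opsp F) A c" and v: "two_oh_bound F v 1" and J: "finite J"
  shows "(\<Sum>i\<in>J. (norm (v (A (ell2_basis i))))\<^sup>2) \<le> c\<^sup>2"
proof -
  have c: "0 \<le> c" using cb by (simp add: cb_bound_def)
  obtain \<beta> where "bij_betw \<beta> {0..<card J} J" using ex_bij_betw_nat_finite[OF J] by blast
  then have \<beta>: "bij_betw \<beta> {..<card J} J" by (simp add: atLeast0LessThan)
  have AF: "A x \<in> F" for x using clinear_between_mem[OF A] by (simp add: ell2_space_def)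
  then have Ab: "A x \<in> bounded_operators" for x using operator_space_bounded[OF F] by blast
  have "conj_square_test J (\<lambda>i. A (ell2_basis i)) c"
    using conj_square_norm_basis_image_le[OF operator_space_bounded[OF F] A cb J] conj_square_norm_le_iff[OF J Ab c] by simp
  moreover have "(\<Sum>i<card J. \<Sum>k<m'. \<Sum>l<m. (cmod (cinner (A (ell2_basis (\<beta> i)) (h l)) (h' k)))\<^sup>2)
      = (\<Sum>i\<in>J. \<Sum>k<m'. \<Sum>l<m. (cmod (cinner (A (ell2_basis i) (h l)) (h' k)))\<^sup>2)" for m m' :: nat and h h'
    by (rule sum.reindex_bij_betw[OF \<beta>])
  ultimately have "conj_square_test {..<card J} (\<lambda>i. A (ell2_basis (\<beta> i))) c"
    unfolding conj_square_test_def by (simp only: simp_thms)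
  then have N: "conj_square_norm {..<card J} (\<lambda>i. A (ell2_basis (\<beta> i))) \<le> c"
    using conj_square_norm_le_iff[OF finite_lessThan Ab c] by simp
  have "L2_set (\<lambda>i. norm (v (A (ell2_basis (\<beta> i))))) {..<card J} \<le> 1 * conj_square_norm {..<card J} (\<lambda>i. A (ell2_basis (\<beta> i)))"
    using v AF unfolding two_oh_bound_def by simp
  then have "sqrt (\<Sum>i<card J. (norm (v (A (ell2_basis (\<beta> i)))))\<^sup>2) \<le> c" using N by (simp add: L2_set_def)
  then have "(\<Sum>i<card J. (norm (v (A (ell2_basis (\<beta> i)))))\<^sup>2) \<le> c\<^sup>2" by (rule sqrt_le_D)
  then show ?thesis using sum.reindex_bij_betw[OF \<beta>, of "\<lambda>i. (norm (v (A (ell2_basis i))))\<^sup>2"] by simp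
qed

theorem theorem2:
  fixes E :: "('h::chilbert_space \<Rightarrow>\<^sub>L 'h) set"
    and F :: "('k::chilbert_space \<Rightarrow>\<^sub>L 'k) set"
    and C :: real
    and u :: "('h \<Rightarrow>\<^sub>L 'h) \<Rightarrow> ('k \<Rightarrow>\<^sub>L 'k)"
  assumes "operator_space E" and "operator_space F" and "C > 0"
    and "bounded_clinear_between E F u"
  shows "u \<in> Gamma_oh TYPE('i + ('h \<Rightarrow>\<^sub>L 'h)) E F \<and> gamma_oh TYPE('i + ('h \<Rightarrow>\<^sub>L 'h)) E F u \<le> C \<longleftrightarrow>
    (\<forall>v :: ('k \<Rightarrow>\<^sub>L 'k) \<Rightarrow> nat ell2.
      bounded_clinear_between F UNIV v \<and> two_oh_summing F v \<and> pi_2oh F v \<le> 1 \<longrightarrow>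
      (\<exists>(B :: ('h \<Rightarrow>\<^sub>L 'h) \<Rightarrow> nat ell2) (A :: nat ell2 \<Rightarrow> nat ell2).
        completely_bounded (opsp E) (OH UNIV) B \<and> hilbert_schmidt A \<and>
        (\<forall>x\<in>E. v (u x) = A (B x)) \<and>
        hs_norm A * cb_norm (opsp E) (OH UNIV) B \<le> C))"
    (is "?i \<longleftrightarrow> ?ii")
proof -
  note E = assms(1) and F = assms(2)
  have C: "0 \<le> C" using assms(3) by simp
  have u: "clinear_between E F u" by (rule bounded_clinear_betweenD(1)[OF assms(4)])
  show ?thesis
  proof
    assume i: ?i
    let ?S = "{cb_norm (OH I) (opsp F) A * cb_norm (opsp E) (OH I) B |
      (I :: ('i + ('h \<Rightarrow>\<^sub>L 'h)) set) A B. oh_factorization E F u I A B}"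
    have "\<exists>s. oh_form E s \<and> (\<forall>\<omega>\<in>excess_tests E. excess u \<omega> s \<le> C\<^sup>2)"
    proof (rule oh_form_compactness[OF continuous_on_excess])
      fix \<Omega>' :: "('h, 'k) excess_test set" and e :: real assume \<Omega>': "\<Omega>' \<subseteq> excess_tests E" and e: "0 < e"
      \<comment> \<open>For \<open>\<delta>\<close> at most \<open>1\<close> the square of
        \<open>C + \<delta>\<close> is at most \<open>C\<^sup>2 + \<delta> * (2 * C + 1)\<close>,
        and this must not exceed \<open>C\<^sup>2 + e\<close>.\<close>
      define \<delta> where "\<delta> = min 1 (e / (2 * C + 1))"
      have d: "0 < \<delta>" "\<delta> \<le> 1" using e C by (simp_all add: \<delta>_def)
      have de: "\<delta> * (2 * C + 1) \<le> e"
      proof -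
        have "\<delta> * (2 * C + 1) \<le> e / (2 * C + 1) * (2 * C + 1)"
          using C by (intro mult_right_mono) (simp_all add: \<delta>_def)
        then show ?thesis using C by simp
      qed
      have "\<exists>(I :: ('i + ('h \<Rightarrow>\<^sub>L 'h)) set) A B. oh_factorization E F u I A B"
        using conjunct1[OF i] unfolding Gamma_oh_def by (rule CollectD)
      then have "?S \<noteq> {}" by auto
      moreover have "gamma_oh TYPE('i + ('h \<Rightarrow>\<^sub>L 'h)) E F u < C + \<delta>" using conjunct2[OF i] d(1) by simp
      then have "Inf ?S < C + \<delta>" by (simp only: gamma_oh_def)
      ultimately obtain p where p: "p \<in> ?S" "p < C + \<delta>" by (rule cInf_lessD[THEN bexE])
      from p(1) obtain I :: "('i + ('h \<Rightarrow>\<^sub>L 'h)) set" and A B where fact: "oh_factorization E F u I A B"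
        and p_eq: "p = cb_norm (OH I) (opsp F) A * cb_norm (opsp E) (OH I) B"
        by (elim CollectE exE conjE) (rule that)
      have less: "cb_norm (OH I) (opsp F) A * cb_norm (opsp E) (OH I) B < C + \<delta>" using p(2) unfolding p_eq .
      define a b where "a = cb_norm (OH I) (opsp F) A" and "b = cb_norm (opsp E) (OH I) B"
      have cA: "completely_bounded (OH I) (opsp F) A" and cB: "completely_bounded (opsp E) (OH I) B"
        and uAB: "\<And>x. x \<in> E \<Longrightarrow> u x = A (B x)" using fact unfolding oh_factorization_def by auto
      have cbA: "cb_bound (OH I) (opsp F) A a" unfolding a_def by (rule cb_bound_cb_norm_OH[OF cA])
      have cbB: "cb_bound (opsp E) (OH I) B b" unfolding b_def by (rule cb_bound_cb_norm_opsp[OF cB])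
      have A: "clinear_between (ell2_space I) F A" and B: "clinear_between E (ell2_space I) B"
        using cA cB by (simp_all add: completely_bounded_def)
      have ab: "0 \<le> a * b" using cbA cbB by (simp add: cb_bound_def)
      have "(a * b)\<^sup>2 \<le> (C + \<delta>)\<^sup>2" using less ab by (intro power_mono) (simp_all add: a_def b_def)
      also have "\<dots> = C\<^sup>2 + \<delta> * (2 * C + \<delta>)" by (simp add: power2_eq_square algebra_simps)
      also have "\<dots> \<le> C\<^sup>2 + \<delta> * (2 * C + 1)" using d by (intro add_left_mono mult_left_mono) auto
      finally have abC: "(a * b)\<^sup>2 \<le> C\<^sup>2 + e" using de by linarith
      have s: "oh_form E (induced_form E B b)" by (rule oh_form_induced_form[OF E B cbB])
      have "excess u \<omega> (induced_form E B b) \<le> C\<^sup>2 + e" if "\<omega> \<in> \<Omega>'" for \<omega>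
        using excess_le_of_oh_dominated[OF oh_dominated_factorization[OF F A B cbA cbB uAB] ab s, of \<omega>] that \<Omega>' abC
        by auto
      then show "\<exists>s. oh_form E s \<and> (\<forall>\<omega>\<in>\<Omega>'. excess u \<omega> s \<le> C\<^sup>2 + e)" using s by blast
    qed
    then obtain s where s: "oh_form E s" and le: "\<And>\<omega>. \<omega> \<in> excess_tests E \<Longrightarrow> excess u \<omega> s \<le> C\<^sup>2" by blast
    have dom: "oh_dominated E u C s" by (rule oh_dominated_of_excess_le[OF E F u s]) (rule le)
    obtain A and B :: "('h \<Rightarrow>\<^sub>L 'h) \<Rightarrow> ('i + ('h \<Rightarrow>\<^sub>L 'h)) ell2" where fact: "oh_factorization E F u UNIV A B"
      and cbB: "cb_bound (opsp E) (OH UNIV) B 1" and cbA: "cb_bound (OH UNIV) (opsp F) A C"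
      by (rule factorization_of_oh_form[OF E F u s C dom]) (rule that)
    have A: "clinear_between (ell2_space UNIV) F A" and B: "clinear_between E (ell2_space UNIV) B"
      and uAB: "\<And>x. x \<in> E \<Longrightarrow> u x = A (B x)"
      using fact unfolding oh_factorization_def completely_bounded_def by auto
    show ?ii
    proof (intro allI impI)
      fix v :: "('k \<Rightarrow>\<^sub>L 'k) \<Rightarrow> nat ell2"
      assume v: "bounded_clinear_between F UNIV v \<and> two_oh_summing F v \<and> pi_2oh F v \<le> 1"
      have v_lin: "clinear_between F UNIV v" using v bounded_clinear_betweenD(1) by blast
      obtain K where K: "\<And>y. y \<in> F \<Longrightarrow> norm (v y) \<le> K * norm y" using v bounded_clinear_betweenD(2)[of F UNIV v] by blast
      have v1: "two_oh_bound F v 1"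
        unfolding two_oh_bound_def
      proof (intro conjI allI impI)
        fix n :: nat and x assume x: "\<forall>i<n. x i \<in> F"
        then have "0 \<le> conj_square_norm {..<n} x"
          using operator_space_bounded[OF F] by (intro conj_square_norm_nonneg) auto
        then have "pi_2oh F v * conj_square_norm {..<n} x \<le> 1 * conj_square_norm {..<n} x"
          using v by (intro mult_right_mono) auto
        moreover have "two_oh_bound F v (pi_2oh F v)"
          using v by (intro two_oh_bound_pi_2oh operator_space_bounded[OF F]) simp
        then have "L2_set (\<lambda>i. norm (v (x i))) {..<n} \<le> pi_2oh F v * conj_square_norm {..<n} x"
          using x unfolding two_oh_bound_def by blast
        ultimately show "L2_set (\<lambda>i. norm (v (x i))) {..<n} \<le> 1 * conj_square_norm {..<n} x" by linarith
      qed simp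
      have AF: "A x \<in> F" for x using clinear_between_mem[OF A] by (simp add: ell2_space_def)
      have "clinear_between UNIV UNIV (\<lambda>x. v (A x))"
        using clinear_between_add[OF A] clinear_between_scale[OF A]
        unfolding clinear_between_def
        by (auto simp: ell2_space_def clinear_between_add[OF v_lin AF AF] clinear_between_scale[OF v_lin AF])
      moreover have "norm (v (A x)) \<le> (\<bar>K\<bar> * C) * norm x" for x
      proof -
        have "norm (v (A x)) \<le> K * norm (A x)" by (rule K[OF AF])
        also have "\<dots> \<le> \<bar>K\<bar> * norm (A x)" by (intro mult_right_mono) auto
        also have "\<dots> \<le> \<bar>K\<bar> * (C * norm x)"
          by (intro mult_left_mono cb_bound_OH_norm_le[OF cbA]) (simp_all add: ell2_space_def)
        finally show ?thesis by (simp add: mult.assoc)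
      qed
      ultimately have vA: "bounded_clinear_between UNIV UNIV (\<lambda>x. v (A x))"
        unfolding bounded_clinear_between_def by blast
      have vA_sum: "(\<Sum>i\<in>J. (norm (v (A (ell2_basis i))))\<^sup>2) \<le> C\<^sup>2" if "finite J" for J
        by (rule two_oh_summing_basis_image[OF F A cbA v1 that])
      \<comment> \<open>The form is realized over the large index type, while property (ii) demands
        a factorization through sequences.\<close>
      obtain B' :: "('h \<Rightarrow>\<^sub>L 'h) \<Rightarrow> nat ell2" and A' :: "nat ell2 \<Rightarrow> nat ell2"
        where B': "clinear_between E (ell2_space UNIV) B'" "cb_bound (opsp E) (OH UNIV) B' 1"
          and A': "hilbert_schmidt A'" "hs_norm A' \<le> C" and AB': "\<And>x. A' (B' x) = v (A (B x))"
        by (rule separable_reduction[OF E vA C vA_sum B cbB], assumption) (rule that)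
      have "completely_bounded (opsp E) (OH UNIV) B'" using B' by (auto simp: completely_bounded_def)
      moreover have "\<forall>x\<in>E. v (u x) = A' (B' x)" by (simp add: AB' uAB)
      moreover have "hs_norm A' * cb_norm (opsp E) (OH UNIV) B' \<le> C"
      proof -
        have "hs_norm A' * cb_norm (opsp E) (OH UNIV) B' \<le> hs_norm A' * 1"
          by (intro mult_left_mono cb_norm_le B' hs_norm_nonneg)
        then show ?thesis using A'(2) by simp
      qed
      ultimately show "\<exists>(B :: ('h \<Rightarrow>\<^sub>L 'h) \<Rightarrow> nat ell2) (A :: nat ell2 \<Rightarrow> nat ell2).
        completely_bounded (opsp E) (OH UNIV) B \<and> hilbert_schmidt A \<and>
        (\<forall>x\<in>E. v (u x) = A (B x)) \<and> hs_norm A * cb_norm (opsp E) (OH UNIV) B \<le> C"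
        using A'(1) by blast
    qed
  next
    assume ii: ?ii
    have fact: "\<exists>(B :: ('h \<Rightarrow>\<^sub>L 'h) \<Rightarrow> nat ell2) (A :: nat ell2 \<Rightarrow> nat ell2).
        completely_bounded (opsp E) (OH UNIV) B \<and> hilbert_schmidt A \<and>
        (\<forall>x\<in>E. v (u x) = A (B x)) \<and> hs_norm A * cb_norm (opsp E) (OH UNIV) B \<le> C"
      if "bounded_clinear_between F UNIV v" "two_oh_bound F v 1" for v :: "('k \<Rightarrow>\<^sub>L 'k) \<Rightarrow> nat ell2"
      using ii that pi_2oh_le[OF that(2)] unfolding two_oh_summing_def by blast
    have "\<exists>s. oh_form E s \<and> (\<forall>\<omega>\<in>excess_tests E. excess u \<omega> s \<le> C\<^sup>2)"
    proof (rule oh_form_compactness[OF continuous_on_excess])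
      fix \<Omega>' :: "('h, 'k) excess_test set" and e :: real assume \<Omega>': "finite \<Omega>'" "\<Omega>' \<subseteq> excess_tests E" and e: "0 < e"
      show "\<exists>s. oh_form E s \<and> (\<forall>\<omega>\<in>\<Omega>'. excess u \<omega> s \<le> C\<^sup>2 + e)"
      proof (cases "\<Omega>' = {}")
        case True
        then show ?thesis using oh_form_zero by blast
      next
        case False
        have "\<exists>s\<in>Collect (oh_form E). \<forall>\<omega>\<in>\<Omega>'. excess u \<omega> s \<le> C\<^sup>2 + e"
        proof (rule minimax_finite[OF \<Omega>'(1) False _ _ e])
          fix s s' and t :: real assume "s \<in> Collect (oh_form E)" "s' \<in> Collect (oh_form E)" "0 \<le> t" "t \<le> 1"
          then show "\<exists>s''\<in>Collect (oh_form E). \<forall>\<omega>\<in>\<Omega>'. excess u \<omega> s'' \<le> (1 - t) * excess u \<omega> s + t * excess u \<omega> s'"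
            by (intro bexI[of _ "\<lambda>x y. of_real (1 - t) * s x y + of_real t * s' x y"])
               (simp_all add: excess_mix oh_form_mix del: of_real_diff)
        next
          fix \<mu> :: "('h, 'k) excess_test \<Rightarrow> real"
          assume \<mu>: "\<forall>\<omega>\<in>\<Omega>'. 0 \<le> \<mu> \<omega>" "(\<Sum>\<omega>\<in>\<Omega>'. \<mu> \<omega>) = 1"
          have "\<exists>s. oh_form E s \<and> (\<Sum>\<omega>\<in>\<Omega>'. \<mu> \<omega> * excess u \<omega> s) \<le> C\<^sup>2"
            by (rule form_for_weighted_tests[OF E F u _ \<Omega>' \<mu>]) (rule fact)
          then show "\<exists>s\<in>Collect (oh_form E). (\<Sum>\<omega>\<in>\<Omega>'. \<mu> \<omega> * excess u \<omega> s) \<le> C\<^sup>2" by blast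
        qed
        then show ?thesis by blast
      qed
    qed
    then obtain s where s: "oh_form E s" and le: "\<And>\<omega>. \<omega> \<in> excess_tests E \<Longrightarrow> excess u \<omega> s \<le> C\<^sup>2" by blast
    have dom: "oh_dominated E u C s" by (rule oh_dominated_of_excess_le[OF E F u s]) (rule le)
    obtain A and B :: "('h \<Rightarrow>\<^sub>L 'h) \<Rightarrow> ('i + ('h \<Rightarrow>\<^sub>L 'h)) ell2" where f: "oh_factorization E F u UNIV A B"
      and cbB: "cb_bound (opsp E) (OH UNIV) B 1" and cbA: "cb_bound (OH UNIV) (opsp F) A C"
      by (rule factorization_of_oh_form[OF E F u s C dom]) (rule that)
    \<comment> \<open>These bounds make \<open>0\<close> a lower bound of the products, so that
      their infimum lies below the product found here.\<close>
    have nonneg: "0 \<le> cb_norm (OH I) (opsp F) A" "0 \<le> cb_norm (opsp E) (OH I) B"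
      if "oh_factorization E F u I A B" for I :: "('i + ('h \<Rightarrow>\<^sub>L 'h)) set" and A B
      using that cb_bound_cb_norm_OH[of I "opsp F" A] cb_bound_cb_norm_opsp[of E "OH I" B]
      by (simp_all add: oh_factorization_def cb_bound_def)
    have "gamma_oh TYPE('i + ('h \<Rightarrow>\<^sub>L 'h)) E F u \<le> cb_norm (OH UNIV) (opsp F) A * cb_norm (opsp E) (OH UNIV) B"
      unfolding gamma_oh_def
    proof (rule cInf_lower)
      show "bdd_below {cb_norm (OH I) (opsp F) A * cb_norm (opsp E) (OH I) B |
          (I :: ('i + ('h \<Rightarrow>\<^sub>L 'h)) set) A B. oh_factorization E F u I A B}"
        by (rule bdd_belowI[of _ 0]) (auto intro!: mult_nonneg_nonneg nonneg)
    qed (use f in blast)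
    also have "\<dots> \<le> C * 1"
      by (intro mult_mono cb_norm_le cbA cbB nonneg[OF f] C)
    finally show ?i using f unfolding Gamma_oh_def by auto
  qed
qed

end
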